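(* Let $P:\mathbb{C}\to\mathbb{R}$ be smooth, subharmonic and non-harmonic, let $\Omega=\{(z_1,z_2)\in\mathbb{C}^2:\Im(z_2)>P(z_1)\}$, and identify ${\rm b}\Omega$ with $\mathbb{C}\times\mathbb{R}$. Then for every $p=(z_0,t_0)\in{\rm b}\Omega$ and every $\delta>0$, $$\Lambda(p,\delta)=\sup_{R}\ \sum_{R_i\in R}\int_{R_i}\Delta P(w)\,dm(w),$$ where the supremum is taken over all $(z_0,\delta)$-stockyards $R$.
   Context: ${\rm b}\Omega$ denotes the boundary of $\Omega$, and is identified with $\mathbb{C}\times\mathbb{R}$ via $(z,t+iP(z))\sim(z,t)\sim(x,y,t)$, $z=x+iy$. $dm$ is Lebesgue measure on $\mathbb{C}\cong\mathbb{R}^2$ and $\Delta=\partial_x^2+\partial_y^2$. $FPWS[0,1]$: real functions $f$ on $[0,1]$ for which there are finitely many points $0=a_0<a_1<\dots<a_N<a_{N+1}=1$ such that, for each $i$, $f$ is smooth on $(a_i,a_{i+1})$ and $f|_{(a_i,a_{i+1})}$ extends continuously to $[a_i,a_{i+1}]$. For $A\subset\mathbb{R}^2$, the boundary ${\rm b}A$ is said to be $FPWS$ if it can be locally parametrized by an $FPWS$ function. $\mathscr{X}^\ast$ is the set of pairs $(\alpha,\beta)$ with $\alpha,\beta\in FPWS[0,1]$, $|\alpha(s)|^2+|\beta(s)|^2<1$, $\int_0^1\alpha=\int_0^1\beta=0$. For $z_0=x_0+iy_0$, $\delta>0$ and $(\alpha,\beta)\in\mathscr{X}^\ast$ let $\gamma_1(r)=x_0+\frac{\delta}{2}\int_0^r\alpha(s)ds$,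 $\gamma_2(r)=y_0-\frac{\delta}{2}\int_0^r\beta(s)ds$, and $$\Lambda_{z_0,\delta}(\alpha,\beta)=\int_0^1\left[\partial_yP(\gamma_1(r),\gamma_2(r))\gamma_1'(r)-\partial_xP(\gamma_1(r),\gamma_2(r))\gamma_2'(r)\right]dr.$$ For $p=(z_0,t_0)$ define $\Lambda(p,\delta)=\sup_{(\alpha,\beta)\in\mathscr{X}^\ast}|\Lambda_{z_0,\delta}(\alpha,\beta)|$. The length of the planar curve $(\gamma_1,\gamma_2)$ is denoted $L:=\delta\int_0^1\sqrt{|\alpha(t)|^2+|\beta(t)|^2}\,dt$. A pen is a set $A\subset\mathbb{C}$ that is open, connected and simply connected and whose boundary ${\rm b}A$ is $FPWS$. The amount of fencing used to enclose $A$ is $L({\rm b}A)$, the perimeter of $A$. For $z_0\in\mathbb{C}$ and $\delta>0$, a $(z_0,\delta)$-stockyard is a finite collection of pens $R=\{R_1,\dots,R_N\}$ (the same pen may occur more than once) such that $z_0\in\bigcup_{i=1}^N{\rm b}R_i$, the sum of the perimeters of $R_1,\dots,R_N$ is at most $\delta$, and $\bigcup_{i=1}^N{\rm b}R_i$ is connected.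
   Formalization: Perimeters are measured by L, which is twice Euclidean length (with Euclidean perimeter the formula fails for P=|z|^2); boundaries of pens are locally injective arcs (no slits or pinch points), and the whole plane, having no enclosing curve, is not a usable pen. *)

theory Defs
  imports "HOL-Analysis.Analysis"
begin

section \<open>Smooth, subharmonic and harmonic functions on the plane\<close>

definition pd_x :: "(complex \<Rightarrow> real) \<Rightarrow> complex \<Rightarrow> real" where
  "pd_x f z = deriv (\<lambda>s. f (Complex s (Im z))) (Re z)"

definition pd_y :: "(complex \<Rightarrow> real) \<Rightarrow> complex \<Rightarrow> real" where
  "pd_y f z = deriv (\<lambda>s. f (Complex (Re z) s)) (Im z)"

definition laplacian :: "(complex \<Rightarrow> real) \<Rightarrow> complex \<Rightarrow> real" where
  "laplacian f z = pd_x (pd_x f) z + pd_y (pd_y f) z"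

text \<open>
  \<open>C\<^sup>\<infinity>\<close> in the real sense: every iterated partial derivative exists and is (Frechet)
  differentiable, hence in particular continuous, on the whole plane.
\<close>

definition smooth_plane :: "(complex \<Rightarrow> real) \<Rightarrow> bool" where
  "smooth_plane f \<longleftrightarrow>
     (\<forall>ds. set ds \<subseteq> {pd_x, pd_y} \<longrightarrow> (\<forall>z. fold (\<lambda>D g. D g) ds f differentiable (at z)))"

text \<open>
  Real-valued subharmonic functions on the plane. A subharmonic function that never takes the
  value \<open>-\<infinity>\<close> is integrable on circles, so requiring integrability loses nothing.
\<close>

definition subharmonic :: "(complex \<Rightarrow> real) \<Rightarrow> bool" where
  "subharmonic f \<longleftrightarrow>
     (\<forall>a. open {z. f z < a}) \<and>
     (\<forall>z. \<forall>r>0. (\<lambda>\<theta>. f (z + of_real r * cis \<theta>)) integrable_on {0..2 * pi} \<and>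
        f z \<le> 1 / (2 * pi) * integral {0..2 * pi} (\<lambda>\<theta>. f (z + of_real r * cis \<theta>)))"

text \<open>Used for smooth functions only, so no regularity requirement is repeated here.\<close>

definition harmonic :: "(complex \<Rightarrow> real) \<Rightarrow> bool" where
  "harmonic f \<longleftrightarrow> (\<forall>z. laplacian f z = 0)"


section \<open>The domain and the identification of its boundary\<close>

definition Omega :: "(complex \<Rightarrow> real) \<Rightarrow> (complex \<times> complex) set" where
  "Omega P = {(z1, z2). Im z2 > P z1}"

definition boundary_point :: "(complex \<Rightarrow> real) \<Rightarrow> complex \<times> real \<Rightarrow> complex \<times> complex" where
  "boundary_point P = (\<lambda>(z, t). (z, Complex t (P z)))"


section \<open>FPWS functions and the function \<open>\<Lambda>\<close>\<close>

definition smooth_interval :: "real \<Rightarrow> real \<Rightarrow> (real \<Rightarrow> real) \<Rightarrow> bool" where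
  "smooth_interval a b f \<longleftrightarrow> (\<forall>k. \<forall>x\<in>{a<..<b}. (deriv ^^ k) f differentiable (at x))"

text \<open>Only the values on \<open>[0,1]\<close> matter; the breakpoints are \<open>a 0, \<dots>, a (N + 1)\<close>.\<close>

definition FPWS :: "(real \<Rightarrow> real) \<Rightarrow> bool" where
  "FPWS f \<longleftrightarrow>
     (\<exists>N (a :: nat \<Rightarrow> real). a 0 = 0 \<and> a (N + 1) = 1 \<and>
        (\<forall>i\<le>N. a i < a (i + 1) \<and> smooth_interval (a i) (a (i + 1)) f \<and>
           (\<exists>g. continuous_on {a i..a (i + 1)} g \<and> (\<forall>x\<in>{a i<..<a (i + 1)}. g x = f x))))"

definition Xstar :: "((real \<Rightarrow> real) \<times> (real \<Rightarrow> real)) set" where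
  "Xstar = {(\<alpha>, \<beta>). FPWS \<alpha> \<and> FPWS \<beta> \<and>
     (\<forall>s\<in>{0..1}. \<bar>\<alpha> s\<bar>\<^sup>2 + \<bar>\<beta> s\<bar>\<^sup>2 < 1) \<and>
     integral {0..1} \<alpha> = 0 \<and> integral {0..1} \<beta> = 0}"

definition gamma1 :: "complex \<Rightarrow> real \<Rightarrow> (real \<Rightarrow> real) \<Rightarrow> real \<Rightarrow> real" where
  "gamma1 z0 \<delta> \<alpha> r = Re z0 + \<delta> / 2 * integral {0..r} \<alpha>"

definition gamma2 :: "complex \<Rightarrow> real \<Rightarrow> (real \<Rightarrow> real) \<Rightarrow> real \<Rightarrow> real" where
  "gamma2 z0 \<delta> \<beta> r = Im z0 - \<delta> / 2 * integral {0..r} \<beta>"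

text \<open>
  The derivatives of \<open>gamma1\<close> and \<open>gamma2\<close> exist off a finite set, which the integral ignores.
\<close>

definition Lambda_curve ::
  "(complex \<Rightarrow> real) \<Rightarrow> complex \<Rightarrow> real \<Rightarrow> (real \<Rightarrow> real) \<Rightarrow> (real \<Rightarrow> real) \<Rightarrow> real" where
  "Lambda_curve P z0 \<delta> \<alpha> \<beta> =
     integral {0..1} (\<lambda>r.
       pd_y P (Complex (gamma1 z0 \<delta> \<alpha> r) (gamma2 z0 \<delta> \<beta> r)) * deriv (gamma1 z0 \<delta> \<alpha>) r -
       pd_x P (Complex (gamma1 z0 \<delta> \<alpha> r) (gamma2 z0 \<delta> \<beta> r)) * deriv (gamma2 z0 \<delta> \<beta>) r)"

definition Lambda :: "(complex \<Rightarrow> real) \<Rightarrow> complex \<times> real \<Rightarrow> real \<Rightarrow> ereal" where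
  "Lambda P p \<delta> = (SUP (\<alpha>, \<beta>)\<in>Xstar. ereal \<bar>Lambda_curve P (fst p) \<delta> \<alpha> \<beta>\<bar>)"


section \<open>Pens and stockyards\<close>

definition FPWS_path :: "(real \<Rightarrow> complex) \<Rightarrow> bool" where
  "FPWS_path \<gamma> \<longleftrightarrow> path \<gamma> \<and> FPWS (Re \<circ> \<gamma>) \<and> FPWS (Im \<circ> \<gamma>)"

text \<open>
  Local parametrizations are injective: near each of its points the boundary is an open arc
  (no slits, no pinch points).
\<close>

definition FPWS_boundary :: "complex set \<Rightarrow> bool" where
  "FPWS_boundary A \<longleftrightarrow>
     (\<forall>w\<in>frontier A. \<exists>U \<gamma>. open U \<and> w \<in> U \<and> FPWS_path \<gamma> \<and> arc \<gamma> \<and>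
        frontier A \<inter> U = \<gamma> ` {0<..<1})"

definition pen :: "complex set \<Rightarrow> bool" where
  "pen A \<longleftrightarrow> open A \<and> connected A \<and> simply_connected A \<and> FPWS_boundary A"

text \<open>
  The length functional \<open>L\<close> of the theory, normalised so that the curve
  \<open>(gamma1 z0 \<delta> \<alpha>, gamma2 z0 \<delta> \<beta>)\<close> has length
  \<open>L = \<delta> \<integral>\<^sub>0\<^sup>1 sqrt (\<bar>\<alpha>\<bar>\<^sup>2 + \<bar>\<beta>\<bar>\<^sup>2)\<close> (lemma \<open>curve_length_gamma\<close> below). As that curve has
  velocity \<open>\<delta>/2 (\<alpha>, -\<beta>)\<close>, \<open>L\<close> is \<^emph>\<open>twice\<close> the Euclidean arc length. The perimeters
  of pens are measured by the same \<open>L\<close>; with plain Euclidean perimeters the two sides of the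
  stockyard formula differ, e.g. by a factor 4 for \<open>P z = \<bar>z\<bar>\<^sup>2\<close>.
\<close>

definition curve_length :: "(real \<Rightarrow> complex) \<Rightarrow> ennreal" where
  "curve_length \<gamma> = (\<integral>\<^sup>+t\<in>{0..1}. ennreal (2 * norm (vector_derivative \<gamma> (at t))) \<partial>lborel)"

text \<open>
  All simple closed parametrizations of the boundary have the same length, so the infimum merely
  picks it out. If there is none the perimeter is \<open>\<infinity>\<close>; this matters for \<open>A = UNIV\<close>, whose
  boundary is empty: the whole plane is not enclosed by a fence of length 0.
\<close>

definition perimeter :: "complex set \<Rightarrow> ennreal" where
  "perimeter A = (INF \<gamma>\<in>{\<gamma>. FPWS_path \<gamma> \<and> simple_path \<gamma> \<and> pathfinish \<gamma> = pathstart \<gamma> \<and>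
     path_image \<gamma> = frontier A}. curve_length \<gamma>)"

text \<open>Stockyards are lists, since the same pen may be used repeatedly.\<close>

definition stockyards :: "complex \<Rightarrow> real \<Rightarrow> complex set list set" where
  "stockyards z0 \<delta> = {R. (\<forall>A\<in>set R. pen A) \<and>
     z0 \<in> (\<Union>A\<in>set R. frontier A) \<and>
     (\<Sum>A\<leftarrow>R. perimeter A) \<le> ennreal \<delta> \<and>
     connected (\<Union>A\<in>set R. frontier A)}"


section \<open>Consistency of the conventions\<close>

lemma frontier_Omega:
  assumes "continuous_on UNIV P"
  shows "frontier (Omega P) = range (boundary_point P)"
proof -
  have cont: "continuous_on UNIV (\<lambda>w :: complex \<times> complex. P (fst w))"
    by (rule continuous_on_compose2[OF assms]) (auto intro!: continuous_intros)
  have eq: "Omega P = {w. P (fst w) < Im (snd w)}"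
    by (auto simp: Omega_def)
  have op: "open (Omega P)"
    unfolding eq by (intro open_Collect_less cont continuous_intros)
  have cl: "closed {w :: complex \<times> complex. P (fst w) \<le> Im (snd w)}"
    by (intro closed_Collect_le cont continuous_intros)
  have "closure (Omega P) = {w. P (fst w) \<le> Im (snd w)}"
  proof
    show "closure (Omega P) \<subseteq> {w. P (fst w) \<le> Im (snd w)}"
      by (rule closure_minimal[OF _ cl]) (auto simp: eq)
    show "{w. P (fst w) \<le> Im (snd w)} \<subseteq> closure (Omega P)"
    proof
      fix w :: "complex \<times> complex"
      assume w: "w \<in> {w. P (fst w) \<le> Im (snd w)}"
      let ?s = "\<lambda>n. (fst w, snd w + \<i> * of_real (inverse (real (Suc n))))"
      have "?s n \<in> Omega P" for n
      proof -
        have "inverse (real (Suc n)) > 0"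
          by simp
        hence "P (fst w) < Im (snd w) + inverse (real (Suc n))"
          using w unfolding mem_Collect_eq by linarith
        thus ?thesis
          unfolding eq mem_Collect_eq fst_conv snd_conv by (simp only: plus_complex.sel
            Im_i_times Re_complex_of_real)
      qed
      moreover have "?s \<longlonglongrightarrow> (fst w, snd w + \<i> * of_real 0)"
        by (intro tendsto_intros LIMSEQ_inverse_real_of_nat)
      ultimately show "w \<in> closure (Omega P)"
        unfolding closure_sequential by (intro exI[of _ ?s]) simp
    qed
  qed
  hence "frontier (Omega P) = {w. Im (snd w) = P (fst w)}"
    unfolding frontier_def interior_open[OF op] by (auto simp: eq)
  also have "\<dots> = range (boundary_point P)"
    by (force simp: boundary_point_def complex_eq_iff image_iff)
  finally show ?thesis .
qed

lemma FPWS_finite_discontinuities: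
  assumes "FPWS f"
  obtains S where "finite S" "{0, 1} \<subseteq> S" "\<And>t. t \<in> {0..1} - S \<Longrightarrow> isCont f t"
proof -
  obtain N and a :: "nat \<Rightarrow> real" where a: "a 0 = 0" "a (N + 1) = 1"
    and sm: "\<And>i. i \<le> N \<Longrightarrow> smooth_interval (a i) (a (i + 1)) f"
    using assms unfolding FPWS_def by metis
  have ex: "\<exists>i\<le>n. a i < t \<and> t < a (i + 1)"
    if "a 0 < t" "t < a (n + 1)" "t \<notin> a ` {..n + 1}" for t n
    using that
  proof (induction n)
    case (Suc n)
    have "t \<noteq> a (n + 1)"
      using Suc.prems(3) by auto
    then consider "t < a (n + 1)" | "a (n + 1) < t"
      by linarith
    thus ?case
    proof cases
      case 1
      have "t \<notin> a ` {..n + 1}"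
        using Suc.prems(3) by auto
      thus ?thesis
        using Suc.IH[OF Suc.prems(1) 1] le_Suc_eq by blast
    next
      case 2
      thus ?thesis using Suc.prems(2) by auto
    qed
  qed auto
  show ?thesis
  proof (rule that[of "a ` {..N + 1}"])
    show "{0, 1} \<subseteq> a ` {..N + 1}"
      using a by (metis atMost_iff bot_nat_0.extremum empty_subsetI image_eqI insert_subset le_refl)
    fix t assume t: "t \<in> {0..1} - a ` {..N + 1}"
    have "t \<noteq> 0" "t \<noteq> 1"
      using t \<open>{0, 1} \<subseteq> a ` {..N + 1}\<close> by auto
    hence "a 0 < t" "t < a (N + 1)"
      using t a by auto
    with ex[of t N] t obtain i where i: "i \<le> N" "a i < t" "t < a (i + 1)"
      by auto
    have "(deriv ^^ 0) f differentiable (at t)"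
      using sm[OF i(1)] i unfolding smooth_interval_def by (meson greaterThanLessThan_iff)
    thus "isCont f t"
      by (simp add: differentiable_imp_continuous_within)
  qed auto
qed

lemma bounded_finite_discontinuities_integrable:
  fixes f :: "real \<Rightarrow> real"
  assumes "finite S" "{0, 1} \<subseteq> S" "\<And>t. t \<in> {0..1} - S \<Longrightarrow> isCont f t"
    and "\<And>t. t \<in> {0..1} \<Longrightarrow> \<bar>f t\<bar> \<le> B"
  shows "f integrable_on {0..1}"
proof -
  let ?T = "{0<..<1} - S"
  have T: "open ?T"
    using assms(1) by (simp add: finite_imp_closed open_Diff)
  have "continuous_on ?T f"
    using assms(3) by (intro continuous_at_imp_continuous_on) auto
  hence m: "f \<in> borel_measurable (lebesgue_on ?T)"
    using T by (intro continuous_imp_measurable_on_sets_lebesgue) auto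
  have fin: "?T \<in> lmeasurable"
    using T by (intro lmeasurable_open) (auto intro: bounded_subset[of "{0<..<1::real}"])
  have "f integrable_on ?T"
    by (rule measurable_bounded_by_integrable_imp_integrable[OF m, where g = "\<lambda>_. B"])
      (use fin assms(4) in \<open>auto intro: integrable_on_const\<close>)
  thus ?thesis
  proof (rule integrable_spike_set)
    show "negligible {x \<in> ?T - {0..1}. f x \<noteq> 0}"
      by (rule negligible_subset[of S]) (use assms(1) in auto)
    show "negligible {x \<in> {0..1} - ?T. f x \<noteq> 0}"
      by (rule negligible_subset[of S]) (use assms(1,2) in \<open>auto simp: less_le\<close>)
  qed
qed

lemma curve_length_gamma:
  assumes "(\<alpha>, \<beta>) \<in> Xstar" "\<delta> \<ge> 0"
  shows "curve_length (\<lambda>r. Complex (gamma1 z0 \<delta> \<alpha> r) (gamma2 z0 \<delta> \<beta> r)) =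
    ennreal (\<delta> * integral {0..1} (\<lambda>t. sqrt (\<bar>\<alpha> t\<bar>\<^sup>2 + \<bar>\<beta> t\<bar>\<^sup>2)))"
    (is "curve_length ?\<gamma> = ennreal (\<delta> * integral _ ?h)")
proof -
  have FP: "FPWS \<alpha>" "FPWS \<beta>"
    and lt: "\<And>s. s \<in> {0..1} \<Longrightarrow> \<bar>\<alpha> s\<bar>\<^sup>2 + \<bar>\<beta> s\<bar>\<^sup>2 < 1"
    using assms(1) by (auto simp: Xstar_def)
  obtain S1 where S1: "finite S1" "{0, 1} \<subseteq> S1" "\<And>t. t \<in> {0..1} - S1 \<Longrightarrow> isCont \<alpha> t"
    using FPWS_finite_discontinuities[OF FP(1)] by metis
  obtain S2 where S2: "finite S2" "{0, 1} \<subseteq> S2" "\<And>t. t \<in> {0..1} - S2 \<Longrightarrow> isCont \<beta> t"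
    using FPWS_finite_discontinuities[OF FP(2)] by metis
  have h1: "\<bar>?h s\<bar> \<le> 1" if "s \<in> {0..1}" for s
    using lt[OF that] by auto
  have "\<bar>\<alpha> s\<bar> \<le> ?h s" "\<bar>\<beta> s\<bar> \<le> ?h s" for s
    by auto
  hence bd: "\<bar>\<alpha> s\<bar> \<le> 1" "\<bar>\<beta> s\<bar> \<le> 1" if "s \<in> {0..1}" for s
    using h1[OF that] by (smt (verit))+
  have int: "\<alpha> integrable_on {0..1}" "\<beta> integrable_on {0..1}"
    using bounded_finite_discontinuities_integrable[OF S1] 
      bounded_finite_discontinuities_integrable[OF S2] bd by blast+
  have inth: "?h integrable_on {0..1}"
  proof (rule bounded_finite_discontinuities_integrable[of "S1 \<union> S2" _ 1])
    show "isCont ?h t" if "t \<in> {0..1} - (S1 \<union> S2)" for t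
      using S1(3)[of t] S2(3)[of t] that by (intro continuous_intros) auto
  qed (use S1(1,2) S2(1) h1 in blast)+
  have deriv: "2 * norm (vector_derivative ?\<gamma> (at t)) = \<delta> * ?h t"
    if t: "t \<in> {0..1} - (S1 \<union> S2)" for t
  proof -
    have t01: "t \<in> {0<..<1}"
      using t S1(2) by (auto simp: less_le)
    have D: "((\<lambda>r. integral {0..r} f) has_vector_derivative f t) (at t)"
      if "f integrable_on {0..1}" "isCont f t" for f :: "real \<Rightarrow> real"
    proof -
      have "continuous (at t within {0..1} - {}) f"
        using that(2) by (rule continuous_at_imp_continuous_at_within)
      hence "((\<lambda>r. integral {0..r} f) has_vector_derivative f t) (at t within {0..1} - {})"
        using that(1) t by (intro integral_has_vector_derivative_continuous_at) auto
      thus ?thesis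
        using t01 at_within_interior[of t "{0..1}"] by (simp add: interior_atLeastAtMost_real)
    qed
    have D1: "((\<lambda>r. integral {0..r} \<alpha>) has_real_derivative \<alpha> t) (at t)"
      and D2: "((\<lambda>r. integral {0..r} \<beta>) has_real_derivative \<beta> t) (at t)"
      using D[OF int(1) S1(3)] D[OF int(2) S2(3)] t
      by (auto simp: has_real_derivative_iff_has_vector_derivative)
    have "(gamma1 z0 \<delta> \<alpha> has_real_derivative \<delta> / 2 * \<alpha> t) (at t)"
      unfolding gamma1_def[abs_def] by (auto intro!: derivative_eq_intros D1)
    moreover have "(gamma2 z0 \<delta> \<beta> has_real_derivative - (\<delta> / 2 * \<beta> t)) (at t)"
      unfolding gamma2_def[abs_def] by (auto intro!: derivative_eq_intros D2)
    ultimately have "(?\<gamma> has_vector_derivative Complex (\<delta> / 2 * \<alpha> t) (- (\<delta> / 2 * \<beta> t))) (at t)"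
      unfolding Complex_eq
      by (intro has_vector_derivative_add has_vector_derivative_mult_right has_vector_derivative_of_real)
    hence "norm (vector_derivative ?\<gamma> (at t)) = norm (Complex (\<delta> / 2 * \<alpha> t) (- (\<delta> / 2 * \<beta> t)))"
      by (simp add: vector_derivative_at)
    also have "\<dots> = sqrt ((\<delta> / 2)\<^sup>2 * (\<bar>\<alpha> t\<bar>\<^sup>2 + \<bar>\<beta> t\<bar>\<^sup>2))"
      by (simp add: complex_norm power_mult_distrib algebra_simps power_divide)
    also have "\<dots> = \<delta> / 2 * ?h t"
      unfolding real_sqrt_mult using assms(2) by (simp add: real_sqrt_divide)
    finally show ?thesis by simp
  qed
  have "AE t in lborel. t \<notin> S1 \<union> S2"
    using S1(1) S2(1) by (intro AE_not_in) (simp add: finite_imp_null_set_lborel)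
  hence "curve_length ?\<gamma> = (\<integral>\<^sup>+t. ennreal (\<delta> * ?h t) * indicator {0..1} t \<partial>lborel)"
    unfolding curve_length_def
    by (intro nn_integral_cong_AE, elim AE_mp) (auto intro!: AE_I2 simp: indicator_def deriv)
  also have "\<dots> = ennreal (\<delta> * integral {0..1} ?h)"
    using assms(2) inth
    by (intro nn_integral_has_integral_lebesgue' has_integral_mult_right integrable_integral) auto
  finally show ?thesis .
qed

end

theory Submission
  imports Defs "HOL-Complex_Analysis.Complex_Analysis"
begin

text \<open>
  Both sides of the stockyard formula are governed by closed polygons. The integrand of \<open>\<Lambda>\<close> is the
  real part of \<open>f (\<gamma> r) * \<gamma>' r\<close> for \<open>f = \<partial>\<^sub>yP + \<i> \<partial>\<^sub>xP\<close>, and by Green's theorem (\<open>green_closed_chain\<close>,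
  \<open>AE_chain_winding_number_crossing\<close>) its integral along a closed polygon, called flux here, is minus the
  integral of \<open>\<Delta>P\<close> against the winding number. As \<open>P\<close> is subharmonic, \<open>\<Delta>P \<ge> 0\<close>.

  \<^bold>\<open>Curves are dominated by stockyards.\<close> A curve of \<open>\<Lambda>\<close> is a closed curve through \<open>z0\<close> that is strictly shorter
  than \<open>\<delta> / 2\<close>, because \<open>\<bar>\<alpha>\<bar>\<^sup>2 + \<bar>\<beta>\<bar>\<^sup>2 < 1\<close>, and inscribed polygons approximate its flux
  (\<open>Xstar_inscribed_polygon\<close>). Cutting a closed polygon wherever it meets itself leaves simple
  polygons and segments traversed back and forth (\<open>closed_polygon_enclosable\<close>). The inside of a simple polygon
  is a pen, on which \<open>\<Delta>P\<close> integrates to the absolute flux of the polygon. A doubled segment has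
  flux 0; it is replaced by a thin triangle, which keeps the boundary connected, does no harm
  since \<open>\<Delta>P \<ge> 0\<close>, and is paid for by the length that is left over.

  \<^bold>\<open>Stockyards are dominated by curves.\<close> A pen of finite perimeter is the inside of a Jordan curve of finite length
  (\<open>pen_eq_inside\<close>), and fine inscribed polygons have nearly the flux that Green's theorem predicts for the
  curve itself (\<open>inscribed_polygon_flux\<close>): away from the curve the winding numbers agree, and near it they
  are uniformly integrable. As the union of the boundaries is connected, tours of the pens can be
  spliced into one closed polygon through \<open>z0\<close> hardly longer than \<open>\<delta> / 2\<close> whose flux is nearly the sum over
  all pens (\<open>stockyard_tour\<close>). Shrunk a little towards \<open>z0\<close>, it is the curve of a pair of step
  functions (\<open>polygon_Lambda_curve\<close>).
\<close>

section \<open>Smooth and subharmonic functions\<close>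

lemma smooth_plane_pd:
  assumes "smooth_plane P"
  shows "smooth_plane (pd_x P)" "smooth_plane (pd_y P)"
proof -
  have "fold (\<lambda>D g. D g) ds (D P) differentiable (at z)"
    if "set ds \<subseteq> {pd_x, pd_y}" "D \<in> {pd_x, pd_y}" for ds D z
  proof -
    have "set (D # ds) \<subseteq> {pd_x, pd_y}" using that by simp
    hence "fold (\<lambda>D g. D g) (D # ds) P differentiable (at z)"
      using assms unfolding smooth_plane_def by blast
    thus ?thesis by simp
  qed
  thus "smooth_plane (pd_x P)" "smooth_plane (pd_y P)"
    unfolding smooth_plane_def by simp_all
qed

lemma smooth_plane_has_derivative:
  assumes "smooth_plane P"
  shows "(P has_derivative (\<lambda>h. pd_x P z * Re h + pd_y P z * Im h)) (at z)"
proof -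
  have "fold (\<lambda>D g. D g) [] P differentiable (at z)"
    using assms unfolding smooth_plane_def by (metis empty_set empty_subsetI)
  then obtain D where D: "(P has_derivative D) (at z)"
    by (auto simp: differentiable_def)
  interpret linear D
    using D by (rule has_derivative_linear)
  have Dh: "D h = D 1 * Re h + D \<i> * Im h" for h
  proof -
    have "D h = D (Re h *\<^sub>R 1 + Im h *\<^sub>R \<i>)"
      by (rule arg_cong[where f = D]) (simp add: complex_eq_iff)
    thus ?thesis by (simp only: add scale) (simp add: mult.commute)
  qed
  have "((\<lambda>s. P (Complex s (Im z))) has_derivative (\<lambda>h. D (of_real h))) (at (Re z))"
    unfolding Complex_eq
    by (rule has_derivative_compose[where g = P])
       (use D in \<open>auto intro!: derivative_eq_intros simp: complex_eq_iff[symmetric] complex_eq[symmetric]\<close>)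
  hence "((\<lambda>s. P (Complex s (Im z))) has_real_derivative D 1) (at (Re z))"
    unfolding has_field_derivative_def by (rule has_derivative_eq_rhs) (auto simp: Dh[of "of_real _"])
  hence 1: "pd_x P z = D 1"
    unfolding pd_x_def by (rule DERIV_imp_deriv)
  have "((\<lambda>s. P (Complex (Re z) s)) has_derivative (\<lambda>h. D (\<i> * of_real h))) (at (Im z))"
    unfolding Complex_eq
    by (rule has_derivative_compose[where g = P])
       (use D in \<open>auto intro!: derivative_eq_intros simp: complex_eq_iff[symmetric] complex_eq[symmetric]\<close>)
  hence "((\<lambda>s. P (Complex (Re z) s)) has_real_derivative D \<i>) (at (Im z))"
    unfolding has_field_derivative_def
    by (rule has_derivative_eq_rhs) (auto simp: Dh[of "\<i> * of_real _"])
  hence 2: "pd_y P z = D \<i>"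
    unfolding pd_y_def by (rule DERIV_imp_deriv)
  show ?thesis
    using D Dh 1 2 by (metis (no_types, lifting) ext)
qed

lemma smooth_plane_continuous:
  assumes "smooth_plane P"
  shows "continuous_on A P"
  by (intro continuous_at_imp_continuous_on ballI
      has_derivative_continuous[OF smooth_plane_has_derivative[OF assms]])

lemma smooth_plane_compose_continuous:
  assumes "smooth_plane P" "continuous_on A g"
  shows "continuous_on A (\<lambda>x. P (g x))"
  by (rule continuous_on_compose2[OF smooth_plane_continuous[OF assms(1), of UNIV] assms(2)]) auto

lemma continuous_on_laplacian:
  assumes "smooth_plane P"
  shows "continuous_on A (laplacian P)"
  unfolding laplacian_def[abs_def]
  by (intro continuous_intros smooth_plane_continuous smooth_plane_pd assms)

lemma smooth_plane_DERIV_ray: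
  assumes "smooth_plane P"
  shows "((\<lambda>s. P (z + of_real s * e)) has_real_derivative
    pd_x P (z + of_real s * e) * Re e + pd_y P (z + of_real s * e) * Im e) (at s)"
proof -
  have "((\<lambda>s. P (z + of_real s * e)) has_derivative
    (\<lambda>h. pd_x P (z + of_real s * e) * Re (of_real h * e) + pd_y P (z + of_real s * e) * Im (of_real h * e))) (at s)"
    by (rule has_derivative_compose[where g = P, OF _ smooth_plane_has_derivative[OF assms]])
       (auto intro!: derivative_eq_intros)
  thus ?thesis
    unfolding has_field_derivative_def by (rule has_derivative_eq_rhs) (auto simp: algebra_simps)
qed

text \<open>
  Average the second-order Taylor expansion along the rays from a point over a small circle: the
  linear terms cancel and the quadratic ones leave \<open>r\<^sup>2/4\<close> times the Laplacian, up to \<open>o(r\<^sup>2)\<close>. A negative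
  Laplacian would contradict the mean value inequality.
\<close>

lemma subharmonic_imp_laplacian_nonneg:
  assumes P: "smooth_plane P" and "subharmonic P"
  shows "laplacian P z \<ge> 0"
proof (rule ccontr)
  assume neg: "\<not> laplacian P z \<ge> 0"
  \<comment> \<open>Each of the four second derivatives contributes an error \<open>\<epsilon>\<close>; in total \<open>8 \<epsilon>\<close> is half of the deficit.\<close>
  define \<epsilon> where "\<epsilon> = - laplacian P z / 16"
  have \<epsilon>: "\<epsilon> > 0" using neg by (simp add: \<epsilon>_def)
  define xx xy yx yy where "xx = pd_x (pd_x P)" and "xy = pd_y (pd_x P)"
    and "yx = pd_x (pd_y P)" and "yy = pd_y (pd_y P)"
  have sm: "smooth_plane xx" "smooth_plane xy" "smooth_plane yx" "smooth_plane yy"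
    unfolding xx_def xy_def yx_def yy_def by (intro smooth_plane_pd P)+
  have near: "\<exists>r>0. \<forall>w. dist w z < r \<longrightarrow> \<bar>g w - g z\<bar> < \<epsilon>" if "smooth_plane g" for g
    using smooth_plane_continuous[OF that, of UNIV] \<epsilon>
    unfolding continuous_on_iff dist_real_def by (metis UNIV_I)
  obtain r1 r2 r3 r4 where rr: "r1 > 0" "r2 > 0" "r3 > 0" "r4 > 0"
    "\<And>w. dist w z < r1 \<Longrightarrow> \<bar>xx w - xx z\<bar> < \<epsilon>" "\<And>w. dist w z < r2 \<Longrightarrow> \<bar>xy w - xy z\<bar> < \<epsilon>"
    "\<And>w. dist w z < r3 \<Longrightarrow> \<bar>yx w - yx z\<bar> < \<epsilon>" "\<And>w. dist w z < r4 \<Longrightarrow> \<bar>yy w - yy z\<bar> < \<epsilon>"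
    using near[OF sm(1)] near[OF sm(2)] near[OF sm(3)] near[OF sm(4)] by metis
  define r where "r = Min {r1, r2, r3, r4} / 2"
  have r: "r > 0" "r < r1" "r < r2" "r < r3" "r < r4"
    using rr unfolding r_def by auto
  define A where "A = (\<lambda>\<theta>. xx z * (cos \<theta>)\<^sup>2 + (xy z + yx z) * (cos \<theta> * sin \<theta>) + yy z * (sin \<theta>)\<^sup>2)"
  define U where "U = (\<lambda>\<theta>. P z + r * (pd_x P z * cos \<theta> + pd_y P z * sin \<theta>) + r\<^sup>2 / 2 * (A \<theta> + 4 * \<epsilon>))"
  have up: "P (z + of_real r * cis \<theta>) \<le> U \<theta>" for \<theta>
  proof -
    let ?e = "cis \<theta>"
    define d where "d = (\<lambda>m::nat. if m = 0 then (\<lambda>s. P (z + of_real s * ?e)) else if m = 1 then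
      (\<lambda>s. pd_x P (z + of_real s * ?e) * Re ?e + pd_y P (z + of_real s * ?e) * Im ?e) else
      (\<lambda>s. (xx (z + of_real s * ?e) * Re ?e + xy (z + of_real s * ?e) * Im ?e) * Re ?e +
          (yx (z + of_real s * ?e) * Re ?e + yy (z + of_real s * ?e) * Im ?e) * Im ?e))"
    have "\<exists>t>0. t < r \<and> (\<lambda>s. P (z + of_real s * ?e)) r = (\<Sum>m<2. d m 0 / fact m * r ^ m) + d 2 t / fact 2 * r ^ 2"
    proof (rule Maclaurin[OF r(1)])
      show "\<forall>m t. m < 2 \<and> 0 \<le> t \<and> t \<le> r \<longrightarrow> (d m has_real_derivative d (Suc m) t) (at t)"
      proof (intro allI impI)
        fix m :: nat and t assume m: "m < 2 \<and> 0 \<le> t \<and> t \<le> r"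
        show "(d m has_real_derivative d (Suc m) t) (at t)"
        proof (cases "m = 0")
          case True
          thus ?thesis unfolding d_def using smooth_plane_DERIV_ray[OF P, of z ?e t] by simp
        next
          case False
          hence "m = 1" using m by auto
          thus ?thesis unfolding d_def xx_def xy_def yx_def yy_def
            using DERIV_add[OF
                DERIV_cmult_right[OF smooth_plane_DERIV_ray[OF smooth_plane_pd(1)[OF P], of z ?e t], of "Re ?e"]
                DERIV_cmult_right[OF smooth_plane_DERIV_ray[OF smooth_plane_pd(2)[OF P], of z ?e t], of "Im ?e"]]
            by simp
        qed
      qed
    qed (auto simp: d_def)
    then obtain t where t: "t > 0" "t < r"
      "P (z + of_real r * ?e) = P z + d 1 0 * r + d 2 t / 2 * r\<^sup>2"
      by (auto simp: numeral_2_eq_2 d_def)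
    have dist: "dist (z + of_real t * ?e) z < r"
      using t by (simp add: dist_norm norm_mult)
    define w where "w = z + of_real t * ?e"
    have cs: "\<bar>cos \<theta> * cos \<theta>\<bar> \<le> 1" "\<bar>cos \<theta> * sin \<theta>\<bar> \<le> 1" "\<bar>sin \<theta> * sin \<theta>\<bar> \<le> 1"
      unfolding abs_mult by (intro mult_le_one abs_cos_le_one abs_sin_le_one abs_ge_zero)+
    have mm: "x * y \<le> \<epsilon>" if "\<bar>x\<bar> < \<epsilon>" "\<bar>y\<bar> \<le> 1" for x y
    proof -
      have "x * y \<le> \<bar>x\<bar> * \<bar>y\<bar>" by (metis abs_ge_self abs_mult)
      also have "\<dots> \<le> \<epsilon> * 1" using that by (intro mult_mono) auto
      finally show ?thesis by simp
    qed
    have "d 2 t - A \<theta> = (xx w - xx z) * (cos \<theta> * cos \<theta>) + (xy w - xy z) * (cos \<theta> * sin \<theta>)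
       + (yx w - yx z) * (cos \<theta> * sin \<theta>) + (yy w - yy z) * (sin \<theta> * sin \<theta>)"
      by (simp add: d_def A_def w_def algebra_simps power2_eq_square)
    also have "\<dots> \<le> \<epsilon> + \<epsilon> + \<epsilon> + \<epsilon>"
      using rr(5-8)[of w] dist r cs unfolding w_def by (intro add_mono mm) auto
    finally have "d 2 t \<le> A \<theta> + 4 * \<epsilon>" by simp
    hence "r\<^sup>2 / 2 * d 2 t \<le> r\<^sup>2 / 2 * (A \<theta> + 4 * \<epsilon>)"
      by (intro mult_left_mono) auto
    thus ?thesis
      unfolding t(3) U_def by (simp add: d_def algebra_simps)
  qed
  \<comment> \<open>A primitive of \<open>U\<close>.\<close>
  define F where "F = (\<lambda>\<theta>. P z * \<theta> + r * (pd_x P z * sin \<theta> - pd_y P z * cos \<theta>) +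
    r\<^sup>2 / 2 * (xx z * (\<theta> + sin \<theta> * cos \<theta>) / 2 + (xy z + yx z) * (sin \<theta>)\<^sup>2 / 2 +
      yy z * (\<theta> - sin \<theta> * cos \<theta>) / 2 + 4 * \<epsilon> * \<theta>))"
  have "(U has_integral F (2 * pi) - F 0) {0..2 * pi}"
  proof (rule fundamental_theorem_of_calculus)
    fix x
    have "(F has_real_derivative (P z * 1 + r * (pd_x P z * cos x - pd_y P z * - sin x) +
      r\<^sup>2 / 2 * (xx z * (1 + (cos x * cos x - sin x * sin x)) / 2 +
        (xy z + yx z) * (2 * sin x * cos x) / 2 +
        yy z * (1 - (cos x * cos x - sin x * sin x)) / 2 + 4 * \<epsilon> * 1))) (at x within {0..2 * pi})"
      unfolding F_def by (rule derivative_eq_intros refl | simp add: field_simps)+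
    also have "(P z * 1 + r * (pd_x P z * cos x - pd_y P z * - sin x) +
      r\<^sup>2 / 2 * (xx z * (1 + (cos x * cos x - sin x * sin x)) / 2 +
        (xy z + yx z) * (2 * sin x * cos x) / 2 +
        yy z * (1 - (cos x * cos x - sin x * sin x)) / 2 + 4 * \<epsilon> * 1)) = U x"
    proof -
      have c: "1 + (cos x * cos x - sin x * sin x) = 2 * (cos x)\<^sup>2"
        "1 - (cos x * cos x - sin x * sin x) = 2 * (sin x)\<^sup>2"
        using sin_cos_squared_add[of x] by (simp_all add: power2_eq_square)
      show ?thesis unfolding U_def A_def c by simp
    qed
    finally show "(F has_vector_derivative U x) (at x within {0..2 * pi})"
      by (simp add: has_real_derivative_iff_has_vector_derivative)
  qed auto
  moreover have "F (2 * pi) - F 0 = 2 * pi * P z + pi * r\<^sup>2 / 2 * (laplacian P z + 8 * \<epsilon>)"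
    by (simp add: F_def laplacian_def xx_def yy_def algebra_simps)
  ultimately have U: "(U has_integral 2 * pi * P z + pi * r\<^sup>2 / 2 * (laplacian P z + 8 * \<epsilon>)) {0..2 * pi}"
    by simp
  have sub: "(\<lambda>\<theta>. P (z + of_real r * cis \<theta>)) integrable_on {0..2 * pi}"
    "P z \<le> 1 / (2 * pi) * integral {0..2 * pi} (\<lambda>\<theta>. P (z + of_real r * cis \<theta>))"
    using assms(2) r(1) unfolding subharmonic_def by blast+
  have "2 * pi * P z \<le> integral {0..2 * pi} (\<lambda>\<theta>. P (z + of_real r * cis \<theta>))"
    using sub(2) by (simp add: field_simps)
  also have "\<dots> \<le> 2 * pi * P z + pi * r\<^sup>2 / 2 * (laplacian P z + 8 * \<epsilon>)"
    by (rule has_integral_le[OF integrable_integral[OF sub(1)] U up])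
  finally have "0 \<le> pi * r\<^sup>2 / 2 * (laplacian P z + 8 * \<epsilon>)" by simp
  moreover have "laplacian P z + 8 * \<epsilon> < 0" using neg by (simp add: \<epsilon>_def)
  moreover have "pi * r\<^sup>2 / 2 > 0" using r(1) by simp
  ultimately show False by (smt (verit) mult_pos_neg)
qed

section \<open>Iterated integrals over the plane\<close>

lemma lborel_complex_eq_distr:
  "(lborel :: complex measure) =
    distr (lborel \<Otimes>\<^sub>M lborel) borel (\<lambda>p. Complex (fst p) (snd p))"
proof (rule lborel_eqI)
  fix l u :: complex
  assume lu: "\<And>b. b \<in> Basis \<Longrightarrow> l \<bullet> b \<le> u \<bullet> b"
  have le: "Re l \<le> Re u" "Im l \<le> Im u"
    using lu[of 1] lu[of \<i>] by (auto simp: Basis_complex_def inner_complex_def)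
  have m: "(\<lambda>p::real \<times> real. Complex (fst p) (snd p)) \<in> borel_measurable (lborel \<Otimes>\<^sub>M lborel)"
    unfolding Complex_eq by measurable
  have pre: "(\<lambda>p. Complex (fst p) (snd p)) -` box l u \<inter> space (lborel \<Otimes>\<^sub>M lborel)
    = {Re l<..<Re u} \<times> {Im l<..<Im u}"
    by (auto simp: box_def Basis_complex_def inner_complex_def space_pair_measure)
  have "emeasure (distr (lborel \<Otimes>\<^sub>M lborel) borel (\<lambda>p. Complex (fst p) (snd p))) (box l u) =
    emeasure (lborel \<Otimes>\<^sub>M lborel) ({Re l<..<Re u} \<times> {Im l<..<Im u})"
    by (subst emeasure_distr[OF m]) (simp_all add: pre)
  also have "\<dots> = ennreal (Re u - Re l) * ennreal (Im u - Im l)"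
    by (subst lborel.emeasure_pair_measure_Times) (simp_all add: le)
  also have "\<dots> = (\<Prod>b\<in>Basis. (u - l) \<bullet> b)"
    using le by (simp add: Basis_complex_def inner_complex_def ennreal_mult)
  finally show "emeasure (distr (lborel \<Otimes>\<^sub>M lborel) borel (\<lambda>p. Complex (fst p) (snd p))) (box l u)
    = (\<Prod>b\<in>Basis. (u - l) \<bullet> b)" .
qed simp

lemma lborel_complex_integral_iterated:
  fixes f :: "complex \<Rightarrow> real"
  assumes "integrable lborel f"
  shows "integral\<^sup>L lborel f = (\<integral>x. (\<integral>y. f (Complex x y) \<partial>lborel) \<partial>lborel)"
    and "integrable lborel (\<lambda>x. \<integral>y. f (Complex x y) \<partial>lborel)"
proof -
  have m: "(\<lambda>p::real \<times> real. Complex (fst p) (snd p)) \<in> lborel \<Otimes>\<^sub>M lborel \<rightarrow>\<^sub>M borel"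
    unfolding Complex_eq by measurable
  have f: "f \<in> borel_measurable borel"
    using borel_measurable_integrable[OF assms] by simp
  have "integrable (distr (lborel \<Otimes>\<^sub>M lborel) borel (\<lambda>p. Complex (fst p) (snd p))) f"
    using assms lborel_complex_eq_distr by simp
  hence i: "integrable (lborel \<Otimes>\<^sub>M lborel) (\<lambda>p. f (Complex (fst p) (snd p)))"
    by (subst (asm) integrable_distr_eq[OF m f])
  have "integral\<^sup>L lborel f =
    integral\<^sup>L (distr (lborel \<Otimes>\<^sub>M lborel) borel (\<lambda>p. Complex (fst p) (snd p))) f"
    using lborel_complex_eq_distr by simp
  also have "\<dots> = (\<integral>p. f (Complex (fst p) (snd p)) \<partial>(lborel \<Otimes>\<^sub>M lborel))"
    by (rule integral_distr[OF m f])
  also have "\<dots> = (\<integral>x. (\<integral>y. f (Complex x y) \<partial>lborel) \<partial>lborel)"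
    using lborel_pair.integral_fst'[OF i] by simp
  finally show "integral\<^sup>L lborel f = (\<integral>x. (\<integral>y. f (Complex x y) \<partial>lborel) \<partial>lborel)" .
  show "integrable lborel (\<lambda>x. \<integral>y. f (Complex x y) \<partial>lborel)"
    using lborel_pair.integrable_fst'[OF i] by simp
qed

lemma has_integral_unit_interval_iff:
  fixes f :: "real \<Rightarrow> 'a::real_normed_vector"
  assumes "c < d"
  shows "((\<lambda>t. (d - c) *\<^sub>R f (c + t * (d - c))) has_integral I) {0..1} \<longleftrightarrow> (f has_integral I) {c..d}"
proof -
  have "((\<lambda>t. (d - c) *\<^sub>R f (c + t * (d - c))) has_integral I) {0..1} \<longleftrightarrow>
    ((\<lambda>t. f (c + t * (d - c))) has_integral (I /\<^sub>R (d - c))) {0..1}"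
    using assms by (intro has_integral_cmul_iff') auto
  also have "\<dots> \<longleftrightarrow> (f has_integral I) {c..d}"
    using has_integral_affinity_iff[of "d - c" f c I c d] assms
    by (simp add: mult.commute add.commute diff_divide_distrib[symmetric] divide_inverse_commute[symmetric])
  finally show ?thesis .
qed

text \<open>
  Differentiation under the integral sign combined with the fundamental theorem, by the chain rule
  for a function of two variables with continuous partial derivatives.
\<close>

lemma DERIV_integral_moving_endpoint:
  fixes p px :: "real \<Rightarrow> real \<Rightarrow> real"
  assumes p: "\<And>x s. ((\<lambda>x. p x s) has_real_derivative px x s) (at x)"
    and cont: "continuous_on UNIV (\<lambda>(x, s). p x s)" "continuous_on UNIV (\<lambda>(x, s). px x s)"
    and h: "(h has_real_derivative m) (at x)" and c: "c < h x"
  shows "((\<lambda>x. integral {c..h x} (p x)) has_real_derivative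
    integral {c..h x} (px x) + p x (h x) * m) (at x)"
proof -
  have cp: "continuous_on A (p x)" for x A
  proof -
    have "continuous_on A (Pair x)"
      by (rule continuous_on_Pair[OF continuous_on_const continuous_on_id])
    thus ?thesis using continuous_on_compose2[OF cont(1), of A "Pair x"] by simp
  qed
  define Q where "Q = (\<lambda>x y. integral {c..y} (p x))"
  have Qx: "((\<lambda>x. Q x (h x0)) has_derivative (\<lambda>t. integral {c..h x0} (px x) * t)) (at x within UNIV)" for x0
  proof -
    have "((\<lambda>x. integral (cbox c (h x0)) (p x)) has_field_derivative integral (cbox c (h x0)) (px x)) (at x within UNIV)"
    proof (rule leibniz_rule_field_derivative)
      show "continuous_on (UNIV \<times> cbox c (h x0)) (\<lambda>(x, t). px x t)"
        using cont(2) by (rule continuous_on_subset) auto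
      show "p x integrable_on cbox c (h x0)" for x
        using cp by (intro integrable_continuous) auto
    qed (use p in auto)
    thus ?thesis by (simp add: Q_def has_field_derivative_def)
  qed
  have Qy: "((\<lambda>y. Q x' y) has_derivative blinfun_apply (blinfun_mult_right (p x' y))) (at y within {c<..})"
    if "y \<in> {c<..}" for x' y
  proof -
    have "((\<lambda>y. integral {c..y} (p x')) has_vector_derivative p x' y) (at y within {c..y + 1})"
      by (rule integral_has_vector_derivative) (use that cp in auto)
    hence "((\<lambda>y. Q x' y) has_vector_derivative p x' y) (at y)"
      using that at_within_interior[of y "{c..y + 1}"]
      by (simp add: Q_def interior_atLeastAtMost_real)
    thus ?thesis
      unfolding has_real_derivative_iff_has_vector_derivative[symmetric]
        has_field_derivative_eq_has_derivative_blinfun[symmetric]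
      by (rule has_field_derivative_at_within)
  qed
  have "((\<lambda>(x, y). Q x y) has_derivative
    (\<lambda>(tx, ty). integral {c..h x} (px x) * tx + blinfun_mult_right (p x (h x)) ty)) (at (x, h x) within UNIV \<times> {c<..})"
  proof (rule has_derivative_partialsI[OF Qx Qy])
    have "continuous_on UNIV (\<lambda>z::real \<times> real. blinfun_mult_right ((\<lambda>(x, s). p x s) z))"
      by (rule bounded_linear.continuous_on[OF bounded_linear_blinfun_mult_right cont(1)])
    hence "isCont (\<lambda>z. blinfun_mult_right ((\<lambda>(x, s). p x s) z)) (x, h x)"
      by (simp add: continuous_on_eq_continuous_at)
    thus "continuous (at (x, h x) within UNIV \<times> {c<..}) (\<lambda>(x, y). blinfun_mult_right (p x y))"
      unfolding case_prod_unfold by (rule continuous_at_imp_continuous_at_within)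
    show "h x \<in> {c<..}" using c by simp
    show "convex {c<..}" by simp
  qed
  moreover have "at (x, h x) within UNIV \<times> {c<..} = at (x, h x)"
    by (rule at_within_open) (use c in \<open>simp_all add: open_Times\<close>)
  ultimately have D: "((\<lambda>(x, y). Q x y) has_derivative
    (\<lambda>(tx, ty). integral {c..h x} (px x) * tx + p x (h x) * ty)) (at (x, h x))"
    unfolding blinfun_mult_right.rep_eq by simp
  have "((\<lambda>t. (\<lambda>(x, y). Q x y) (t, h t)) has_derivative
    (\<lambda>t. (\<lambda>(tx, ty). integral {c..h x} (px x) * tx + p x (h x) * ty) (t, m * t))) (at x)"
  proof (rule has_derivative_compose[where f = "\<lambda>t. (t, h t)" and f' = "\<lambda>t. (t, m * t)"
        and g = "\<lambda>(x, y). Q x y"])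
    show "((\<lambda>(x, y). Q x y) has_derivative
      (\<lambda>(tx, ty). integral {c..h x} (px x) * tx + p x (h x) * ty)) (at (x, h x))" by (rule D)
    show "((\<lambda>t. (t, h t)) has_derivative (\<lambda>t. (t, m * t))) (at x)"
      using h by (intro has_derivative_Pair has_derivative_ident) (simp add: has_field_derivative_def)
  qed
  hence "((\<lambda>x. integral {c..h x} (p x)) has_derivative
    (\<lambda>t. (integral {c..h x} (px x) + p x (h x) * m) * t)) (at x)"
    by (simp add: Q_def algebra_simps)
  thus ?thesis unfolding has_field_derivative_def .
qed

section \<open>The flux along a segment and the region below it\<close>

text \<open>
  The integrand of \<open>\<Lambda>\<close> along a curve \<open>\<gamma>\<close> is the real part of \<open>flux_field P (\<gamma> r) * \<gamma>' r\<close>. Writing it as a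
  complex line integral makes the calculus of contour integrals available; up to sign it is the
  flux of the gradient of \<open>P\<close> across the curve.
\<close>

definition flux_field :: "(complex \<Rightarrow> real) \<Rightarrow> complex \<Rightarrow> complex" where
  "flux_field P z = Complex (pd_y P z) (pd_x P z)"

definition flux :: "(complex \<Rightarrow> real) \<Rightarrow> complex \<Rightarrow> complex \<Rightarrow> real" where
  "flux P a b = Re (contour_integral (linepath a b) (flux_field P))"

lemma continuous_on_flux_field:
  assumes "smooth_plane P"
  shows "continuous_on A (flux_field P)"
  unfolding flux_field_def[abs_def] Complex_eq
  by (intro continuous_intros smooth_plane_continuous smooth_plane_pd assms)

lemma flux_refl [simp]: "flux P a a = 0"
  by (simp add: flux_def)

lemma flux_swap: "smooth_plane P \<Longrightarrow> flux P b a = - flux P a b"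
  by (simp add: flux_def contour_integral_reverse_linepath[OF continuous_on_flux_field, of P b a])

lemma flux_split:
  "smooth_plane P \<Longrightarrow> c \<in> closed_segment a b \<Longrightarrow> flux P a b = flux P a c + flux P c b"
  by (simp add: flux_def contour_integral_split_linepath[OF continuous_on_flux_field, of P c a b])

lemma flux_has_integral:
  assumes "smooth_plane P"
  shows "((\<lambda>t. pd_y P (linepath a b t) * Re (b - a) - pd_x P (linepath a b t) * Im (b - a))
    has_integral flux P a b) {0..1}"
proof -
  have "(flux_field P has_contour_integral contour_integral (linepath a b) (flux_field P)) (linepath a b)"
    by (intro has_contour_integral_integral contour_integrable_continuous_linepath
        continuous_on_flux_field assms)
  hence "((\<lambda>t. Re (flux_field P (linepath a b t) * (b - a))) has_integral flux P a b) {0..1}"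
    unfolding has_contour_integral_linepath flux_def
    using has_integral_linear[OF _ bounded_linear_Re] by (simp add: o_def del: times_complex.sel)
  thus ?thesis by (simp add: flux_field_def)
qed

definition segment_height :: "complex \<Rightarrow> complex \<Rightarrow> real \<Rightarrow> real" where
  "segment_height a b x = Im a + (x - Re a) / (Re b - Re a) * (Im b - Im a)"

text \<open>
  The signed number of times the segment from \<open>a\<close> to \<open>b\<close> crosses the vertical ray going up from \<open>w\<close>. Summed over
  the edges of a closed polygon it is almost everywhere minus the winding number. As a function of \<open>w\<close> it is, for one
  edge, a signed indicator of the region below the edge, which suits iterated integrals.
\<close>

definition crossing :: "complex \<Rightarrow> complex \<Rightarrow> complex \<Rightarrow> real" where
  "crossing a b w =
    (if Re a < Re w \<and> Re w < Re b \<and> Im w < segment_height a b (Re w) then 1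
     else if Re b < Re w \<and> Re w < Re a \<and> Im w < segment_height a b (Re w) then -1 else 0)"

text \<open>
  The boundary contributions of the region below a segment that do not come from the segment itself:
  its vertical sides and the horizontal line at height \<open>c\<close>. They depend on the end points only, so
  they telescope around a closed polygon.
\<close>

definition green_potential :: "(complex \<Rightarrow> real) \<Rightarrow> real \<Rightarrow> real \<Rightarrow> complex \<Rightarrow> real" where
  "green_potential P u c z = integral {c..Im z} (\<lambda>s. pd_x P (Complex (Re z) s)) -
    integral {u..Re z} (\<lambda>x. pd_y P (Complex x c))"

lemma segment_height_commute:
  "Re a \<noteq> Re b \<Longrightarrow> segment_height b a x = segment_height a b x"
  by (simp add: segment_height_def field_simps)

lemma crossing_swap: "crossing b a w = - crossing a b w"
  by (auto simp: crossing_def segment_height_commute[of b a])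

lemma smooth_plane_DERIV_coordinates:
  assumes "smooth_plane f"
  shows "((\<lambda>x. f (Complex x s)) has_real_derivative pd_x f (Complex x s)) (at x)"
    and "((\<lambda>s. f (Complex x s)) has_real_derivative pd_y f (Complex x s)) (at s)"
  using smooth_plane_DERIV_ray[OF assms, of "Complex 0 s" 1 x]
    smooth_plane_DERIV_ray[OF assms, of "Complex x 0" \<i> s]
  by (simp_all add: Complex_eq mult.commute add.commute)

lemma set_integrable_continuous_bounded:
  fixes f :: "'a::euclidean_space \<Rightarrow> real"
  assumes "continuous_on UNIV f" "D \<in> sets borel" "bounded D"
  shows "set_integrable lborel D f"
proof -
  obtain r where "\<And>x. x \<in> D \<Longrightarrow> norm x \<le> r"
    using assms(3) by (auto simp: bounded_iff)
  hence "D \<subseteq> cball 0 r" by auto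
  moreover have "set_integrable lborel (cball 0 r) f"
    using borel_integrable_compact[of "cball 0 r" f] continuous_on_subset[OF assms(1)]
    by (simp add: set_integrable_def)
  ultimately show ?thesis
    using assms(2) by (auto intro: set_integrable_subset)
qed

text \<open>
  Green's theorem for the region between a segment and a horizontal line. Integrating \<open>\<partial>\<^sub>y\<^sup>2P\<close> vertically
  gives \<open>\<partial>\<^sub>yP\<close> on the segment and on the line. The vertical integral of \<open>\<partial>\<^sub>x\<^sup>2P\<close> is the derivative in \<open>x\<close> of the
  vertical integral of \<open>\<partial>\<^sub>xP\<close>, minus the term that the moving upper end point produces.
\<close>

lemma green_under_rightward_segment:
  assumes P: "smooth_plane P" and ab: "Re a < Re b" and u: "u < Re a" and c: "c < Im a" "c < Im b"
  shows "integrable lborel (\<lambda>w. indicator {w. c < Im w} w * (laplacian P w * crossing a b w))"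
    and "(\<integral>w. indicator {w. c < Im w} w * (laplacian P w * crossing a b w) \<partial>lborel) =
      flux P a b + green_potential P u c b - green_potential P u c a"
proof -
  define h where "h = segment_height a b"
  define m where "m = (Im b - Im a) / (Re b - Re a)"
  define D where "D = {w. Re a < Re w \<and> Re w < Re b \<and> c < Im w \<and> Im w < h (Re w)}"
  have h_eq: "h x = Im a + (x - Re a) * m" for x
    by (simp add: h_def segment_height_def m_def)
  have h_ends: "h (Re a) = Im a" "h (Re b) = Im b"
    using ab by (simp_all add: h_eq m_def)
  have h_conv: "h x = (1 - t) * Im a + t * Im b"
    if "t = (x - Re a) / (Re b - Re a)" for x t
  proof -
    have "h x = Im a + t * (Im b - Im a)" unfolding that h_eq m_def by simp
    thus ?thesis by (simp add: algebra_simps)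
  qed
  have h_bounds: "c < h x" "h x \<le> \<bar>Im a\<bar> + \<bar>Im b\<bar>" if "x \<in> {Re a..Re b}" for x
  proof -
    define t where "t = (x - Re a) / (Re b - Re a)"
    have t: "0 \<le> t" "t \<le> 1" using that ab by (auto simp: t_def field_simps)
    have "(1 - t) * min (Im a) (Im b) + t * min (Im a) (Im b) \<le> h x"
      unfolding h_conv[OF t_def] by (intro add_mono mult_left_mono) (use t in auto)
    moreover have "(1 - t) * min (Im a) (Im b) + t * min (Im a) (Im b) = min (Im a) (Im b)"
      by (simp add: algebra_simps)
    ultimately show "c < h x" using c by linarith
    have "s * y \<le> \<bar>y\<bar>" if "0 \<le> s" "s \<le> 1" for s y :: real
      using mult_left_mono[OF abs_ge_self[of y], of s] mult_right_mono[of s 1 "\<bar>y\<bar>"] that by auto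
    thus "h x \<le> \<bar>Im a\<bar> + \<bar>Im b\<bar>"
      unfolding h_conv[OF t_def] using t by (intro add_mono) auto
  qed
  have hc: "continuous_on A h" for A
    unfolding h_eq[abs_def] by (intro continuous_intros)
  have eq: "indicator {w. c < Im w} w * (laplacian P w * crossing a b w) = indicator D w *\<^sub>R laplacian P w" for w
    using ab by (simp add: D_def crossing_def h_def indicator_def)
  have D_open: "open D"
    unfolding D_def
    by (intro open_Collect_conj open_Collect_less continuous_intros
        continuous_on_compose2[OF hc[of UNIV]]) auto
  have "D \<subseteq> cbox (Complex (Re a) c) (Complex (Re b) (\<bar>Im a\<bar> + \<bar>Im b\<bar>))"
  proof
    fix w assume "w \<in> D"
    thus "w \<in> cbox (Complex (Re a) c) (Complex (Re b) (\<bar>Im a\<bar> + \<bar>Im b\<bar>))"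
      using h_bounds(2)[of "Re w"] by (simp add: D_def in_cbox_complex_iff)
  qed
  hence D_bdd: "bounded D"
    using bounded_cbox bounded_subset by blast
  have int: "set_integrable lborel D (laplacian P)"
    by (rule set_integrable_continuous_bounded[OF continuous_on_laplacian[OF P] _ D_bdd])
       (use D_open in simp)
  thus "integrable lborel (\<lambda>w. indicator {w. c < Im w} w * (laplacian P w * crossing a b w))"
    unfolding eq set_integrable_def .
  define H where "H = (\<lambda>x. integral {c..h x} (\<lambda>s. pd_x (pd_x P) (Complex x s)) +
    pd_y P (Complex x (h x)) - pd_y P (Complex x c))"
  note Px = smooth_plane_pd(1)[OF P] and Py = smooth_plane_pd(2)[OF P]
  have cC: "continuous_on A (\<lambda>s. f (Complex x s))" if "smooth_plane f" for f x A
    by (intro smooth_plane_compose_continuous[OF that]) (simp add: Complex_eq continuous_intros)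
  have inner: "(\<integral>y. indicator D (Complex x y) *\<^sub>R laplacian P (Complex x y) \<partial>lborel) =
    indicator {Re a<..<Re b} x *\<^sub>R H x" for x
  proof (cases "x \<in> {Re a<..<Re b}")
    case True
    have "(\<integral>y. indicator D (Complex x y) *\<^sub>R laplacian P (Complex x y) \<partial>lborel) =
      set_lebesgue_integral lborel {c<..<h x} (\<lambda>y. laplacian P (Complex x y))"
      unfolding set_lebesgue_integral_def
      by (rule Bochner_Integration.integral_cong) (use True in \<open>auto simp: D_def indicator_def\<close>)
    also have "\<dots> = integral {c<..<h x} (\<lambda>y. laplacian P (Complex x y))"
      unfolding laplacian_def
      by (intro set_borel_integral_eq_integral(2) set_integrable_continuous_bounded continuous_intros
          cC smooth_plane_pd P) auto
    also have "\<dots> = integral {c..h x} (\<lambda>y. pd_x (pd_x P) (Complex x y) + pd_y (pd_y P) (Complex x y))"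
      by (simp add: integral_open_interval_real laplacian_def)
    also have "\<dots> = integral {c..h x} (\<lambda>y. pd_x (pd_x P) (Complex x y)) + integral {c..h x} (\<lambda>y. pd_y (pd_y P) (Complex x y))"
      by (intro Henstock_Kurzweil_Integration.integral_add integrable_continuous_real cC smooth_plane_pd P)
    also have "integral {c..h x} (\<lambda>y. pd_y (pd_y P) (Complex x y)) = pd_y P (Complex x (h x)) - pd_y P (Complex x c)"
    proof (rule integral_unique, rule fundamental_theorem_of_calculus)
      show "c \<le> h x" using h_bounds(1)[of x] True by auto
      show "((\<lambda>y. pd_y P (Complex x y)) has_vector_derivative pd_y (pd_y P) (Complex x s)) (at s within {c..h x})" for s
        using smooth_plane_DERIV_coordinates(2)[OF Py, of x s]
        by (metis has_field_derivative_at_within has_real_derivative_iff_has_vector_derivative)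
    qed
    finally show ?thesis using True by (simp add: H_def)
  qed (auto simp: D_def)
  have "(\<integral>w. indicator {w. c < Im w} w * (laplacian P w * crossing a b w) \<partial>lborel) =
    (\<integral>w. indicator D w *\<^sub>R laplacian P w \<partial>lborel)"
    unfolding eq ..
  also have "\<dots> = set_lebesgue_integral lborel {Re a<..<Re b} H"
    using lborel_complex_integral_iterated(1)[OF int[unfolded set_integrable_def]]
    unfolding inner set_lebesgue_integral_def .
  also have "\<dots> = integral {Re a<..<Re b} H"
  proof (rule set_borel_integral_eq_integral(2))
    show "set_integrable lborel {Re a<..<Re b} H"
      using lborel_complex_integral_iterated(2)[OF int[unfolded set_integrable_def]]
      unfolding inner set_integrable_def .
  qed
  also have "\<dots> = integral {Re a..Re b} H"
    by (simp add: integral_open_interval_real)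
  also have "\<dots> = flux P a b + green_potential P u c b - green_potential P u c a"
  proof (rule integral_unique)
    define k where "k = (\<lambda>x. pd_y P (Complex x (h x)) - pd_x P (Complex x (h x)) * m)"
    define G where "G = (\<lambda>x. green_potential P u c (Complex x (h x)))"
    have "(k has_integral flux P a b) {Re a..Re b}"
    proof (subst has_integral_unit_interval_iff[OF ab, symmetric], rule has_integral_eq[OF _ flux_has_integral[OF P]])
      fix t :: real assume t: "t \<in> {0..1}"
      have "linepath a b t = Complex (Re a + t * (Re b - Re a)) (h (Re a + t * (Re b - Re a)))"
        using ab by (simp add: complex_eq_iff linepath_def h_eq m_def algebra_simps)
           (simp add: field_simps)
      thus "pd_y P (linepath a b t) * Re (b - a) - pd_x P (linepath a b t) * Im (b - a) =
        (Re b - Re a) *\<^sub>R k (Re a + t * (Re b - Re a))"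
        using ab by (simp add: k_def m_def field_simps)
    qed
    moreover have "((\<lambda>x. H x - k x) has_integral (G (Re b) - G (Re a))) {Re a..Re b}"
    proof (rule fundamental_theorem_of_calculus)
      fix x assume x: "x \<in> {Re a..Re b}"
      have 1: "((\<lambda>x. integral {c..h x} (\<lambda>s. pd_x P (Complex x s))) has_real_derivative
        integral {c..h x} (\<lambda>s. pd_x (pd_x P) (Complex x s)) + pd_x P (Complex x (h x)) * m) (at x)"
      proof (rule DERIV_integral_moving_endpoint)
        show "(h has_real_derivative m) (at x)"
          unfolding h_eq[abs_def] by (auto intro!: derivative_eq_intros)
        show "continuous_on UNIV (\<lambda>(x, s). pd_x P (Complex x s))"
          "continuous_on UNIV (\<lambda>(x, s). pd_x (pd_x P) (Complex x s))"
          unfolding case_prod_unfold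
          by (intro smooth_plane_compose_continuous smooth_plane_pd P, simp add: Complex_eq continuous_intros)+
      qed (use h_bounds(1)[OF x] smooth_plane_DERIV_coordinates(1)[OF Px] in auto)
      have "((\<lambda>x. integral {u..x} (\<lambda>x. pd_y P (Complex x c))) has_vector_derivative pd_y P (Complex x c))
        (at x within {u..x + 1})"
      proof (rule integral_has_vector_derivative)
        show "continuous_on {u..x + 1} (\<lambda>x. pd_y P (Complex x c))"
          by (intro smooth_plane_compose_continuous[OF Py]) (simp add: Complex_eq continuous_intros)
      qed (use x u in auto)
      hence 2: "((\<lambda>x. integral {u..x} (\<lambda>x. pd_y P (Complex x c))) has_real_derivative pd_y P (Complex x c)) (at x)"
        using x u at_within_interior[of x "{u..x + 1}"]
        by (simp add: interior_atLeastAtMost_real has_real_derivative_iff_has_vector_derivative)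
      have "(G has_real_derivative H x - k x) (at x)"
        using DERIV_diff[OF 1 2] by (simp add: G_def green_potential_def H_def k_def algebra_simps)
      thus "(G has_vector_derivative H x - k x) (at x within {Re a..Re b})"
        by (metis has_field_derivative_at_within has_real_derivative_iff_has_vector_derivative)
    qed (use ab in auto)
    ultimately have "((\<lambda>x. k x + (H x - k x)) has_integral (flux P a b + (G (Re b) - G (Re a)))) {Re a..Re b}"
      by (rule has_integral_add)
    thus "(H has_integral (flux P a b + green_potential P u c b - green_potential P u c a)) {Re a..Re b}"
      by (simp add: G_def h_ends algebra_simps)
  qed
  finally show "(\<integral>w. indicator {w. c < Im w} w * (laplacian P w * crossing a b w) \<partial>lborel) =
      flux P a b + green_potential P u c b - green_potential P u c a" .
qed

text \<open>
  Reversing a segment changes the sign of all terms, and on a vertical segment the flux is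
  cancelled by the potential.
\<close>

lemma green_under_segment:
  assumes P: "smooth_plane P" and u: "u < Re a" "u < Re b" and c: "c < Im a" "c < Im b"
  shows "integrable lborel (\<lambda>w. indicator {w. c < Im w} w * (laplacian P w * crossing a b w))"
      (is "integrable lborel (?f a b)")
    and "(\<integral>w. indicator {w. c < Im w} w * (laplacian P w * crossing a b w) \<partial>lborel) =
      flux P a b + green_potential P u c b - green_potential P u c a"
proof -
  have *: "integrable lborel (?f a b) \<and> integral\<^sup>L lborel (?f a b) =
    flux P a b + green_potential P u c b - green_potential P u c a"
  proof (cases "Re a" "Re b" rule: linorder_cases)
    case less
    thus ?thesis using green_under_rightward_segment[OF P less u(1) c] by blast
  next
    case greater
    have "?f a b = (\<lambda>w. - ?f b a w)"
      by (simp add: crossing_swap[of a b])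
    thus ?thesis
      using green_under_rightward_segment[OF P greater u(2) c(2,1)] by (simp add: flux_swap[OF P, of a b])
  next
    case equal
    have z: "?f a b = (\<lambda>w. 0)"
      using equal by (auto simp: crossing_def)
    have key: "flux P a b + green_potential P u c b - green_potential P u c a = 0"
      if e: "Re a = Re b" and le: "Im a \<le> Im b" and c: "c < Im a" for a b
    proof (cases "Im a = Im b")
      case True
      hence "a = b" using e by (simp add: complex_eq_iff)
      thus ?thesis by simp
    next
      case False
      hence lt: "Im a < Im b" using le by simp
      let ?p = "\<lambda>s. pd_x P (Complex (Re a) s)"
      have cont: "continuous_on A ?p" for A
        by (intro smooth_plane_compose_continuous smooth_plane_pd P) (simp add: Complex_eq continuous_intros)
      have "((\<lambda>s. - ?p s) has_integral flux P a b) {Im a..Im b}"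
      proof (subst has_integral_unit_interval_iff[OF lt, symmetric], rule has_integral_eq[OF _ flux_has_integral[OF P]])
        fix t :: real
        have "linepath a b t = Complex (Re a) (Im a + t * (Im b - Im a))"
          using e by (simp add: complex_eq_iff linepath_def algebra_simps)
        thus "pd_y P (linepath a b t) * Re (b - a) - pd_x P (linepath a b t) * Im (b - a) =
          (Im b - Im a) *\<^sub>R - ?p (Im a + t * (Im b - Im a))"
          using e by simp
      qed
      hence "flux P a b = - integral {Im a..Im b} ?p"
        by (metis integral_neg integral_unique)
      moreover have "integral {c..Im a} ?p + integral {Im a..Im b} ?p = integral {c..Im b} ?p"
        by (rule Henstock_Kurzweil_Integration.integral_combine)
           (use c le cont in \<open>auto intro!: integrable_continuous_real\<close>)
      ultimately show ?thesis using e by (simp add: green_potential_def)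
    qed
    have "flux P a b + green_potential P u c b - green_potential P u c a = 0"
    proof (cases "Im a \<le> Im b")
      case True
      thus ?thesis using key[OF equal] c by simp
    next
      case False
      thus ?thesis using key[of b a] equal c by (simp add: flux_swap[OF P, of a b])
    qed
    thus ?thesis unfolding z by simp
  qed
  thus "integrable lborel (?f a b)" and "integral\<^sup>L lborel (?f a b) =
    flux P a b + green_potential P u c b - green_potential P u c a"
    by blast+
qed

section \<open>Green's theorem for closed polygons\<close>

fun chain_sum :: "('a \<Rightarrow> 'a \<Rightarrow> 'b::comm_monoid_add) \<Rightarrow> 'a list \<Rightarrow> 'b" where
  "chain_sum f (x # y # zs) = f x y + chain_sum f (y # zs)"
| "chain_sum f zs = 0"

lemma chain_sum_telescope:
  fixes g :: "'a \<Rightarrow> 'b::ab_group_add"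
  shows "vs \<noteq> [] \<Longrightarrow> chain_sum (\<lambda>a b. g b - g a) vs = g (last vs) - g (hd vs)"
  by (induction vs rule: induct_list012) auto

lemma chain_sum_add: "chain_sum (\<lambda>a b. f a b + g a b) vs = chain_sum f vs + chain_sum g vs"
  by (induction vs rule: induct_list012) (auto simp: algebra_simps)

lemma chain_sum_diff:
  fixes f g :: "'a \<Rightarrow> 'a \<Rightarrow> 'b::ab_group_add"
  shows "chain_sum (\<lambda>a b. f a b - g a b) vs = chain_sum f vs - chain_sum g vs"
  by (induction vs rule: induct_list012) (auto simp: algebra_simps)

lemma chain_sum_mult_left:
  fixes c :: "'b::comm_semiring_0"
  shows "chain_sum (\<lambda>a b. c * f a b) vs = c * chain_sum f vs"
  by (induction vs rule: induct_list012) (auto simp: algebra_simps)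

lemma chain_sum_mono:
  fixes f g :: "'a \<Rightarrow> 'a \<Rightarrow> 'b::ordered_comm_monoid_add"
  shows "(\<And>a b. a \<in> set vs \<Longrightarrow> b \<in> set vs \<Longrightarrow> f a b \<le> g a b) \<Longrightarrow> chain_sum f vs \<le> chain_sum g vs"
  by (induction vs rule: induct_list012) (auto intro!: add_mono)

lemma chain_sum_cong:
  "(\<And>a b. a \<in> set vs \<Longrightarrow> b \<in> set vs \<Longrightarrow> f a b = g a b) \<Longrightarrow> chain_sum f vs = chain_sum g vs"
  by (induction vs rule: induct_list012) auto

lemma Re_chain_sum: "Re (chain_sum f vs) = chain_sum (\<lambda>a b. Re (f a b)) vs"
  by (induction vs rule: induct_list012) auto

text \<open>
  \<open>Ln (\<i> * (z - w))\<close> is a primitive of \<open>1 / (z - w)\<close> that is cut along the ray going up from \<open>w\<close>.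
\<close>

lemma contour_integral_inverse_linepath_upper:
  assumes "\<And>z. z \<in> closed_segment a b \<Longrightarrow> Re z = Re w \<Longrightarrow> Im z < Im w"
  shows "contour_integral (linepath a b) (\<lambda>z. 1 / (z - w)) = Ln (\<i> * (b - w)) - Ln (\<i> * (a - w))"
proof -
  have "((\<lambda>z. 1 / (z - w)) has_contour_integral
    ((\<lambda>z. Ln (\<i> * (z - w))) (pathfinish (linepath a b)) - (\<lambda>z. Ln (\<i> * (z - w))) (pathstart (linepath a b))))
    (linepath a b)"
  proof (rule contour_integral_primitive)
    fix z assume z: "z \<in> closed_segment a b"
    have "\<i> * (z - w) \<notin> \<real>\<^sub>\<le>\<^sub>0"
      using assms[OF z] by (auto simp: complex_nonpos_Reals_iff)
    moreover have "z \<noteq> w" using assms[OF z] by auto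
    ultimately show "((\<lambda>z. Ln (\<i> * (z - w))) has_field_derivative 1 / (z - w)) (at z within closed_segment a b)"
      by (auto intro!: derivative_eq_intros simp: divide_simps)
  qed auto
  thus ?thesis by (simp add: contour_integral_unique)
qed

text \<open>
  Here the cut goes down from \<open>w\<close>.
\<close>

lemma contour_integral_inverse_linepath_lower:
  assumes "\<And>z. z \<in> closed_segment a b \<Longrightarrow> Re z = Re w \<Longrightarrow> Im w < Im z"
  shows "contour_integral (linepath a b) (\<lambda>z. 1 / (z - w)) = Ln (- (\<i> * (b - w))) - Ln (- (\<i> * (a - w)))"
proof -
  have "((\<lambda>z. 1 / (z - w)) has_contour_integral
    ((\<lambda>z. Ln (- (\<i> * (z - w)))) (pathfinish (linepath a b)) - (\<lambda>z. Ln (- (\<i> * (z - w)))) (pathstart (linepath a b))))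
    (linepath a b)"
  proof (rule contour_integral_primitive)
    fix z assume z: "z \<in> closed_segment a b"
    have "- (\<i> * (z - w)) \<notin> \<real>\<^sub>\<le>\<^sub>0"
      using assms[OF z] by (auto simp: complex_nonpos_Reals_iff)
    moreover have "z \<noteq> w" using assms[OF z] by auto
    ultimately show "((\<lambda>z. Ln (- (\<i> * (z - w)))) has_field_derivative 1 / (z - w)) (at z within closed_segment a b)"
      by (auto intro!: derivative_eq_intros simp: divide_simps)
  qed auto
  thus ?thesis by (simp add: contour_integral_unique)
qed

lemma segment_height_on_segment:
  assumes "z \<in> closed_segment a b" "Re a \<noteq> Re b"
  shows "Im z = segment_height a b (Re z)"
proof -
  obtain t where t: "z = (1 - t) *\<^sub>R a + t *\<^sub>R b"
    using assms(1) by (auto simp: closed_segment_def)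
  have "Re z = Re a + t * (Re b - Re a)" "Im z = Im a + t * (Im b - Im a)"
    unfolding t by (simp_all add: algebra_simps)
  thus ?thesis using assms(2) by (simp add: segment_height_def)
qed

lemma Re_winding_number_linepath_eq:
  assumes "w \<notin> closed_segment a b"
  shows "Re (winding_number (linepath a b) w) =
    Im (contour_integral (linepath a b) (\<lambda>z. 1 / (z - w))) / (2 * pi)"
proof -
  have "1 / (2 * complex_of_real pi * \<i>) = Complex 0 (- 1 / (2 * pi))"
    by (simp add: complex_eq_iff Re_divide Im_divide power2_eq_square field_simps)
  thus ?thesis
    using winding_number_valid_path[of "linepath a b" w] assms by simp
qed

text \<open>
  If the segment avoids the upward ray, the winding number is the increment of the branch of the
  logarithm cut along that ray. Otherwise it avoids the downward ray, and the branch cut there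
  differs from the first one by \<open>\<pi> \<i>\<close> with opposite signs on the two sides of the vertical line through \<open>w\<close>.
\<close>

lemma winding_number_linepath_crossing:
  assumes w: "w \<notin> closed_segment a b" and ne: "Re w \<noteq> Re a" "Re w \<noteq> Re b"
  shows "Re (winding_number (linepath a b) w) =
    Im (Ln (\<i> * (b - w))) / (2 * pi) - Im (Ln (\<i> * (a - w))) / (2 * pi) - crossing a b w"
proof -
  have between: "(Re a < Re w \<and> Re w < Re b) \<or> (Re b < Re w \<and> Re w < Re a)"
    if z: "z \<in> closed_segment a b" "Re z = Re w" for z
  proof -
    have "Re z \<in> closed_segment (Re a) (Re b)"
      using z(1) closed_segment_linear_image[of Re a b] by (auto simp: bounded_linear.linear[OF bounded_linear_Re])
    thus ?thesis using z(2) ne by (auto simp: closed_segment_eq_real_ivl split: if_splits)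
  qed
  have pos: "Re (winding_number (linepath a b) w) =
    Im (Ln (\<i> * (b - w))) / (2 * pi) - Im (Ln (\<i> * (a - w))) / (2 * pi) - 1"
    if w: "w \<notin> closed_segment a b" and c: "Re a < Re w" "Re w < Re b" "Im w < segment_height a b (Re w)" for a b
  proof -
    have "contour_integral (linepath a b) (\<lambda>z. 1 / (z - w)) = Ln (- (\<i> * (b - w))) - Ln (- (\<i> * (a - w)))"
      using segment_height_on_segment[of _ a b] c
      by (intro contour_integral_inverse_linepath_lower) auto
    also have "Ln (- (\<i> * (b - w))) = Ln (\<i> * (b - w)) - \<i> * pi"
      using c by (subst Ln_minus) auto
    also have "Ln (- (\<i> * (a - w))) = Ln (\<i> * (a - w)) + \<i> * pi"
      using c by (subst Ln_minus) auto
    finally have eq: "contour_integral (linepath a b) (\<lambda>z. 1 / (z - w)) =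
      Ln (\<i> * (b - w)) - \<i> * pi - (Ln (\<i> * (a - w)) + \<i> * pi)" .
    show ?thesis
      unfolding Re_winding_number_linepath_eq[OF w] eq by (simp add: diff_divide_distrib add_divide_distrib)
  qed
  consider "\<not> (Re a < Re w \<and> Re w < Re b \<and> Im w < segment_height a b (Re w))"
      "\<not> (Re b < Re w \<and> Re w < Re a \<and> Im w < segment_height a b (Re w))"
    | "Re a < Re w" "Re w < Re b" "Im w < segment_height a b (Re w)"
    | "Re b < Re w" "Re w < Re a" "Im w < segment_height a b (Re w)"
    by blast
  thus ?thesis
  proof cases
    case 1
    have c0: "crossing a b w = 0" using 1 by (simp only: crossing_def if_False)
    have "Im z < Im w" if z: "z \<in> closed_segment a b" "Re z = Re w" for z
    proof -
      have "z \<noteq> w" using z w by auto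
      moreover have "Im z = segment_height a b (Re w)"
        using segment_height_on_segment[OF z(1)] between[OF z] z(2) by auto
      ultimately show ?thesis
        using 1 between[OF z] z(2) by (auto simp: complex_eq_iff)
    qed
    thus ?thesis
      unfolding Re_winding_number_linepath_eq[OF w] using c0
      by (subst contour_integral_inverse_linepath_upper) (auto simp: diff_divide_distrib)
  next
    case 2
    thus ?thesis using pos[OF w] by (simp add: crossing_def)
  next
    case 3
    have w': "w \<notin> closed_segment b a" using w by (simp add: closed_segment_commute)
    have "winding_number (linepath b a) w = - winding_number (linepath a b) w"
      using winding_number_reversepath[of "linepath a b" w] w by simp
    thus ?thesis
      using pos[OF w'] 3 segment_height_commute[of b a "Re w"] by (simp add: crossing_def)
  qed
qed

lemma null_sets_closed_segment: "closed_segment a b \<in> null_sets (lborel :: complex measure)"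
proof -
  have "negligible (frontier (closed_segment a b))"
    by (rule negligible_convex_frontier) simp
  moreover have "frontier (closed_segment a b) = closed_segment a b"
    by (simp add: frontier_def interior_closed_segment_ge2)
  ultimately show ?thesis
    by (simp add: negligible_iff_null_sets null_sets_completion_iff)
qed

lemma null_sets_vertical_line: "{w. Re w = x} \<in> null_sets (lborel :: complex measure)"
proof -
  have "negligible {w :: complex. w \<bullet> 1 = x}"
    by (rule negligible_standard_hyperplane) (simp add: Basis_complex_def)
  moreover have "closed {w. Re w = x}"
    by (intro closed_Collect_eq continuous_intros)
  ultimately show ?thesis
    by (simp add: negligible_iff_null_sets null_sets_completion_iff inner_complex_def)
qed

text \<open>
  Around a closed polygon the branches of the logarithm telescope.
\<close>

lemma AE_chain_winding_number_crossing:
  assumes "vs \<noteq> []" "hd vs = last vs"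
  shows "AE w in lborel. chain_sum (\<lambda>a b. Re (winding_number (linepath a b) w)) vs =
    - chain_sum (\<lambda>a b. crossing a b w) vs"
proof -
  define N where "N = (\<Union>a\<in>set vs. \<Union>b\<in>set vs. closed_segment a b) \<union> (\<Union>a\<in>set vs. {w. Re w = Re a})"
  have "N \<in> null_sets (lborel :: complex measure)"
    unfolding N_def by (intro null_sets.Un null_sets.finite_UN null_sets_closed_segment null_sets_vertical_line) auto
  hence "AE w in lborel. w \<notin> N"
    by (rule AE_not_in)
  thus ?thesis
  proof eventually_elim
    case (elim w)
    define L where "L = (\<lambda>z. Im (Ln (\<i> * (z - w))) / (2 * pi))"
    have "chain_sum (\<lambda>a b. Re (winding_number (linepath a b) w)) vs =
      chain_sum (\<lambda>a b. (L b - L a) - crossing a b w) vs"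
      using elim unfolding L_def
      by (intro chain_sum_cong winding_number_linepath_crossing) (auto simp: N_def)
    also have "\<dots> = (L (last vs) - L (hd vs)) - chain_sum (\<lambda>a b. crossing a b w) vs"
      unfolding chain_sum_diff[of "\<lambda>a b. L b - L a"] chain_sum_telescope[OF assms(1)] ..
    finally show ?case using assms(2) by simp
  qed
qed

text \<open>
  Green's theorem for closed polygons, which may intersect themselves. The region below a single edge is
  unbounded; cutting it off at a height \<open>c\<close> below the polygon makes the integrals over the edges finite, and
  further down the crossings cancel.
\<close>

lemma green_closed_chain:
  assumes P: "smooth_plane P" and vs: "vs \<noteq> []" "hd vs = last vs" and c: "\<And>v. v \<in> set vs \<Longrightarrow> c < Im v"
  shows "(\<integral>w. indicator {w. c < Im w} w * (laplacian P w * chain_sum (\<lambda>a b. crossing a b w) vs) \<partial>lborel) =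
      chain_sum (flux P) vs"
    and "integrable lborel (\<lambda>w. indicator {w. c < Im w} w * (laplacian P w * chain_sum (\<lambda>a b. crossing a b w) vs))"
proof -
  obtain u where u: "\<And>v. v \<in> set vs \<Longrightarrow> u < Re v"
  proof
    fix v assume "v \<in> set vs"
    hence "Min (Re ` set vs) \<le> Re v" by simp
    thus "Min (Re ` set vs) - 1 < Re v" by simp
  qed
  have "integrable lborel (\<lambda>w. indicator {w. c < Im w} w * (laplacian P w * chain_sum (\<lambda>a b. crossing a b w) vs))
    \<and> (\<integral>w. indicator {w. c < Im w} w * (laplacian P w * chain_sum (\<lambda>a b. crossing a b w) vs) \<partial>lborel) =
      chain_sum (\<lambda>a b. flux P a b + (green_potential P u c b - green_potential P u c a)) vs"
    using c u
  proof (induction vs rule: induct_list012)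
    case (3 a b vs)
    note IH = 3(2)
    have ab: "u < Re a" "u < Re b" "c < Im a" "c < Im b" using 3(3,4) by auto
    have "integrable lborel (\<lambda>w. indicator {w. c < Im w} w * (laplacian P w * chain_sum (\<lambda>a b. crossing a b w) (b # vs)))
      \<and> (\<integral>w. indicator {w. c < Im w} w * (laplacian P w * chain_sum (\<lambda>a b. crossing a b w) (b # vs)) \<partial>lborel) =
      chain_sum (\<lambda>a b. flux P a b + (green_potential P u c b - green_potential P u c a)) (b # vs)"
      by (rule IH) (use 3(3,4) in auto)
    thus ?case
      using green_under_segment[OF P ab] by (simp add: distrib_left)
  qed auto
  thus "(\<integral>w. indicator {w. c < Im w} w * (laplacian P w * chain_sum (\<lambda>a b. crossing a b w) vs) \<partial>lborel) =
      chain_sum (flux P) vs"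
    and "integrable lborel (\<lambda>w. indicator {w. c < Im w} w * (laplacian P w * chain_sum (\<lambda>a b. crossing a b w) vs))"
    using vs by (auto simp: chain_sum_add chain_sum_telescope)
qed

section \<open>Integrability of winding numbers\<close>

text \<open>
  Cover the disc by the dyadic discs of radius \<open>r / 2\<^sup>k\<close>: off the centre, \<open>1 / \<bar>w - z\<bar>\<close> is at most \<open>2\<^sup>k\<^sup>+\<^sup>1 / r\<close> on the
  smallest of them containing \<open>w\<close>, and the weighted areas form a geometric series.
\<close>

lemma nn_integral_inverse_norm_ball:
  fixes z :: complex
  assumes r: "r > 0"
  shows "(\<integral>\<^sup>+w. ennreal (inverse (norm (w - z))) * indicator (ball z r) w \<partial>lborel) \<le> ennreal (4 * pi * r)"
proof -
  define g where "g = (\<lambda>k w. ennreal (2 ^ Suc k / r) * indicator (ball z (r / 2 ^ k)) w :: ennreal)"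
  have le: "ennreal (inverse (norm (w - z))) * indicator (ball z r) w \<le> (\<Sum>k. g k w)" for w
  proof (cases "w \<noteq> z \<and> w \<in> ball z r")
    case True
    hence pos: "norm (w - z) > 0" and lt: "norm (w - z) < r" by (auto simp: dist_norm norm_minus_commute)
    define d where "d = norm (w - z)"
    obtain n where "r / d < 2 ^ n"
      using real_arch_pow[of 2 "r / d"] by auto
    hence n: "r / 2 ^ n < d" using pos r by (simp add: d_def field_simps)
    define k where "k = (LEAST k. r / 2 ^ Suc k \<le> d)"
    have ex: "r / 2 ^ Suc n \<le> d"
    proof -
      have "r / 2 ^ Suc n = r / 2 ^ n / 2" "0 < r / 2 ^ n" using r by simp_all
      moreover have "q / 2 \<le> d" if "0 < q" "q < d" for q :: real using that by simp
      ultimately show ?thesis using n by simp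
    qed
    have k1: "r / 2 ^ Suc k \<le> d" unfolding k_def by (rule LeastI[of "\<lambda>k. r / 2 ^ Suc k \<le> d", OF ex])
    have k2: "d < r / 2 ^ k"
    proof (cases k)
      case 0 thus ?thesis using lt by (simp add: d_def)
    next
      case (Suc j)
      hence "\<not> (r / 2 ^ Suc j \<le> d)" unfolding k_def using not_less_Least lessI by metis
      thus ?thesis using Suc by simp
    qed
    have "inverse d \<le> 2 ^ Suc k / r"
      using k1 r pos by (simp add: d_def field_simps)
    hence "ennreal (inverse (norm (w - z))) * indicator (ball z r) w \<le> g k w"
      using k2 True by (auto simp: g_def d_def dist_norm norm_minus_commute intro!: ennreal_leI)
    also have "\<dots> \<le> (\<Sum>k. g k w)"
      using sum_le_suminf[of "\<lambda>k. g k w" "{k}"] by auto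
    finally show ?thesis .
  qed auto
  have m: "g k \<in> borel_measurable lborel" for k
    using borel_open[OF open_ball[of z "r / 2 ^ k"]] unfolding g_def by measurable
  have "(\<integral>\<^sup>+w. ennreal (inverse (norm (w - z))) * indicator (ball z r) w \<partial>lborel) \<le> (\<integral>\<^sup>+w. (\<Sum>k. g k w) \<partial>lborel)"
    by (intro nn_integral_mono le)
  also have "\<dots> = (\<Sum>k. \<integral>\<^sup>+w. g k w \<partial>lborel)"
    by (rule nn_integral_suminf[OF m])
  also have "(\<lambda>k. \<integral>\<^sup>+w. g k w \<partial>lborel) = (\<lambda>k. ennreal (2 * pi * r * (1 / 2) ^ k))"
  proof
    fix k
    have "(\<integral>\<^sup>+w. g k w \<partial>lborel) = ennreal (2 ^ Suc k / r) * emeasure lborel (ball z (r / 2 ^ k))"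
      unfolding g_def by (subst nn_integral_cmult_indicator) auto
    also have "\<dots> = ennreal (2 ^ Suc k / r) * ennreal (pi * (r / 2 ^ k)\<^sup>2)"
      using r by (subst emeasure_ball) (auto simp: eval_unit_ball_vol)
    also have "\<dots> = ennreal (2 * pi * r * (1 / 2) ^ k)"
      using r by (subst ennreal_mult[symmetric]) (auto simp: field_simps power2_eq_square)
    finally show "(\<integral>\<^sup>+w. g k w \<partial>lborel) = ennreal (2 * pi * r * (1 / 2) ^ k)" .
  qed
  also have "(\<Sum>k. ennreal (2 * pi * r * (1 / 2) ^ k)) = ennreal (4 * pi * r)"
  proof (rule suminf_ennreal_eq)
    have "(\<lambda>k. 2 * pi * r * (1 / 2) ^ k) sums (2 * pi * r * (1 / (1 - 1 / 2)))"
      by (intro sums_mult geometric_sums) auto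
    moreover have "2 * pi * r * (1 / (1 - 1 / 2)) = 4 * pi * r" by simp
    ultimately show "(\<lambda>k. 2 * pi * r * (1 / 2) ^ k) sums (4 * pi * r)" by (simp only:)
  qed (use r in auto)
  finally show ?thesis .
qed

text \<open>
  Uniform integrability of \<open>1 / \<bar>w - z\<bar>\<close>: small on a disc of radius \<open>r\<close>, bounded by \<open>1 / r\<close> outside.
\<close>

lemma nn_integral_inverse_norm_le:
  fixes z :: complex
  assumes r: "r > 0" and E: "E \<in> sets lborel"
  shows "(\<integral>\<^sup>+w. ennreal (inverse (norm (w - z))) * indicator E w \<partial>lborel) \<le>
    ennreal (4 * pi * r) + ennreal (1 / r) * emeasure lborel E"
proof -
  have "(\<integral>\<^sup>+w. ennreal (inverse (norm (w - z))) * indicator E w \<partial>lborel) \<le>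
    (\<integral>\<^sup>+w. ennreal (inverse (norm (w - z))) * indicator (ball z r) w + ennreal (1 / r) * indicator E w \<partial>lborel)"
  proof (rule nn_integral_mono)
    fix w
    show "ennreal (inverse (norm (w - z))) * indicator E w \<le>
      ennreal (inverse (norm (w - z))) * indicator (ball z r) w + ennreal (1 / r) * indicator E w"
    proof (cases "w \<in> ball z r")
      case True
      thus ?thesis by (auto simp: indicator_def)
    next
      case False
      hence "norm (w - z) \<ge> r" by (simp add: dist_norm norm_minus_commute)
      hence "inverse (norm (w - z)) \<le> 1 / r"
        using le_imp_inverse_le[of r] r by (simp add: inverse_eq_divide)
      thus ?thesis using False by (auto simp: indicator_def intro: ennreal_leI)
    qed
  qed
  also have "\<dots> = (\<integral>\<^sup>+w. ennreal (inverse (norm (w - z))) * indicator (ball z r) w \<partial>lborel) +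
      ennreal (1 / r) * emeasure lborel E"
  proof -
    have "(\<lambda>w. ennreal (inverse (norm (w - z))) * indicator (ball z r) w) \<in> borel_measurable lborel"
      using borel_open[OF open_ball[of z r]] by measurable
    moreover have "(\<lambda>w. ennreal (1 / r) * indicator E w) \<in> borel_measurable lborel"
      using E by measurable
    ultimately show ?thesis
      by (subst nn_integral_add) (use E in \<open>simp_all add: nn_integral_cmult_indicator\<close>)
  qed
  also have "\<dots> \<le> ennreal (4 * pi * r) + ennreal (1 / r) * emeasure lborel E"
    by (intro add_right_mono nn_integral_inverse_norm_ball r)
  finally show ?thesis .
qed

text \<open>
  A majorant of the winding number of a segment. Its integral over a small set is small relative
  to the length of the segment, uniformly in the segment; this controls inscribed
  polygons near the curve in which they are inscribed.
\<close>

definition winding_kernel :: "complex \<Rightarrow> complex \<Rightarrow> complex \<Rightarrow> ennreal" where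
  "winding_kernel a b w =
    ennreal (norm (b - a)) * (\<integral>\<^sup>+t. ennreal (inverse (norm (w - linepath a b t))) * indicator {0..1} t \<partial>lborel)"

lemma norm_winding_number_linepath_le:
  assumes w: "w \<notin> closed_segment a b"
  shows "ennreal (norm (winding_number (linepath a b) w)) \<le> winding_kernel a b w"
proof -
  let ?k = "\<lambda>t. norm (b - a) * inverse (norm (w - linepath a b t))"
  have ne: "linepath a b t \<noteq> w" if "t \<in> {0..1}" for t
    using w that linepath_in_path by blast
  have "((\<lambda>z. 1 / (z - w)) has_contour_integral contour_integral (linepath a b) (\<lambda>z. 1 / (z - w))) (linepath a b)"
    by (intro has_contour_integral_integral contour_integrable_continuous_linepath continuous_intros)
       (use w in auto)
  hence hi: "((\<lambda>t. 1 / (linepath a b t - w) * (b - a)) has_integral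
    contour_integral (linepath a b) (\<lambda>z. 1 / (z - w))) {0..1}"
    by (simp only: has_contour_integral_linepath)
  have kc: "continuous_on {0..1} ?k"
    by (intro continuous_intros) (use ne in force)+
  hence ki: "(?k has_integral integral {0..1} ?k) {0..1}"
    by (intro integrable_integral integrable_continuous_real)
  have A: "norm (contour_integral (linepath a b) (\<lambda>z. 1 / (z - w))) \<le> integral {0..1} ?k"
    unfolding integral_unique[OF hi, symmetric]
    using hi ki by (intro integral_norm_bound_integral)
      (auto simp: has_integral_integrable norm_mult norm_divide norm_inverse norm_minus_commute divide_inverse mult.commute)
  have B: "norm (winding_number (linepath a b) w) = norm (contour_integral (linepath a b) (\<lambda>z. 1 / (z - w))) / (2 * pi)"
    using w by (subst winding_number_valid_path) (auto simp: norm_divide norm_mult)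
  have C: "x / (2 * pi) \<le> x" if "x \<ge> 0" for x
    using pi_gt3 that mult_left_mono[of 1 "2 * pi" x] by (simp add: divide_le_eq)
  have "norm (winding_number (linepath a b) w) \<le> integral {0..1} ?k"
    unfolding B using order_trans[OF C[OF norm_ge_zero] A] .
  hence "ennreal (norm (winding_number (linepath a b) w)) \<le> ennreal (integral {0..1} ?k)"
    by (rule ennreal_leI)
  also have "\<dots> = (\<integral>\<^sup>+t. ennreal (?k t) * indicator {0..1} t \<partial>lborel)"
    using ki by (intro nn_integral_has_integral_lebesgue'[symmetric]) auto
  also have "\<dots> = (\<integral>\<^sup>+t. ennreal (norm (b - a)) * (ennreal (inverse (norm (w - linepath a b t))) * indicator {0..1} t) \<partial>lborel)"
    by (simp add: ennreal_mult mult.assoc)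
  also have "\<dots> = ennreal (norm (b - a)) * (\<integral>\<^sup>+t. ennreal (inverse (norm (w - linepath a b t))) * indicator {0..1} t \<partial>lborel)"
    unfolding linepath_def by (rule nn_integral_cmult) measurable
  finally show ?thesis by (simp only: winding_kernel_def)
qed

lemma borel_measurable_winding_kernel [measurable]: "winding_kernel a b \<in> borel_measurable borel"
  unfolding winding_kernel_def[abs_def] linepath_def by measurable

lemma nn_integral_winding_kernel_le:
  assumes r: "r > 0" and E: "E \<in> sets lborel"
  shows "(\<integral>\<^sup>+w. winding_kernel a b w * indicator E w \<partial>lborel) \<le>
    ennreal (norm (b - a)) * (ennreal (4 * pi * r) + ennreal (1 / r) * emeasure lborel E)"
proof -
  note [measurable] = E[unfolded sets_lborel]
  let ?f = "\<lambda>w t. ennreal (inverse (norm (w - linepath a b t))) * indicator {0..1} t"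
  have "(\<integral>\<^sup>+w. winding_kernel a b w * indicator E w \<partial>lborel) =
    (\<integral>\<^sup>+w. (\<integral>\<^sup>+t. ennreal (norm (b - a)) * ?f w t * indicator E w \<partial>lborel) \<partial>lborel)"
    unfolding winding_kernel_def linepath_def
    by (intro nn_integral_cong) (subst nn_integral_multc nn_integral_cmult; measurable)+
  also have "\<dots> = (\<integral>\<^sup>+t. (\<integral>\<^sup>+w. ennreal (norm (b - a)) * ?f w t * indicator E w \<partial>lborel) \<partial>lborel)"
    unfolding linepath_def by (rule lborel_pair.Fubini') measurable
  also have "\<dots> = (\<integral>\<^sup>+t. ennreal (norm (b - a)) * indicator {0..1} t *
      (\<integral>\<^sup>+w. ennreal (inverse (norm (w - linepath a b t))) * indicator E w \<partial>lborel) \<partial>lborel)"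
    by (intro nn_integral_cong, subst nn_integral_cmult[symmetric]) (auto simp: mult_ac)
  also have "\<dots> \<le> (\<integral>\<^sup>+t. ennreal (norm (b - a)) * indicator {0..1::real} t *
      (ennreal (4 * pi * r) + ennreal (1 / r) * emeasure lborel E) \<partial>lborel)"
    by (intro nn_integral_mono mult_left_mono nn_integral_inverse_norm_le r E) auto
  also have "\<dots> = ennreal (norm (b - a)) * (ennreal (4 * pi * r) + ennreal (1 / r) * emeasure lborel E)"
    by (subst nn_integral_multc) (auto simp: nn_integral_cmult_indicator)
  finally show ?thesis .
qed

section \<open>Polygonal paths\<close>

definition breakpoints :: "(nat \<Rightarrow> real) \<Rightarrow> nat \<Rightarrow> bool" where
  "breakpoints a n \<longleftrightarrow> n > 0 \<and> a 0 = 0 \<and> a n = 1 \<and> (\<forall>k<n. a k < a (Suc k))"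

lemma breakpoints_mono:
  assumes "breakpoints a n" "i \<le> j" "j \<le> n"
  shows "a i \<le> a j"
  using assms(2,3)
proof (induction rule: dec_induct)
  case (step k)
  thus ?case using assms(1) by (force simp: breakpoints_def dest: spec[of _ k])
qed simp

lemma breakpoints_in_01:
  assumes "breakpoints a n" "i \<le> n"
  shows "0 \<le> a i" "a i \<le> 1"
  using breakpoints_mono[OF assms(1), of 0 i] breakpoints_mono[OF assms(1), of i n] assms
  by (auto simp: breakpoints_def)

lemma breakpoints_cases:
  assumes "breakpoints a n" "0 \<le> t" "t < 1"
  obtains k where "k < n" "a k \<le> t" "t < a (Suc k)"
proof -
  have *: "\<exists>k<m. a k \<le> t \<and> t < a (Suc k)" if "t < a m" for m
    using that
  proof (induction m)
    case 0
    thus ?case using assms by (simp add: breakpoints_def)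
  next
    case (Suc m)
    show ?case
    proof (cases "t < a m")
      case True
      thus ?thesis using Suc.IH less_SucI by blast
    next
      case False
      thus ?thesis using Suc.prems by (intro exI[of _ m]) auto
    qed
  qed
  show ?thesis using *[of n] assms that by (auto simp: breakpoints_def)
qed

lemma breakpoints_uniform: "n > 0 \<Longrightarrow> breakpoints (\<lambda>k. real k / real n) n"
  by (auto simp: breakpoints_def divide_strict_right_mono)

lemma has_integral_breakpoints:
  fixes f :: "real \<Rightarrow> 'a::banach"
  assumes a: "breakpoints a n"
    and f: "\<And>k. k < n \<Longrightarrow> (f has_integral I k) {a k..a (Suc k)}"
  shows "(f has_integral (\<Sum>k<n. I k)) {0..1}"
proof -
  have "(f has_integral (\<Sum>k<m. I k)) {0..a m}" if "m \<le> n" for m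
    using that
  proof (induction m)
    case 0
    thus ?case using a has_integral_refl(2)[of f 0] by (simp add: breakpoints_def)
  next
    case (Suc m)
    have "(f has_integral (\<Sum>k<m. I k) + I m) {0..a (Suc m)}"
      by (rule has_integral_combine[where c = "a m"])
         (use Suc f[of m] breakpoints_mono[OF a, of 0 m] breakpoints_mono[OF a, of m "Suc m"] a in
           \<open>auto simp: breakpoints_def\<close>)
    thus ?case by simp
  qed
  thus ?thesis using a by (metis breakpoints_def order_refl)
qed

lemma smooth_interval_affine:
  assumes f: "\<And>t. t \<in> {a<..<b} \<Longrightarrow> f t = c + d * t"
  shows "smooth_interval a b f"
proof -
  have ev: "(g has_real_derivative d) (at t)"
    if "\<And>t. t \<in> {a<..<b} \<Longrightarrow> g t = c + d * t" "t \<in> {a<..<b}" for g c d t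
  proof (rule has_field_derivative_transform_within_open[where S = "{a<..<b}"])
    show "((\<lambda>t. c + d * t) has_real_derivative d) (at t)"
      by (auto intro!: derivative_eq_intros)
  qed (use that in auto)
  have "\<exists>c d. \<forall>t\<in>{a<..<b}. (deriv ^^ k) f t = c + d * t" for k
  proof (induction k)
    case 0
    thus ?case using f by auto
  next
    case (Suc k)
    then obtain c d where cd: "\<forall>t\<in>{a<..<b}. (deriv ^^ k) f t = c + d * t" by blast
    have "deriv ((deriv ^^ k) f) t = d" if "t \<in> {a<..<b}" for t
      using cd that by (intro DERIV_imp_deriv ev) auto
    thus ?case by (intro exI[of _ d] exI[of _ 0]) auto
  qed
  thus ?thesis
    unfolding smooth_interval_def using ev real_differentiable_def by blast
qed

lemma FPWS_piecewise_affine: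
  assumes a: "breakpoints a n"
    and f: "\<And>k t. k < n \<Longrightarrow> t \<in> {a k<..<a (Suc k)} \<Longrightarrow> f t = c k + d k * t"
  shows "FPWS f"
  unfolding FPWS_def
proof (intro exI[of _ "n - 1"] exI[of _ a] conjI allI impI)
  show "a 0 = 0" "a (n - 1 + 1) = 1" using a by (auto simp: breakpoints_def)
  fix i assume "i \<le> n - 1"
  hence i: "i < n" using a by (auto simp: breakpoints_def)
  show "a i < a (i + 1)" using a i by (simp add: breakpoints_def)
  show "smooth_interval (a i) (a (i + 1)) f"
    using f[OF i] by (intro smooth_interval_affine) auto
  show "\<exists>g. continuous_on {a i..a (i + 1)} g \<and> (\<forall>x\<in>{a i<..<a (i + 1)}. g x = f x)"
    using f[OF i] by (intro exI[of _ "\<lambda>t. c i + d i * t"]) (auto intro!: continuous_intros)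
qed

text \<open>
  The path through \<open>v 0, \<dots>, v n\<close> that reaches \<open>v k\<close> at time \<open>a k\<close>. Written with clamped parameters,
  its continuity is evident.
\<close>

definition polyline :: "(nat \<Rightarrow> real) \<Rightarrow> (nat \<Rightarrow> complex) \<Rightarrow> nat \<Rightarrow> real \<Rightarrow> complex" where
  "polyline a v n t = v 0 +
    (\<Sum>k<n. max 0 (min 1 ((t - a k) / (a (Suc k) - a k))) *\<^sub>R (v (Suc k) - v k))"

lemma polyline_eq_linepath:
  assumes a: "breakpoints a n" and k: "k < n" and t: "a k \<le> t" "t \<le> a (Suc k)"
  shows "polyline a v n t = linepath (v k) (v (Suc k)) ((t - a k) / (a (Suc k) - a k))"
proof -
  let ?c = "\<lambda>j. max 0 (min 1 ((t - a j) / (a (Suc j) - a j)))"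
  have pos: "a j < a (Suc j)" if "j < n" for j using a that by (simp add: breakpoints_def)
  have 1: "?c j = 1" if "j < k" for j
    using pos[of j] that k t breakpoints_mono[OF a, of "Suc j" k] by (simp add: field_simps)
  have 2: "?c j = 0" if "k < j" "j < n" for j
    using pos[of j] that t breakpoints_mono[OF a, of "Suc k" j] by (simp add: field_simps)
  have 3: "?c k = (t - a k) / (a (Suc k) - a k)"
    using pos[of k] k t by (simp add: field_simps)
  have split: "sum F {..<n} = sum F {..<k} + F k + sum F {Suc k..<n}" for F :: "nat \<Rightarrow> complex"
    using k sum.atLeastLessThan_concat[of 0 k n F] sum.atLeast_Suc_lessThan[of k n F]
    by (simp add: lessThan_atLeast0 add.assoc)
  have "(\<Sum>j<n. ?c j *\<^sub>R (v (Suc j) - v j)) =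
    (\<Sum>j<k. ?c j *\<^sub>R (v (Suc j) - v j)) + ?c k *\<^sub>R (v (Suc k) - v k) + (\<Sum>j=Suc k..<n. ?c j *\<^sub>R (v (Suc j) - v j))"
    by (rule split)
  also have "(\<Sum>j<k. ?c j *\<^sub>R (v (Suc j) - v j)) = (\<Sum>j<k. v (Suc j) - v j)"
    by (intro sum.cong) (use 1 in auto)
  also have "\<dots> = v k - v 0" by (rule sum_lessThan_telescope)
  also have "(\<Sum>j=Suc k..<n. ?c j *\<^sub>R (v (Suc j) - v j)) = 0"
    by (intro sum.neutral) (use 2 in auto)
  finally show ?thesis
    unfolding polyline_def 3 by (simp add: linepath_def algebra_simps)
qed

lemma continuous_on_polyline: "continuous_on A (polyline a v n)"
  unfolding polyline_def[abs_def] divide_inverse by (intro continuous_intros)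

lemma polyline_breakpoint:
  assumes "breakpoints a n" "k \<le> n"
  shows "polyline a v n (a k) = v k"
proof (cases "k = n")
  case True
  obtain m where "n = Suc m" using assms by (cases n) (auto simp: breakpoints_def)
  thus ?thesis
    using polyline_eq_linepath[OF assms(1), of m "a n" v] assms(1) True
    by (auto simp: breakpoints_def linepath_def dest!: spec[of _ m])
next
  case False
  thus ?thesis
    using polyline_eq_linepath[OF assms(1), of k "a k" v] assms
    by (auto simp: breakpoints_def linepath_def less_imp_le)
qed

lemma path_polyline: "path (polyline a v n)"
  unfolding path_def by (rule continuous_on_polyline)

lemma polyline_has_vector_derivative:
  assumes a: "breakpoints a n" and k: "k < n" and t: "t \<in> {a k<..<a (Suc k)}"
  shows "(polyline a v n has_vector_derivative (v (Suc k) - v k) /\<^sub>R (a (Suc k) - a k)) (at t)"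
proof (rule has_vector_derivative_transform_within_open[where S = "{a k<..<a (Suc k)}"])
  have pos: "a k < a (Suc k)" using a k by (simp add: breakpoints_def)
  show "((\<lambda>t. linepath (v k) (v (Suc k)) ((t - a k) / (a (Suc k) - a k)))
    has_vector_derivative (v (Suc k) - v k) /\<^sub>R (a (Suc k) - a k)) (at t)"
    unfolding linepath_def
    by (auto intro!: derivative_eq_intros simp: divide_inverse algebra_simps)
  show "linepath (v k) (v (Suc k)) ((s - a k) / (a (Suc k) - a k)) = polyline a v n s"
    if "s \<in> {a k<..<a (Suc k)}" for s
    using polyline_eq_linepath[OF a k] that by auto
qed (use t in auto)

lemma polyline_affine:
  assumes a: "breakpoints a n"
  shows "\<exists>c d. \<forall>k<n. \<forall>t\<in>{a k..a (Suc k)}. polyline a v n t = c k + of_real t * d k"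
proof (intro exI allI impI ballI)
  fix k t assume k: "k < n" and t: "t \<in> {a k..a (Suc k)}"
  show "polyline a v n t = (v k - of_real (a k / (a (Suc k) - a k)) * (v (Suc k) - v k)) +
    of_real t * ((v (Suc k) - v k) / of_real (a (Suc k) - a k))"
    using polyline_eq_linepath[OF a k, of t v] t
    by (simp add: linepath_def scaleR_conv_of_real algebra_simps diff_divide_distrib add_divide_distrib)
qed

lemma FPWS_path_polyline:
  assumes a: "breakpoints a n"
  shows "FPWS_path (polyline a v n)"
proof -
  obtain c d where cd: "\<forall>k<n. \<forall>t\<in>{a k..a (Suc k)}. polyline a v n t = c k + of_real t * d k"
    using polyline_affine[OF a, of v] by blast
  have "FPWS (Re \<circ> polyline a v n)"
    by (rule FPWS_piecewise_affine[OF a, of _ "\<lambda>k. Re (c k)" "\<lambda>k. Re (d k)"]) (simp add: cd)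
  moreover have "FPWS (Im \<circ> polyline a v n)"
    by (rule FPWS_piecewise_affine[OF a, of _ "\<lambda>k. Im (c k)" "\<lambda>k. Im (d k)"]) (simp add: cd)
  ultimately show ?thesis
    by (simp add: FPWS_path_def path_polyline)
qed

lemma polyline_image_piece:
  assumes a: "breakpoints a n" and k: "k < n"
  shows "polyline a v n ` {a k..a (Suc k)} = closed_segment (v k) (v (Suc k))"
proof -
  have pos: "a k < a (Suc k)" using a k by (simp add: breakpoints_def)
  have "polyline a v n ` {a k..a (Suc k)} =
    (\<lambda>t. linepath (v k) (v (Suc k)) ((t - a k) / (a (Suc k) - a k))) ` {a k..a (Suc k)}"
    by (intro image_cong refl polyline_eq_linepath[OF a k]) auto
  also have "\<dots> = linepath (v k) (v (Suc k)) ` ((\<lambda>t. (t - a k) / (a (Suc k) - a k)) ` {a k..a (Suc k)})"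
    by (simp add: image_image)
  also have "(\<lambda>t. (t - a k) / (a (Suc k) - a k)) ` {a k..a (Suc k)} = {0..1}"
  proof
    show "{0..1} \<subseteq> (\<lambda>t. (t - a k) / (a (Suc k) - a k)) ` {a k..a (Suc k)}"
    proof
      fix s :: real assume s: "s \<in> {0..1}"
      have "s * (a (Suc k) - a k) \<le> a (Suc k) - a k" "0 \<le> s * (a (Suc k) - a k)"
        using s pos by (auto intro!: mult_left_le_one_le)
      hence "a k + s * (a (Suc k) - a k) \<in> {a k..a (Suc k)}"
        unfolding atLeastAtMost_iff by linarith
      thus "s \<in> (\<lambda>t. (t - a k) / (a (Suc k) - a k)) ` {a k..a (Suc k)}"
        using pos by (intro image_eqI[of _ _ "a k + s * (a (Suc k) - a k)"]) simp_all
    qed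
  qed (use pos in \<open>auto simp: field_simps\<close>)
  also have "linepath (v k) (v (Suc k)) ` {0..1} = closed_segment (v k) (v (Suc k))"
    by (rule linepath_image_01)
  finally show ?thesis .
qed

lemma path_image_polyline:
  assumes a: "breakpoints a n"
  shows "path_image (polyline a v n) = (\<Union>k<n. closed_segment (v k) (v (Suc k)))"
proof -
  have "{0..1} = (\<Union>k<n. {a k..a (Suc k)})"
  proof
    show "{0..1} \<subseteq> (\<Union>k<n. {a k..a (Suc k)})"
    proof
      fix t :: real assume t: "t \<in> {0..1}"
      show "t \<in> (\<Union>k<n. {a k..a (Suc k)})"
      proof (cases "t = 1")
        case True
        obtain m where "n = Suc m" using a by (cases n) (auto simp: breakpoints_def)
        thus ?thesis using True a by (intro UN_I[of m]) (auto simp: breakpoints_def intro: less_imp_le)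
      next
        case False
        then obtain k where "k < n" "a k \<le> t" "t < a (Suc k)"
          using breakpoints_cases[OF a, of t] t by auto
        thus ?thesis by (intro UN_I[of k]) auto
      qed
    qed
    show "(\<Union>k<n. {a k..a (Suc k)}) \<subseteq> {0..1}"
    proof
      fix t assume "t \<in> (\<Union>k<n. {a k..a (Suc k)})"
      then obtain k where "k < n" "a k \<le> t" "t \<le> a (Suc k)" by auto
      thus "t \<in> {0..1}"
        using breakpoints_in_01(1)[OF a, of k] breakpoints_in_01(2)[OF a, of "Suc k"] by simp
    qed
  qed
  hence "path_image (polyline a v n) = (\<Union>k<n. polyline a v n ` {a k..a (Suc k)})"
    unfolding path_image_def by (simp add: image_UN)
  also have "\<dots> = (\<Union>k<n. closed_segment (v k) (v (Suc k)))"
    using polyline_image_piece[OF a] by simp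
  finally show ?thesis .
qed

lemma curve_length_polyline_le:
  assumes a: "breakpoints a n"
  shows "curve_length (polyline a v n) \<le> ennreal (\<Sum>k<n. 2 * dist (v k) (v (Suc k)))"
proof -
  let ?d = "\<lambda>k. 2 * dist (v k) (v (Suc k)) / (a (Suc k) - a k)"
  have pos: "a k < a (Suc k)" if "k < n" for k using a that by (simp add: breakpoints_def)
  have "AE t in lborel. t \<notin> a ` {..n}"
    by (intro AE_not_in) (simp add: finite_imp_null_set_lborel)
  hence "curve_length (polyline a v n) \<le>
    (\<integral>\<^sup>+t. (\<Sum>k<n. ennreal (?d k) * indicator {a k..a (Suc k)} t) \<partial>lborel)"
    unfolding curve_length_def
  proof (intro nn_integral_mono_AE, eventually_elim)
    case (elim t)
    show ?case
    proof (cases "t \<in> {0..1}")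
      case True
      have "t \<noteq> 1" using elim a by (auto simp: breakpoints_def image_iff)
      then obtain k where k: "k < n" "a k \<le> t" "t < a (Suc k)"
        using breakpoints_cases[OF a, of t] True by auto
      hence tk: "t \<in> {a k<..<a (Suc k)}" using elim by (force simp: less_le)
      have "2 * norm (vector_derivative (polyline a v n) (at t)) = ?d k"
        using vector_derivative_at[OF polyline_has_vector_derivative[OF a k(1) tk, of v]] pos[OF k(1)]
        by (simp add: dist_norm norm_minus_commute divide_inverse)
      hence "ennreal (2 * norm (vector_derivative (polyline a v n) (at t))) * indicator {0..1} t =
        (\<Sum>j\<in>{k}. ennreal (?d j) * indicator {a j..a (Suc j)} t)"
        using True k by simp
      also have "\<dots> \<le> (\<Sum>j<n. ennreal (?d j) * indicator {a j..a (Suc j)} t)"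
        using k by (intro sum_mono2) auto
      finally show ?thesis .
    qed simp
  qed
  also have "\<dots> = (\<Sum>k<n. ennreal (?d k) * emeasure lborel {a k..a (Suc k)})"
    by (subst nn_integral_sum) (auto simp: nn_integral_cmult_indicator)
  also have "\<dots> = (\<Sum>k<n. ennreal (2 * dist (v k) (v (Suc k))))"
  proof (intro sum.cong refl)
    fix k assume "k \<in> {..<n}"
    hence "a k < a (Suc k)" using pos by simp
    thus "ennreal (?d k) * emeasure lborel {a k..a (Suc k)} = ennreal (2 * dist (v k) (v (Suc k)))"
      by (subst emeasure_lborel_Icc) (auto simp: ennreal_mult[symmetric])
  qed
  also have "\<dots> = ennreal (\<Sum>k<n. 2 * dist (v k) (v (Suc k)))"
    by (rule sum_ennreal) simp
  finally show ?thesis .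
qed

text \<open>
  Winding numbers are additive over subpaths, and the pieces are segments.
\<close>

lemma winding_number_polyline:
  assumes a: "breakpoints a n" and z: "z \<notin> path_image (polyline a v n)"
  shows "winding_number (polyline a v n) z = (\<Sum>k<n. winding_number (linepath (v k) (v (Suc k))) z)"
proof -
  let ?p = "polyline a v n"
  have "winding_number (subpath 0 (a m) ?p) z = (\<Sum>k<m. winding_number (linepath (v k) (v (Suc k))) z)"
    if "m \<le> n" for m
    using that
  proof (induction m)
    case 0
    have "v 0 \<noteq> z"
      using z polyline_breakpoint[OF a, of 0 v] a
      by (auto simp: path_image_def breakpoints_def intro!: image_eqI[of _ _ 0])
    thus ?case
      using a polyline_breakpoint[OF a, of 0 v] by (auto simp: breakpoints_def)
  next
    case (Suc m)
    have pos: "a m < a (Suc m)" using a Suc.prems by (simp add: breakpoints_def)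
    have "subpath (a m) (a (Suc m)) ?p t = linepath (v m) (v (Suc m)) t" if "t \<in> {0..1}" for t
    proof -
      have "t * (a (Suc m) - a m) \<le> a (Suc m) - a m" "0 \<le> t * (a (Suc m) - a m)"
        using that pos by (auto intro!: mult_left_le_one_le)
      hence "a m \<le> (a (Suc m) - a m) * t + a m" "(a (Suc m) - a m) * t + a m \<le> a (Suc m)"
        unfolding mult.commute[of "a (Suc m) - a m"] by linarith+
      thus ?thesis
        using pos Suc.prems unfolding subpath_def
        by (subst polyline_eq_linepath[OF a, of m]) auto
    qed
    hence "winding_number (subpath (a m) (a (Suc m)) ?p) z = winding_number (linepath (v m) (v (Suc m))) z"
      by (intro winding_number_cong) auto
    moreover have "winding_number (subpath 0 (a m) ?p) z + winding_number (subpath (a m) (a (Suc m)) ?p) z =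
      winding_number (subpath 0 (a (Suc m)) ?p) z"
      by (rule winding_number_subpath_combine[OF path_polyline z])
         (use Suc.prems breakpoints_in_01[OF a] in auto)
    ultimately show ?case using Suc by simp
  qed
  from this[of n] show ?thesis using a by (simp add: breakpoints_def)
qed

section \<open>Simple polygons as pens\<close>

lemma chain_sum_conv_nth:
  "chain_sum f xs = (\<Sum>k<length xs - 1. f (xs ! k) (xs ! Suc k))"
  by (induction xs rule: induct_list012) (auto simp: sum.lessThan_Suc_shift simp del: sum.lessThan_Suc)

lemma chain_sum_map_upt: "chain_sum f (map v [0..<Suc n]) = (\<Sum>k<n. f (v k) (v (Suc k)))"
  by (simp add: chain_sum_conv_nth del: upt_Suc)

text \<open>
  The vertices form an \<open>n\<close>-periodic sequence, so that any vertex may be taken as the first one: the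
  definition is visibly invariant under shifts.
\<close>

definition simple_polygon :: "nat \<Rightarrow> (nat \<Rightarrow> complex) \<Rightarrow> bool" where
  "simple_polygon n v \<longleftrightarrow> n \<ge> 3 \<and> (\<forall>k. v (k + n) = v k) \<and> (\<forall>i. v i \<noteq> v (Suc i)) \<and>
    (\<forall>i. closed_segment (v i) (v (Suc i)) \<inter> closed_segment (v (Suc i)) (v (Suc (Suc i))) = {v (Suc i)}) \<and>
    (\<forall>i j. i + 2 \<le> j \<and> j + 2 \<le> i + n \<longrightarrow>
      closed_segment (v i) (v (Suc i)) \<inter> closed_segment (v j) (v (Suc j)) = {})"

definition polygon_path :: "nat \<Rightarrow> (nat \<Rightarrow> complex) \<Rightarrow> real \<Rightarrow> complex" where
  "polygon_path n v = polyline (\<lambda>k. real k / real n) v n"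

lemma simple_polygon_shift:
  assumes "simple_polygon n v"
  shows "simple_polygon n (\<lambda>k. v (k + i))"
proof -
  have "closed_segment (v (j + i)) (v (Suc (j + i))) \<inter> closed_segment (v (l + i)) (v (Suc (l + i))) = {}"
    if "j + 2 \<le> l" "l + 2 \<le> j + n" for j l
  proof -
    have "(j + i) + 2 \<le> l + i" "(l + i) + 2 \<le> (j + i) + n" using that by auto
    thus ?thesis using assms unfolding simple_polygon_def by blast
  qed
  moreover have "v (k + n + i) = v (k + i)" for k
    using assms unfolding simple_polygon_def by (metis add.assoc add.commute)
  ultimately show ?thesis
    using assms unfolding simple_polygon_def by simp
qed

lemma periodic_union_segments:
  fixes v :: "nat \<Rightarrow> complex"
  assumes "\<And>k. v (k + n) = v k" "n > 0"
  shows "(\<Union>k<n. closed_segment (v k) (v (Suc k))) = (\<Union>k. closed_segment (v k) (v (Suc k)))"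
proof -
  have *: "v (k + m * n) = v k" for k m
  proof (induction m)
    case (Suc m)
    have "v (k + Suc m * n) = v ((k + m * n) + n)" by (simp add: algebra_simps)
    thus ?case using Suc assms(1) by simp
  qed simp
  have eq: "closed_segment (v k) (v (Suc k)) = closed_segment (v (k mod n)) (v (Suc (k mod n)))" for k
    using *[of "k mod n" "k div n"] *[of "Suc (k mod n)" "k div n"] by simp
  have "closed_segment (v k) (v (Suc k)) \<subseteq> (\<Union>k<n. closed_segment (v k) (v (Suc k)))" for k
  proof -
    have "k mod n \<in> {..<n}" using assms(2) by simp
    thus ?thesis unfolding eq[of k] by (rule UN_upper)
  qed
  thus ?thesis by blast
qed

lemma path_image_polygon_path:
  assumes "simple_polygon n v"
  shows "path_image (polygon_path n v) = (\<Union>k. closed_segment (v k) (v (Suc k)))"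
  using assms path_image_polyline[OF breakpoints_uniform, of n v] periodic_union_segments[of v n]
  by (simp add: simple_polygon_def polygon_path_def)

lemma path_image_polygon_path_shift:
  assumes "simple_polygon n v"
  shows "path_image (polygon_path n (\<lambda>k. v (k + i))) = path_image (polygon_path n v)"
proof -
  have "v k = v (k + i * n)" for k i
  proof (induction i)
    case (Suc i)
    have "v (k + Suc i * n) = v ((k + i * n) + n)" by (simp add: algebra_simps)
    thus ?case using Suc assms by (simp add: simple_polygon_def)
  qed simp
  hence "closed_segment (v k) (v (Suc k)) = closed_segment (v ((k + i * (n - 1)) + i)) (v (Suc (k + i * (n - 1)) + i))" for k
  proof -
    have "(k + i * (n - 1)) + i = k + i * n" "Suc (k + i * (n - 1)) + i = Suc k + i * n"
      using assms by (cases n; simp add: simple_polygon_def algebra_simps)+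
    thus ?thesis using \<open>\<And>k i. v k = v (k + i * n)\<close> by metis
  qed
  hence "(\<Union>k. closed_segment (v k) (v (Suc k))) \<subseteq> (\<Union>k. closed_segment (v (k + i)) (v (Suc k + i)))"
    by blast
  moreover have "(\<Union>k. closed_segment (v (k + i)) (v (Suc k + i))) \<subseteq> (\<Union>k. closed_segment (v k) (v (Suc k)))"
    by auto
  ultimately show ?thesis
    unfolding path_image_polygon_path[OF simple_polygon_shift[OF assms]] path_image_polygon_path[OF assms]
    by (rule equalityI[rotated])
qed

text \<open>
  Each time before 1 corresponds to an edge and a parameter in \<open>[0,1)\<close> on it, so the point is not
  the end of its edge. A point on two edges would have to be the end of one of them.
\<close>

lemma polygon_path_inj:
  assumes v: "simple_polygon n v" and st: "0 \<le> s" "s < 1" "0 \<le> t" "t < 1"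
    and eq: "polygon_path n v s = polygon_path n v t"
  shows "s = t"
proof -
  have n: "n \<ge> 3" and per: "\<And>k. v (k + n) = v k" and ne: "\<And>i. v i \<noteq> v (Suc i)"
    and adj: "\<And>i. closed_segment (v i) (v (Suc i)) \<inter> closed_segment (v (Suc i)) (v (Suc (Suc i))) = {v (Suc i)}"
    and far: "\<And>i j. i + 2 \<le> j \<Longrightarrow> j + 2 \<le> i + n \<Longrightarrow>
      closed_segment (v i) (v (Suc i)) \<inter> closed_segment (v j) (v (Suc j)) = {}"
    using v unfolding simple_polygon_def by blast+
  have bp: "breakpoints (\<lambda>k. real k / real n) n" using n by (intro breakpoints_uniform) auto
  have piece: "\<exists>i u. i < n \<and> 0 \<le> u \<and> u < 1 \<and> s = (real i + u) / n \<and>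
      polygon_path n v s = linepath (v i) (v (Suc i)) u" if s: "0 \<le> s" "s < 1" for s
  proof -
    obtain i where i: "i < n" "real i / real n \<le> s" "s < real (Suc i) / real n"
      using breakpoints_cases[OF bp s] by blast
    have d: "real (Suc i) / real n - real i / real n = 1 / real n"
      by (simp add: diff_divide_distrib[symmetric])
    define u where "u = (s - real i / real n) / (real (Suc i) / real n - real i / real n)"
    have u: "u = s * real n - real i" unfolding u_def d using n by (simp add: field_simps)
    have "polygon_path n v s = linepath (v i) (v (Suc i)) u"
      unfolding polygon_path_def u_def using polyline_eq_linepath[OF bp i(1,2), of v] i(3) by simp
    moreover have "0 \<le> u" "u < 1" "s = (real i + u) / n"
      using i n unfolding u by (auto simp: field_simps)
    ultimately show ?thesis using i(1) by blast
  qed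
  obtain i x where i: "i < n" "0 \<le> x" "x < 1" "s = (real i + x) / n"
    "polygon_path n v s = linepath (v i) (v (Suc i)) x" using piece[OF st(1,2)] by blast
  obtain j y where j: "j < n" "0 \<le> y" "y < 1" "t = (real j + y) / n"
    "polygon_path n v t = linepath (v j) (v (Suc j)) y" using piece[OF st(3,4)] by blast
  define p where "p = polygon_path n v s"
  have p: "p \<in> closed_segment (v i) (v (Suc i))" "p \<in> closed_segment (v j) (v (Suc j))"
    using linepath_in_path[of x "v i" "v (Suc i)"] linepath_in_path[of y "v j" "v (Suc j)"] i(2,3,5) j(2,3,5) eq
    unfolding p_def by simp_all
  have lin: "linepath (v k) (v (Suc k)) a = linepath (v k) (v (Suc k)) b \<Longrightarrow> a = b" for k a b
  proof -
    assume "linepath (v k) (v (Suc k)) a = linepath (v k) (v (Suc k)) b"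
    hence "(a - b) *\<^sub>R (v (Suc k) - v k) = 0" by (simp add: linepath_def algebra_simps)
    thus "a = b" using ne[of k] by auto
  qed
  have notend: "linepath (v k) (v (Suc k)) a \<noteq> v (Suc k)" if "a < 1" for k a
    using lin[of k a 1] that by (auto simp: linepath_1')
  have pe: "p \<noteq> v (Suc i)" "p \<noteq> v (Suc j)"
    using notend[OF i(3), of i] notend[OF j(3), of j] i(5) j(5) eq by (auto simp: p_def)
  have *: "k = l" if "k \<le> l" "l < n" "p \<in> closed_segment (v k) (v (Suc k))"
    "p \<in> closed_segment (v l) (v (Suc l))" "p \<noteq> v (Suc k)" "p \<noteq> v (Suc l)" for k l
  proof (rule ccontr)
    assume "k \<noteq> l"
    hence "l = Suc k \<or> (k + 2 \<le> l \<and> l + 2 \<le> k + n) \<or> (k = 0 \<and> Suc l = n)"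
      using that(1,2) by arith
    then consider "l = Suc k" | "k + 2 \<le> l" "l + 2 \<le> k + n" | "k = 0" "Suc l = n"
      by blast
    thus False
    proof cases
      case 1
      thus False using adj[of k] that by blast
    next
      case 2
      thus False using far that by blast
    next
      case 3
      have "v (Suc l) = v k" "v (Suc (Suc l)) = v (Suc k)" using per[of 0] per[of 1] 3 by auto
      thus False using adj[of l] that by auto
    qed
  qed
  have "i = j"
    using *[of i j] *[of j i] p pe i(1) j(1) by (metis nat_le_linear)
  moreover have "x = y" using lin[of j x y] i(5) j(5) eq \<open>i = j\<close> by auto
  ultimately show ?thesis using i j by simp
qed

lemma polygon_path_endpoints:
  assumes "simple_polygon n v"
  shows "polygon_path n v 0 = v 0" "polygon_path n v 1 = v 0"
proof -
  have n: "n > 0" using assms by (simp add: simple_polygon_def)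
  show "polygon_path n v 0 = v 0"
    using polyline_breakpoint[OF breakpoints_uniform[OF n], of 0 v] by (simp add: polygon_path_def)
  show "polygon_path n v 1 = v 0"
    using polyline_breakpoint[OF breakpoints_uniform[OF n], of n v] n assms
    by (auto simp: polygon_path_def simple_polygon_def dest: spec[of _ "0::nat"])
qed

lemma simple_path_polygon_path:
  assumes v: "simple_polygon n v"
  shows "simple_path (polygon_path n v)" "pathfinish (polygon_path n v) = pathstart (polygon_path n v)"
proof -
  let ?p = "polygon_path n v"
  note ends = polygon_path_endpoints[OF v]
  show "pathfinish ?p = pathstart ?p"
    by (simp add: pathfinish_def pathstart_def ends)
  have "x = y \<or> x = 0 \<and> y = 1 \<or> x = 1 \<and> y = 0"
    if "x \<in> {0..1}" "y \<in> {0..1}" "?p x = ?p y" for x y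
  proof -
    have "x = y \<or> x = 0 \<and> y = 1 \<or> x = 1 \<and> y = 0" if "x \<in> {0..1}" "y \<in> {0..1}" "?p x = ?p y" "x \<noteq> 1" for x y
    proof (cases "y = 1")
      case True
      thus ?thesis using polygon_path_inj[OF v, of x 0] that ends by auto
    next
      case False
      thus ?thesis using polygon_path_inj[OF v, of x y] that by auto
    qed
    from this[of x y] this[of y x] that show ?thesis by (cases "x = 1"; cases "y = 1") auto
  qed
  thus "simple_path ?p"
    by (simp add: simple_path_def loop_free_def polygon_path_def path_polyline)
qed

text \<open>
  After a shift of the vertices the point lies in the interior of the arc formed by the first two
  edges. The complement of the other edges is the neighbourhood.
\<close>

lemma polygon_image_local_arc:
  assumes v: "simple_polygon n v" and w: "w \<in> path_image (polygon_path n v)"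
  shows "\<exists>U \<gamma>. open U \<and> w \<in> U \<and> FPWS_path \<gamma> \<and> arc \<gamma> \<and> path_image (polygon_path n v) \<inter> U = \<gamma> ` {0<..<1}"
proof -
  have n: "n \<ge> 3" and per: "\<And>k. v (k + n) = v k" using v by (auto simp: simple_polygon_def)
  obtain i where i: "w \<in> closed_segment (v i) (v (Suc i))"
    using w path_image_polygon_path[OF v] by auto
  \<comment> \<open>The shift that makes \<open>w\<close> the second vertex, or an inner or end point of the first edge.\<close>
  define l where "l = (if w = v i then i + (n - 1) else i)"
  define v' where "v' = (\<lambda>k. v (k + l))"
  define q where "q = polygon_path n v'"
  have v': "simple_polygon n v'" unfolding v'_def by (rule simple_polygon_shift[OF v])
  have im: "path_image q = path_image (polygon_path n v)"
    unfolding q_def v'_def by (rule path_image_polygon_path_shift[OF v])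
  have bp: "breakpoints (\<lambda>k. real k / real n) n" using n by (intro breakpoints_uniform) auto
  note sp = simple_path_polygon_path[OF v', folded q_def]
  note ends = polygon_path_endpoints[OF v', folded q_def]
  have q01: "q 0 = q 1" using ends by simp
  note inj = polygon_path_inj[OF v', folded q_def]
  have nn: "2 / real n < 1" "0 < 2 / real n" using n by auto
  have "\<exists>s. 0 < s \<and> s < 2 / real n \<and> q s = w"
  proof (cases "w = v i")
    case True
    have "v' 1 = v (i + n)" using True n by (simp add: v'_def l_def)
    hence "q (1 / real n) = w"
      using polyline_breakpoint[OF bp, of 1 v'] n per True by (simp add: q_def polygon_path_def)
    thus ?thesis using n by (intro exI[of _ "1 / real n"]) (auto simp: divide_strict_right_mono)
  next
    case False
    hence "w \<in> q ` {0..1 / real n}"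
      using polyline_image_piece[OF bp, of 0 v'] n i by (simp add: q_def polygon_path_def v'_def l_def)
    then obtain s where s: "0 \<le> s" "s \<le> 1 / real n" "q s = w" by auto
    have "s \<noteq> 0" using s False ends(1) by (auto simp: v'_def l_def)
    moreover have "s < 2 / real n" using s(2) n by (auto intro: le_less_trans simp: divide_strict_right_mono)
    ultimately show ?thesis using s by (intro exI[of _ s]) auto
  qed
  then obtain s where s: "0 < s" "s < 2 / real n" "q s = w" by blast
  have qc: "continuous_on A q" for A
    unfolding q_def polygon_path_def by (rule continuous_on_polyline)
  have disj: "q x \<noteq> q y" if "0 < x" "x < 2 / real n" "y \<in> {2 / real n..1}" for x y
  proof
    assume e: "q x = q y"
    show False
    proof (cases "y = 1")
      case True
      thus False using e q01 inj[of x 0] that nn by auto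
    next
      case False
      thus False using e inj[of x y] that nn by auto
    qed
  qed
  define U where "U = - q ` {2 / real n..1}"
  define \<gamma> where "\<gamma> = subpath 0 (2 / real n) q"
  have "open U"
    unfolding U_def by (intro open_Compl compact_imp_closed compact_continuous_image qc) auto
  moreover have "w \<in> U" using s disj unfolding U_def by blast
  moreover have "arc \<gamma>"
    unfolding \<gamma>_def by (rule arc_simple_path_subpath_interior[OF sp(1)]) (use nn in auto)
  moreover have "FPWS_path \<gamma>"
  proof -
    obtain c d where cd: "\<forall>k<n. \<forall>t\<in>{real k / real n..real (Suc k) / real n}. q t = c k + of_real t * d k"
      using polyline_affine[OF bp, of v'] unfolding q_def polygon_path_def by blast
    have g: "\<gamma> t = c k + of_real (2 / real n * t) * d k"
      if "k < 2" "t \<in> {real k / real 2<..<real (Suc k) / real 2}" for k t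
    proof -
      have "real k \<le> 2 * t" "2 * t \<le> real (Suc k)" using that(2) by (auto simp: field_simps)
      hence "2 / real n * t \<in> {real k / real n..real (Suc k) / real n}"
        using n by (auto simp: divide_right_mono)
      moreover have "k < n" using that(1) n by simp
      ultimately have "q (2 / real n * t) = c k + of_real (2 / real n * t) * d k"
        using cd by blast
      thus ?thesis by (simp add: \<gamma>_def subpath_def)
    qed
    have bp2: "breakpoints (\<lambda>k. real k / real 2) 2" by (rule breakpoints_uniform) simp
    have "FPWS (Re \<circ> \<gamma>)"
      by (rule FPWS_piecewise_affine[OF bp2, of _ "\<lambda>k. Re (c k)" "\<lambda>k. 2 / real n * Re (d k)"]) (use g in simp)
    moreover have "FPWS (Im \<circ> \<gamma>)"
      by (rule FPWS_piecewise_affine[OF bp2, of _ "\<lambda>k. Im (c k)" "\<lambda>k. 2 / real n * Im (d k)"]) (use g in simp)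
    moreover have "path \<gamma>" using \<open>arc \<gamma>\<close> by (rule arc_imp_path)
    ultimately show ?thesis by (simp add: FPWS_path_def)
  qed
  moreover have "path_image (polygon_path n v) \<inter> U = \<gamma> ` {0<..<1}"
  proof -
    have "\<gamma> ` {0<..<1} = q ` ((\<lambda>t. 2 / real n * t) ` {0<..<1})"
      by (simp add: \<gamma>_def subpath_def image_image)
    also have "(\<lambda>t. 2 / real n * t) ` {0<..<1} = {0<..<2 / real n}"
    proof (intro equalityI subsetI)
      fix x assume "x \<in> {0<..<2 / real n}"
      thus "x \<in> (\<lambda>t. 2 / real n * t) ` {0<..<1}"
        using n by (intro image_eqI[of _ _ "x * real n / 2"]) (auto simp: field_simps)
    next
      fix x assume "x \<in> (\<lambda>t. 2 / real n * t) ` {0<..<1}"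
      then obtain t where x: "x = 2 / real n * t" and "t \<in> {0<..<1}" by (rule imageE)
      hence t: "x = 2 / real n * t" "0 < t" "t < 1" by simp_all
      thus "x \<in> {0<..<2 / real n}"
        using mult_strict_left_mono[OF t(3) nn(2)] mult_pos_pos[OF nn(2) t(2)] by simp
    qed
    finally have g: "\<gamma> ` {0<..<1} = q ` {0<..<2 / real n}" .
    have "q ` {0..1} \<inter> U = q ` {0<..<2 / real n}"
    proof
      show "q ` {0<..<2 / real n} \<subseteq> q ` {0..1} \<inter> U"
      proof
        fix z assume "z \<in> q ` {0<..<2 / real n}"
        then obtain x where z: "z = q x" and "x \<in> {0<..<2 / real n}" by (rule imageE)
        hence x: "0 < x" "x < 2 / real n" by simp_all
        have "z \<in> q ` {0..1}" unfolding z by (rule imageI) (use x less_trans[OF x(2) nn(1)] in simp)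
        moreover have "z \<in> U" using disj[OF x] unfolding U_def z by (metis ComplI imageE)
        ultimately show "z \<in> q ` {0..1} \<inter> U" by (rule IntI)
      qed
      show "q ` {0..1} \<inter> U \<subseteq> q ` {0<..<2 / real n}"
      proof
        fix z assume z: "z \<in> q ` {0..1} \<inter> U"
        then obtain x where x: "z = q x" "x \<in> {0..1}" by (meson IntD1 imageE)
        have "x \<notin> {2 / real n..1}" using z x unfolding U_def by blast
        moreover have "x \<noteq> 0"
        proof
          assume "x = 0"
          hence "z = q 1" using x q01 by simp
          moreover have "(1::real) \<in> {2 / real n..1}" using nn by simp
          ultimately show False using z unfolding U_def by blast
        qed
        ultimately have "x \<in> {0<..<2 / real n}" using x(2) by simp
        thus "z \<in> q ` {0<..<2 / real n}" unfolding x(1) by (rule imageI)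
      qed
    qed
    thus ?thesis using im g by (simp add: path_image_def)
  qed
  ultimately show ?thesis by blast
qed

lemma pen_inside_simple_polygon:
  assumes v: "simple_polygon n v"
  defines "A \<equiv> inside (path_image (polygon_path n v))"
  shows "pen A" "frontier A = path_image (polygon_path n v)"
    "perimeter A \<le> ennreal (\<Sum>k<n. 2 * dist (v k) (v (Suc k)))"
proof -
  note sp = simple_path_polygon_path[OF v]
  note J = Jordan_inside_outside[OF sp]
  show fr: "frontier A = path_image (polygon_path n v)"
    using J unfolding A_def by blast
  have "FPWS_boundary A"
    unfolding FPWS_boundary_def fr using polygon_image_local_arc[OF v] by blast
  thus "pen A"
    unfolding pen_def A_def using J simply_connected_inside_simple_path[OF sp(1)] by blast
  have bp: "breakpoints (\<lambda>k. real k / real n) n" using v by (intro breakpoints_uniform) (auto simp: simple_polygon_def)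
  have "perimeter A \<le> curve_length (polygon_path n v)"
    unfolding perimeter_def
    by (rule INF_lower) (use sp fr FPWS_path_polyline[OF bp, of v] in \<open>auto simp: polygon_path_def\<close>)
  also have "\<dots> \<le> ennreal (\<Sum>k<n. 2 * dist (v k) (v (Suc k)))"
    unfolding polygon_path_def by (rule curve_length_polyline_le[OF bp])
  finally show "perimeter A \<le> ennreal (\<Sum>k<n. 2 * dist (v k) (v (Suc k)))" .
qed

text \<open>
  The winding number of a Jordan curve is \<open>1\<close> or \<open>-1\<close> throughout the inside.
\<close>

lemma flux_simple_polygon:
  assumes P: "smooth_plane P" and v: "simple_polygon n v"
  shows "\<bar>\<Sum>k<n. flux P (v k) (v (Suc k))\<bar> =
    \<bar>set_lebesgue_integral lborel (inside (path_image (polygon_path n v))) (laplacian P)\<bar>"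
proof -
  define p where "p = polygon_path n v"
  define A where "A = inside (path_image p)"
  define vs where "vs = map v [0..<Suc n]"
  note sp = simple_path_polygon_path[OF v, folded p_def]
  note J = Jordan_inside_outside[OF sp, folded A_def]
  have n: "n > 0" using v by (auto simp: simple_polygon_def)
  have bp: "breakpoints (\<lambda>k. real k / real n) n" by (rule breakpoints_uniform[OF n])
  have vs: "vs \<noteq> []" "hd vs = last vs"
    using v n by (auto simp: vs_def hd_map simple_polygon_def last_map simp del: upt_Suc dest: spec[of _ "0::nat"])
  have "bounded (A \<union> set vs)" using J by (simp add: finite_imp_bounded)
  then obtain M where M: "\<And>w. w \<in> A \<union> set vs \<Longrightarrow> norm w \<le> M" by (auto simp: bounded_iff)
  define c where "c = - M - 1"
  have c: "c < Im w" if "w \<in> A \<union> set vs" for w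
    using M[OF that] abs_Im_le_cmod[of w] unfolding c_def by linarith
  obtain \<epsilon> :: real where \<epsilon>: "\<bar>\<epsilon>\<bar> = 1" "\<And>z. z \<in> A \<Longrightarrow> winding_number p z = of_real \<epsilon>"
    using simple_closed_path_winding_number_inside[OF sp(1)] unfolding A_def
    by (metis abs_minus_cancel abs_one of_real_1 of_real_minus)
  have null: "path_image p \<in> null_sets lborel"
    unfolding p_def polygon_path_def path_image_polyline[OF bp]
    by (intro null_sets.finite_UN null_sets_closed_segment) (use n in auto)
  have ae: "AE w in lborel. indicator {w. c < Im w} w * (laplacian P w * chain_sum (\<lambda>a b. crossing a b w) vs) =
    - \<epsilon> * (indicator A w * laplacian P w)"
    using AE_chain_winding_number_crossing[OF vs] AE_not_in[OF null]
  proof eventually_elim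
    case (elim w)
    have "winding_number p w = chain_sum (\<lambda>a b. winding_number (linepath a b) w) vs"
      using winding_number_polyline[OF bp, of w v] elim(2)
      by (simp add: vs_def chain_sum_map_upt p_def polygon_path_def del: upt_Suc)
    hence cr: "chain_sum (\<lambda>a b. crossing a b w) vs = - Re (winding_number p w)"
      using elim(1) by (simp add: Re_chain_sum)
    show ?case
    proof (cases "w \<in> A")
      case True
      thus ?thesis using c[of w] \<epsilon>(2)[OF True] cr by simp
    next
      case False
      hence "w \<in> outside (path_image p)" using J elim(2) by auto
      hence "winding_number p w = 0"
        using winding_number_zero_in_outside[OF simple_path_imp_path[OF sp(1)] sp(2)] by simp
      thus ?thesis using False cr by simp
    qed
  qed
  have Ab: "A \<in> sets borel" using J by simp
  have "chain_sum (flux P) vs =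
    (\<integral>w. indicator {w. c < Im w} w * (laplacian P w * chain_sum (\<lambda>a b. crossing a b w) vs) \<partial>lborel)"
    using green_closed_chain(1)[OF P vs, of c] c by simp
  also have "\<dots> = (\<integral>w. - \<epsilon> * (indicator A w * laplacian P w) \<partial>lborel)"
  proof (rule integral_cong_AE[OF _ _ ae])
    show "(\<lambda>w. indicator {w. c < Im w} w * (laplacian P w * chain_sum (\<lambda>a b. crossing a b w) vs)) \<in> borel_measurable lborel"
      using green_closed_chain(2)[OF P vs, of c] c by (intro borel_measurable_integrable) auto
    have "laplacian P \<in> borel_measurable borel"
      by (intro borel_measurable_continuous_onI continuous_on_laplacian P)
    thus "(\<lambda>w. - \<epsilon> * (indicator A w * laplacian P w)) \<in> borel_measurable lborel"
      using Ab by measurable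
  qed
  also have "\<dots> = - \<epsilon> * set_lebesgue_integral lborel A (laplacian P)"
    by (simp add: set_lebesgue_integral_def)
  finally have "\<bar>chain_sum (flux P) vs\<bar> = \<bar>set_lebesgue_integral lborel A (laplacian P)\<bar>"
    using \<epsilon>(1) by (simp add: abs_mult)
  thus ?thesis by (simp add: vs_def chain_sum_map_upt A_def p_def del: upt_Suc)
qed

section \<open>Enclosing closed polygons by stockyards\<close>

lemma chain_sum_append:
  "chain_sum f (xs @ x # ys) = chain_sum f (xs @ [x]) + chain_sum f (x # ys)"
  by (induction xs rule: induct_list012) (auto simp: add.assoc)

fun edge_union :: "complex list \<Rightarrow> complex set" where
  "edge_union (x # y # zs) = closed_segment x y \<union> edge_union (y # zs)"
| "edge_union zs = {}"

lemma edge_union_append: "edge_union (xs @ x # ys) = edge_union (xs @ [x]) \<union> edge_union (x # ys)"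
  by (induction xs rule: induct_list012) auto

lemma edge_union_conv_nth:
  "edge_union xs = (\<Union>k<length xs - 1. closed_segment (xs ! k) (xs ! Suc k))"
proof (induction xs rule: induct_list012)
  case (3 x y zs)
  have "{..<length (x # y # zs) - 1} = insert 0 (Suc ` {..<length (y # zs) - 1})"
    by (simp add: lessThan_Suc_eq_insert_0)
  thus ?case using 3 by simp
qed auto

text \<open>
  A closed polygon is given by the list of its vertices without repetition of the first one.
\<close>

definition cycle :: "'a list \<Rightarrow> 'a list" where
  "cycle vs = vs @ [hd vs]"

lemma chain_sum_cycle_rotate1: "chain_sum f (cycle (rotate1 vs)) = chain_sum f (cycle vs)"
proof (cases vs)
  case (Cons a xs)
  show ?thesis
  proof (cases xs)
    case (Cons b ys)
    show ?thesis
      using chain_sum_append[of f xs a "[b]"] \<open>vs = a # xs\<close> Cons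
      by (simp add: cycle_def add.commute)
  qed (simp add: \<open>vs = a # xs\<close>)
qed simp

lemma edge_union_cycle_rotate1: "edge_union (cycle (rotate1 vs)) = edge_union (cycle vs)"
proof (cases vs)
  case (Cons a xs)
  show ?thesis
  proof (cases xs)
    case (Cons b ys)
    show ?thesis
      using edge_union_append[of xs a "[b]"] \<open>vs = a # xs\<close> Cons
      by (auto simp add: cycle_def)
  qed (simp add: \<open>vs = a # xs\<close>)
qed simp

lemma chain_sum_cycle_rotate: "chain_sum f (cycle (rotate i vs)) = chain_sum f (cycle vs)"
  by (induction i) (simp_all add: chain_sum_cycle_rotate1)

lemma edge_union_cycle_rotate: "edge_union (cycle (rotate i vs)) = edge_union (cycle vs)"
  by (induction i) (simp_all add: edge_union_cycle_rotate1)

text \<open>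
  Stockyards whose fences contain the closed polygon, with perimeters (doubled lengths, by convention)
  that exceed twice its length by an arbitrarily small amount, and that hold at least its absolute flux.
\<close>

definition enclosable :: "(complex \<Rightarrow> real) \<Rightarrow> complex list \<Rightarrow> bool" where
  "enclosable P vs \<longleftrightarrow> (\<forall>\<eta>>0. \<exists>R. (\<forall>A\<in>set R. pen A) \<and>
     connected (\<Union>A\<in>set R. frontier A) \<and> edge_union (cycle vs) \<subseteq> (\<Union>A\<in>set R. frontier A) \<and>
     (\<Sum>A\<leftarrow>R. perimeter A) \<le> ennreal (2 * chain_sum dist (cycle vs) + \<eta>) \<and>
     \<bar>chain_sum (flux P) (cycle vs)\<bar> \<le> (\<Sum>A\<leftarrow>R. set_lebesgue_integral lborel A (laplacian P)))"

lemma enclosable_rotate: "enclosable P (rotate i vs) \<longleftrightarrow> enclosable P vs"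
  by (simp add: enclosable_def chain_sum_cycle_rotate edge_union_cycle_rotate)

lemma chain_sum_dist_nonneg: "chain_sum dist vs \<ge> (0::real)"
  by (induction vs rule: induct_list012) auto

text \<open>
  Stockyards of two closed polygons with a common point have a connected union.
\<close>

lemma enclosable_merge:
  assumes e: "enclosable P us" "enclosable P ws"
    and meet: "edge_union (cycle us) \<inter> edge_union (cycle ws) \<noteq> {}"
    and tr: "edge_union (cycle vs) \<subseteq> edge_union (cycle us) \<union> edge_union (cycle ws)"
    and len: "chain_sum dist (cycle us) + chain_sum dist (cycle ws) \<le> chain_sum dist (cycle vs)"
    and fl: "chain_sum (flux P) (cycle vs) = chain_sum (flux P) (cycle us) + chain_sum (flux P) (cycle ws)"
  shows "enclosable P vs"
  unfolding enclosable_def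
proof (intro allI impI)
  fix \<eta> :: real assume \<eta>: "\<eta> > 0"
  hence h: "\<eta> / 2 > 0" by simp
  let ?I = "\<lambda>A. set_lebesgue_integral lborel A (laplacian P)"
  obtain R where R: "\<forall>A\<in>set R. pen A" "connected (\<Union>A\<in>set R. frontier A)"
    "edge_union (cycle us) \<subseteq> (\<Union>A\<in>set R. frontier A)"
    "(\<Sum>A\<leftarrow>R. perimeter A) \<le> ennreal (2 * chain_sum dist (cycle us) + \<eta> / 2)"
    "\<bar>chain_sum (flux P) (cycle us)\<bar> \<le> (\<Sum>A\<leftarrow>R. ?I A)"
    using e(1)[unfolded enclosable_def, rule_format, OF h] by blast
  obtain S where S: "\<forall>A\<in>set S. pen A" "connected (\<Union>A\<in>set S. frontier A)"
    "edge_union (cycle ws) \<subseteq> (\<Union>A\<in>set S. frontier A)"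
    "(\<Sum>A\<leftarrow>S. perimeter A) \<le> ennreal (2 * chain_sum dist (cycle ws) + \<eta> / 2)"
    "\<bar>chain_sum (flux P) (cycle ws)\<bar> \<le> (\<Sum>A\<leftarrow>S. ?I A)"
    using e(2)[unfolded enclosable_def, rule_format, OF h] by blast
  have "(\<Sum>A\<leftarrow>R @ S. perimeter A) \<le> ennreal (2 * chain_sum dist (cycle us) + \<eta> / 2) +
    ennreal (2 * chain_sum dist (cycle ws) + \<eta> / 2)"
    using add_mono[OF R(4) S(4)] by simp
  also have "\<dots> = ennreal ((2 * chain_sum dist (cycle us) + \<eta> / 2) + (2 * chain_sum dist (cycle ws) + \<eta> / 2))"
    using \<eta> by (intro ennreal_plus[symmetric] add_nonneg_nonneg mult_nonneg_nonneg chain_sum_dist_nonneg) auto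
  also have "\<dots> \<le> ennreal (2 * chain_sum dist (cycle vs) + \<eta>)"
    using len by (intro ennreal_leI) simp
  finally have per: "(\<Sum>A\<leftarrow>R @ S. perimeter A) \<le> ennreal (2 * chain_sum dist (cycle vs) + \<eta>)" .
  have "(\<Union>A\<in>set R. frontier A) \<inter> (\<Union>A\<in>set S. frontier A) \<noteq> {}"
    using R(3) S(3) meet by blast
  from connected_Un[OF R(2) S(2) this]
  have conn: "connected (\<Union>A\<in>set (R @ S). frontier A)" by (simp add: UN_Un)
  show "\<exists>R. (\<forall>A\<in>set R. pen A) \<and> connected (\<Union>A\<in>set R. frontier A) \<and>
     edge_union (cycle vs) \<subseteq> (\<Union>A\<in>set R. frontier A) \<and>
     (\<Sum>A\<leftarrow>R. perimeter A) \<le> ennreal (2 * chain_sum dist (cycle vs) + \<eta>) \<and>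
     \<bar>chain_sum (flux P) (cycle vs)\<bar> \<le> (\<Sum>A\<leftarrow>R. ?I A)"
  proof (intro exI[of _ "R @ S"] conjI per conn)
    show "\<forall>A\<in>set (R @ S). pen A" using R(1) S(1) by auto
    show "edge_union (cycle vs) \<subseteq> (\<Union>A\<in>set (R @ S). frontier A)" using R(3) S(3) tr by auto
    show "\<bar>chain_sum (flux P) (cycle vs)\<bar> \<le> (\<Sum>A\<leftarrow>R @ S. ?I A)"
      using R(5) S(5) unfolding fl by simp
  qed
qed

lemma set_lebesgue_integral_laplacian_nonneg:
  assumes "\<And>z. laplacian P z \<ge> 0"
  shows "set_lebesgue_integral lborel A (laplacian P) \<ge> 0"
  unfolding set_lebesgue_integral_def by (intro Bochner_Integration.integral_nonneg) (simp add: assms)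

lemma cycle_conv_map:
  assumes "vs \<noteq> []"
  shows "cycle vs = map (\<lambda>k. vs ! (k mod length vs)) [0..<Suc (length vs)]"
  using assms by (intro nth_equalityI) (auto simp: cycle_def nth_append hd_conv_nth less_Suc_eq simp del: upt_Suc)

lemma enclosable_simple_polygon:
  assumes P: "smooth_plane P" "\<And>z. laplacian P z \<ge> 0" and vs: "vs \<noteq> []"
    and v: "simple_polygon (length vs) (\<lambda>k. vs ! (k mod length vs))"
  shows "enclosable P vs"
  unfolding enclosable_def
proof (intro allI impI)
  fix \<eta> :: real assume \<eta>: "\<eta> > 0"
  let ?n = "length vs" and ?v = "\<lambda>k. vs ! (k mod length vs)"
  define A where "A = inside (path_image (polygon_path ?n ?v))"
  note pen = pen_inside_simple_polygon[OF v, folded A_def]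
  have cs: "chain_sum f (cycle vs) = (\<Sum>k<?n. f (?v k) (?v (Suc k)))" for f :: "complex \<Rightarrow> complex \<Rightarrow> real"
    unfolding cycle_conv_map[OF vs] by (rule chain_sum_map_upt)
  have bp: "breakpoints (\<lambda>k. real k / real ?n) ?n" using vs by (intro breakpoints_uniform) auto
  have tr: "edge_union (cycle vs) = frontier A"
    unfolding pen(2) polygon_path_def path_image_polyline[OF bp] edge_union_conv_nth cycle_conv_map[OF vs]
    by (simp del: upt_Suc)
  have conn: "connected (frontier A)"
    unfolding pen(2) using simple_path_polygon_path[OF v] by (intro connected_simple_path_image)
  have "perimeter A \<le> ennreal (2 * chain_sum dist (cycle vs))"
    using pen(3) unfolding cs by (simp add: sum_distrib_left)
  also have "\<dots> \<le> ennreal (2 * chain_sum dist (cycle vs) + \<eta>)"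
    using \<eta> by (intro ennreal_leI) simp
  finally have per: "perimeter A \<le> ennreal (2 * chain_sum dist (cycle vs) + \<eta>)" .
  have "\<bar>chain_sum (flux P) (cycle vs)\<bar> = set_lebesgue_integral lborel A (laplacian P)"
    using flux_simple_polygon[OF P(1) v] set_lebesgue_integral_laplacian_nonneg[OF P(2), of A]
    unfolding cs A_def by simp
  thus "\<exists>R. (\<forall>A\<in>set R. pen A) \<and> connected (\<Union>A\<in>set R. frontier A) \<and>
     edge_union (cycle vs) \<subseteq> (\<Union>A\<in>set R. frontier A) \<and>
     (\<Sum>A\<leftarrow>R. perimeter A) \<le> ennreal (2 * chain_sum dist (cycle vs) + \<eta>) \<and>
     \<bar>chain_sum (flux P) (cycle vs)\<bar> \<le> (\<Sum>A\<leftarrow>R. set_lebesgue_integral lborel A (laplacian P))"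
    using pen(1) conn tr per by (intro exI[of _ "[A]"]) simp
qed

lemma simple_polygon_triangle:
  assumes nc: "\<not> collinear {a, b, c}"
  shows "simple_polygon (length [a, b, c]) (\<lambda>k. [a, b, c] ! (k mod length [a, b, c]))"
proof -
  let ?v = "\<lambda>k. [a, b, c] ! (k mod 3)"
  have m: "k mod 3 = 0 \<or> k mod 3 = 1 \<or> k mod 3 = 2" for k :: nat by linarith
  have Sm: "Suc k mod 3 = (if k mod 3 = 2 then 0 else Suc (k mod 3))" for k :: nat
    by (simp add: mod_Suc)
  have ne: "a \<noteq> b" "b \<noteq> c" "c \<noteq> a"
    using nc by (auto simp: insert_commute)
  have nc': "\<not> collinear {b, c, a}" "\<not> collinear {c, a, b}"
    using nc by (simp_all add: insert_commute)
  have I: "closed_segment a b \<inter> closed_segment b c = {b}" "closed_segment b c \<inter> closed_segment c a = {c}"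
    "closed_segment c a \<inter> closed_segment a b = {a}"
    using nc nc' by (auto intro!: Int_closed_segment)
  have "?v i \<noteq> ?v (Suc i)" for i
    using m[of i] ne unfolding Sm by auto
  moreover have "closed_segment (?v i) (?v (Suc i)) \<inter> closed_segment (?v (Suc i)) (?v (Suc (Suc i))) = {?v (Suc i)}" for i
    using m[of i] I unfolding Sm[of "Suc i"] Sm[of i] by auto
  moreover have "\<not> (i + 2 \<le> j \<and> j + 2 \<le> i + 3)" for i j :: nat by auto
  ultimately show ?thesis
    by (simp add: simple_polygon_def)
qed

text \<open>
  A segment traversed back and forth has flux 0; the sides of a thin triangle with this segment as
  one side have total length only slightly above twice its length.
\<close>

lemma enclosable_two:
  assumes P: "smooth_plane P" "\<And>z. laplacian P z \<ge> 0" and ab: "a \<noteq> b"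
  shows "enclosable P [a, b]"
  unfolding enclosable_def
proof (intro allI impI)
  fix \<eta> :: real assume \<eta>: "\<eta> > 0"
  \<comment> \<open>The height of the triangle relative to its base.\<close>
  define s where "s = \<eta> / (8 * dist a b)"
  have s: "s > 0" using \<eta> ab by (simp add: s_def)
  \<comment> \<open>The apex lies above the midpoint of the base.\<close>
  define c where "c = (a + b) / 2 + \<i> * of_real s * (b - a)"
  have ca: "c - a = (1 / 2 + \<i> * of_real s) * (b - a)" and cb: "c - b = (- 1 / 2 + \<i> * of_real s) * (b - a)"
    by (simp_all add: c_def field_simps)
  have n1: "norm (1 / 2 + \<i> * of_real s) \<le> 1 / 2 + s"
    using norm_triangle_ineq[of "1 / 2" "\<i> * of_real s"] s by (simp add: norm_mult)
  have n2: "norm (- 1 / 2 + \<i> * of_real s) \<le> 1 / 2 + s"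
    using norm_triangle_ineq[of "- 1 / 2" "\<i> * of_real s"] s by (simp add: norm_mult)
  have d: "dist b c \<le> (1 / 2 + s) * dist a b" "dist c a \<le> (1 / 2 + s) * dist a b"
    using mult_right_mono[OF n2, of "norm (b - a)"] mult_right_mono[OF n1, of "norm (b - a)"]
    by (simp_all add: dist_norm norm_minus_commute[of b c] norm_minus_commute[of a b] ca cb norm_mult)
  have "\<not> collinear {a, b, c}"
  proof
    assume "collinear {a, b, c}"
    hence "collinear {b, a, c}" by (simp add: insert_commute)
    hence "collinear {0, b - a, c - a}" by (subst (asm) collinear_3) auto
    hence "c - a = 0 \<or> (\<exists>t. c - a = t *\<^sub>R (b - a))"
      using ab unfolding collinear_lemma by auto
    then obtain t where "c - a = t *\<^sub>R (b - a)"
      by (metis scaleR_zero_left)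
    hence "(1 / 2 + \<i> * of_real s) * (b - a) = of_real t * (b - a)"
      unfolding ca by (simp add: scaleR_conv_of_real)
    hence "1 / 2 + \<i> * of_real s = of_real t" using ab by (subst (asm) mult_right_cancel) auto
    thus False using s by (auto simp: complex_eq_iff)
  qed
  from enclosable_simple_polygon[OF P _ simple_polygon_triangle[OF this]]
  have "enclosable P [a, b, c]" by simp
  then obtain R where R: "\<forall>A\<in>set R. pen A" "connected (\<Union>A\<in>set R. frontier A)"
    "edge_union (cycle [a, b, c]) \<subseteq> (\<Union>A\<in>set R. frontier A)"
    "(\<Sum>A\<leftarrow>R. perimeter A) \<le> ennreal (2 * chain_sum dist (cycle [a, b, c]) + \<eta> / 2)"
    using half_gt_zero[OF \<eta>] unfolding enclosable_def by blast
  have "edge_union (cycle [a, b]) \<subseteq> edge_union (cycle [a, b, c])"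
    by (auto simp: cycle_def closed_segment_commute)
  moreover have "2 * chain_sum dist (cycle [a, b, c]) + \<eta> / 2 \<le> 2 * chain_sum dist (cycle [a, b]) + \<eta>"
  proof -
    have "s * dist a b = \<eta> / 8" using ab by (simp add: s_def)
    thus ?thesis using d by (simp add: cycle_def dist_commute algebra_simps)
  qed
  hence "ennreal (2 * chain_sum dist (cycle [a, b, c]) + \<eta> / 2) \<le> ennreal (2 * chain_sum dist (cycle [a, b]) + \<eta>)"
    by (rule ennreal_leI)
  moreover have "chain_sum (flux P) (cycle [a, b]) = 0"
    using flux_swap[OF P(1), of b a] by (simp add: cycle_def)
  moreover have "0 \<le> (\<Sum>A\<leftarrow>R. set_lebesgue_integral lborel A (laplacian P))"
    by (intro sum_list_nonneg) (auto intro: set_lebesgue_integral_laplacian_nonneg[OF P(2)])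
  ultimately show "\<exists>R. (\<forall>A\<in>set R. pen A) \<and> connected (\<Union>A\<in>set R. frontier A) \<and>
     edge_union (cycle [a, b]) \<subseteq> (\<Union>A\<in>set R. frontier A) \<and>
     (\<Sum>A\<leftarrow>R. perimeter A) \<le> ennreal (2 * chain_sum dist (cycle [a, b]) + \<eta>) \<and>
     \<bar>chain_sum (flux P) (cycle [a, b])\<bar> \<le> (\<Sum>A\<leftarrow>R. set_lebesgue_integral lborel A (laplacian P))"
    using R by (intro exI[of _ R]) (auto intro: order_trans)
qed

lemma enclosable_one:
  assumes P: "smooth_plane P" "\<And>z. laplacian P z \<ge> 0"
  shows "enclosable P [a]"
  unfolding enclosable_def
proof (intro allI impI)
  fix \<eta> :: real assume \<eta>: "\<eta> > 0"
  define b where "b = a + of_real (\<eta> / 8)"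
  have "enclosable P [a, b]" using \<eta> by (intro enclosable_two[OF P]) (simp add: b_def)
  then obtain R where R: "\<forall>A\<in>set R. pen A" "connected (\<Union>A\<in>set R. frontier A)"
    "edge_union (cycle [a, b]) \<subseteq> (\<Union>A\<in>set R. frontier A)"
    "(\<Sum>A\<leftarrow>R. perimeter A) \<le> ennreal (2 * chain_sum dist (cycle [a, b]) + \<eta> / 2)"
    using half_gt_zero[OF \<eta>] unfolding enclosable_def by blast
  have "2 * chain_sum dist (cycle [a, b]) + \<eta> / 2 = 2 * chain_sum dist (cycle [a]) + \<eta>"
    using \<eta> by (simp add: cycle_def b_def dist_norm)
  moreover have "edge_union (cycle [a]) \<subseteq> edge_union (cycle [a, b])" by (auto simp: cycle_def)
  moreover have "0 \<le> (\<Sum>A\<leftarrow>R. set_lebesgue_integral lborel A (laplacian P))"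
    by (intro sum_list_nonneg) (auto intro: set_lebesgue_integral_laplacian_nonneg[OF P(2)])
  ultimately show "\<exists>R. (\<forall>A\<in>set R. pen A) \<and> connected (\<Union>A\<in>set R. frontier A) \<and>
     edge_union (cycle [a]) \<subseteq> (\<Union>A\<in>set R. frontier A) \<and>
     (\<Sum>A\<leftarrow>R. perimeter A) \<le> ennreal (2 * chain_sum dist (cycle [a]) + \<eta>) \<and>
     \<bar>chain_sum (flux P) (cycle [a])\<bar> \<le> (\<Sum>A\<leftarrow>R. set_lebesgue_integral lborel A (laplacian P))"
    using R by (intro exI[of _ R]) (auto simp: cycle_def)
qed

lemma chain_sum_split_edges:
  "chain_sum f (p # q # B @ r # s # C) =
    f p q + chain_sum f (q # B @ [r]) + f r s + chain_sum f (s # C)"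
  using chain_sum_append[of f "p # q # B" r "s # C"] by (simp add: add.assoc)

lemma edge_union_split_edges:
  "edge_union (p # q # B @ r # s # C) =
    closed_segment p q \<union> edge_union (q # B @ [r]) \<union> closed_segment r s \<union> edge_union (s # C)"
  using edge_union_append[of "p # q # B" r "s # C"] by auto

lemma closed_segment_split:
  fixes x :: complex
  assumes "x \<in> closed_segment p q"
  shows "closed_segment p q = closed_segment p x \<union> closed_segment x q"
  using Un_closed_segment[OF assms] by simp

lemma dist_segment_split:
  fixes x :: complex
  assumes "x \<in> closed_segment p q"
  shows "dist p q = dist p x + dist x q"
  using assms by (simp add: between_mem_segment[symmetric] between)

text \<open>
  At a common point \<open>x\<close> of two edges that are not adjacent, the closed polygon splits into two closed
  polygons through \<open>x\<close>, each with fewer vertices.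
\<close>

lemma enclosable_split_crossing:
  assumes P: "smooth_plane P" and x: "x \<in> closed_segment p q" "x \<in> closed_segment r s"
    and e: "enclosable P (x # q # B @ [r])" "enclosable P (x # s # C @ [p])"
  shows "enclosable P (p # q # B @ r # s # C)"
proof (rule enclosable_merge[OF e])
  have c1: "cycle (x # q # B @ [r]) = x # q # B @ r # x # []" by (simp add: cycle_def)
  have c2: "cycle (x # s # C @ [p]) = x # s # C @ p # x # []" by (simp add: cycle_def)
  have c: "cycle (p # q # B @ r # s # C) = p # q # B @ r # s # (C @ [p])" by (simp add: cycle_def)
  have sum: "chain_sum f (cycle (p # q # B @ r # s # C)) =
      chain_sum f (cycle (x # q # B @ [r])) + chain_sum f (cycle (x # s # C @ [p]))"
    if "f p q = f p x + f x q" "f r s = f r x + f x s" for f :: "complex \<Rightarrow> complex \<Rightarrow> real"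
    unfolding c1 c2 c chain_sum_split_edges that by simp
  show "chain_sum dist (cycle (x # q # B @ [r])) + chain_sum dist (cycle (x # s # C @ [p]))
    \<le> chain_sum dist (cycle (p # q # B @ r # s # C))"
    using sum[of dist] dist_segment_split[OF x(1)] dist_segment_split[OF x(2)] by simp
  show "chain_sum (flux P) (cycle (p # q # B @ r # s # C)) =
    chain_sum (flux P) (cycle (x # q # B @ [r])) + chain_sum (flux P) (cycle (x # s # C @ [p]))"
    by (intro sum flux_split[OF P] x)
  show "edge_union (cycle (x # q # B @ [r])) \<inter> edge_union (cycle (x # s # C @ [p])) \<noteq> {}"
    unfolding c1 c2 edge_union_split_edges by auto
  show "edge_union (cycle (p # q # B @ r # s # C)) \<subseteq>
      edge_union (cycle (x # q # B @ [r])) \<union> edge_union (cycle (x # s # C @ [p]))"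
    unfolding c1 c2 c edge_union_split_edges closed_segment_split[OF x(1)] closed_segment_split[OF x(2)] by auto
qed

text \<open>
  Two consecutive edges that overlap: the doubled part is cut off.
\<close>

lemma enclosable_split_spike:
  assumes P: "smooth_plane P" and col: "s \<in> closed_segment p q \<or> p \<in> closed_segment q s"
    and e: "\<And>a b. enclosable P [a, b]" "enclosable P (p # s # C)"
  shows "enclosable P (p # q # s # C)"
proof -
  \<comment> \<open>The tip of the spike is \<open>q\<close>; the doubled part is the segment from \<open>x\<close> to \<open>q\<close>.\<close>
  define x where "x = (if s \<in> closed_segment p q then s else p)"
  have c1: "cycle [x, q] = [x, q, x]" "cycle (p # s # C) = p # s # C @ [p]"
    "cycle (p # q # s # C) = p # q # s # C @ [p]" by (simp_all add: cycle_def)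
  have sum: "chain_sum f (cycle (p # q # s # C)) = chain_sum f (cycle [x, q]) + chain_sum f (cycle (p # s # C))"
    if "\<And>a b y. y \<in> closed_segment a b \<Longrightarrow> f a b = f a y + f y b" for f :: "complex \<Rightarrow> complex \<Rightarrow> real"
    using that[of s p q] that[of p q s] col unfolding c1 unfolding x_def by auto
  show ?thesis
  proof (rule enclosable_merge[OF e(1)[of x q] e(2)])
    show "chain_sum dist (cycle [x, q]) + chain_sum dist (cycle (p # s # C)) \<le> chain_sum dist (cycle (p # q # s # C))"
      using sum[of dist] dist_segment_split by simp
    show "chain_sum (flux P) (cycle (p # q # s # C)) =
      chain_sum (flux P) (cycle [x, q]) + chain_sum (flux P) (cycle (p # s # C))"
      by (intro sum flux_split[OF P])
    show "edge_union (cycle [x, q]) \<inter> edge_union (cycle (p # s # C)) \<noteq> {}"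
      unfolding c1 unfolding x_def by auto
    show "edge_union (cycle (p # q # s # C)) \<subseteq> edge_union (cycle [x, q]) \<union> edge_union (cycle (p # s # C))"
      using col closed_segment_split[of s p q] closed_segment_split[of p q s]
      unfolding c1 unfolding x_def by (auto simp: closed_segment_commute)
  qed
qed

lemma enclosable_drop_repeated:
  assumes "enclosable P (p # B)"
  shows "enclosable P (p # p # B)"
proof -
  have "edge_union (cycle (p # p # B)) = insert p (edge_union (cycle (p # B)))"
    by (simp add: cycle_def)
  moreover have "p \<in> edge_union (cycle (p # B))"
    by (cases B) (auto simp: cycle_def)
  ultimately have t: "edge_union (cycle (p # p # B)) = edge_union (cycle (p # B))" by auto
  have c: "chain_sum dist (cycle (p # p # B)) = chain_sum dist (cycle (p # B))"
    "chain_sum (flux P) (cycle (p # p # B)) = chain_sum (flux P) (cycle (p # B))"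
    by (simp_all add: cycle_def)
  show ?thesis
    using assms unfolding enclosable_def t c .
qed

text \<open>
  Induction on the number of vertices. A closed polygon with at least three vertices that is not
  simple has a vanishing edge, two overlapping consecutive edges or two other edges that meet,
  and each of these defects splits it into smaller closed polygons.
\<close>

lemma closed_polygon_enclosable:
  assumes P: "smooth_plane P" "\<And>z. laplacian P z \<ge> 0"
  shows "vs \<noteq> [] \<Longrightarrow> enclosable P vs"
proof (induction "length vs" arbitrary: vs rule: less_induct)
  case less
  note IH = less(1)
  have two: "enclosable P [a, b]" for a b
    using enclosable_two[OF P, of a b] enclosable_drop_repeated[OF enclosable_one[OF P, of a]]
    by (cases "a = b") auto
  define n where "n = length vs"
  define v where "v = (\<lambda>k. vs ! (k mod n))"
  show ?case
  proof (cases "n \<ge> 3")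
    case False
    then consider a where "vs = [a]" | a b where "vs = [a, b]"
      using less(2) unfolding n_def by (cases vs; cases "tl vs"; cases "tl (tl vs)") auto
    thus ?thesis using enclosable_one[OF P] two by cases auto
  next
    case n: True
    have rot: "rotate i vs ! k = v (i + k)" if "k < n" for i k
      using that unfolding v_def n_def by (subst nth_rotate) auto
    have len: "length (rotate i vs) = n" for i by (simp add: n_def)
    have three: "\<exists>C. rotate i vs = v i # v (Suc i) # v (Suc (Suc i)) # C" for i
    proof -
      have "rotate i vs = rotate i vs ! 0 # rotate i vs ! 1 # rotate i vs ! 2 # drop 3 (rotate i vs)"
        using n len[of i] by (cases "rotate i vs"; cases "tl (rotate i vs)"; cases "tl (tl (rotate i vs))") auto
      thus ?thesis using rot[of 0 i] rot[of 1 i] rot[of 2 i] n by auto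
    qed
    show ?thesis
    proof (rule ccontr)
      assume not: "\<not> enclosable P vs"
      have ne: "v i \<noteq> v (Suc i)" for i
      proof
        assume e: "v i = v (Suc i)"
        obtain C where C: "rotate i vs = v i # v (Suc i) # v (Suc (Suc i)) # C" using three by blast
        have "enclosable P (v i # v (Suc (Suc i)) # C)"
          by (rule IH) (use C len[of i] in \<open>auto simp: n_def\<close>)
        from enclosable_drop_repeated[OF this] show False
          using not e C enclosable_rotate[of P i vs] by simp
      qed
      have adj: "closed_segment (v i) (v (Suc i)) \<inter> closed_segment (v (Suc i)) (v (Suc (Suc i))) = {v (Suc i)}" for i
      proof (rule ccontr)
        let ?p = "v i" and ?q = "v (Suc i)" and ?s = "v (Suc (Suc i))"
        assume bad: "closed_segment ?p ?q \<inter> closed_segment ?q ?s \<noteq> {?q}"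
        hence "collinear {?p, ?q, ?s}" "?q \<notin> closed_segment ?p ?s"
          using Int_closed_segment[of ?q ?p ?s] by blast+
        hence col: "?s \<in> closed_segment ?p ?q \<or> ?p \<in> closed_segment ?q ?s"
          by (auto simp: collinear_between_cases between_mem_segment closed_segment_commute)
        obtain C where C: "rotate i vs = ?p # ?q # ?s # C" using three by blast
        have "enclosable P (?p # ?s # C)"
          by (rule IH) (use C len[of i] in \<open>auto simp: n_def\<close>)
        from enclosable_split_spike[OF P(1) col two this] show False
          using not C enclosable_rotate[of P i vs] by simp
      qed
      have far: "closed_segment (v i) (v (Suc i)) \<inter> closed_segment (v j) (v (Suc j)) = {}"
        if ij: "i + 2 \<le> j" "j + 2 \<le> i + n" for i j
      proof (rule ccontr)
        assume "closed_segment (v i) (v (Suc i)) \<inter> closed_segment (v j) (v (Suc j)) \<noteq> {}"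
        then obtain x where x: "x \<in> closed_segment (v i) (v (Suc i))" "x \<in> closed_segment (v j) (v (Suc j))" by blast
        define ws where "ws = rotate i vs"
        define m where "m = j - i"
        have m: "2 \<le> m" "Suc m < n" using ij by (auto simp: m_def)
        define B where "B = take (m - 2) (drop 2 ws)"
        define C where "C = drop (Suc (Suc m)) ws"
        have lw: "length ws = n" using len by (simp add: ws_def)
        have w: "ws ! 0 = v i" "ws ! 1 = v (Suc i)" "ws ! m = v j" "ws ! Suc m = v (Suc j)"
          using rot[of 0 i] rot[of 1 i] rot[of m i] rot[of "Suc m" i] m n ij unfolding ws_def m_def by auto
        have "ws = take m ws @ ws ! m # ws ! Suc m # C"
          using id_take_nth_drop[of m ws] Cons_nth_drop_Suc[of "Suc m" ws] m lw by (simp add: C_def)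
        moreover have "take m ws = ws ! 0 # ws ! 1 # B"
        proof -
          obtain D where "ws = v i # v (Suc i) # D" using three[of i] unfolding ws_def by auto
          moreover obtain m' where "m = Suc (Suc m')" using m(1) by (metis add_2_eq_Suc le_Suc_ex)
          ultimately show ?thesis by (simp add: B_def)
        qed
        ultimately have ws: "ws = v i # v (Suc i) # B @ v j # v (Suc j) # C" using w by simp
        have l: "n = length B + length C + 4" using ws lw by simp
        have "enclosable P (x # v (Suc i) # B @ [v j])"
          by (rule IH) (use l in \<open>auto simp: n_def\<close>)
        moreover have "enclosable P (x # v (Suc j) # C @ [v i])"
          by (rule IH) (use l in \<open>auto simp: n_def\<close>)
        ultimately have "enclosable P ws"
          unfolding ws by (rule enclosable_split_crossing[OF P(1) x])
        thus False using not enclosable_rotate[of P i vs] by (simp add: ws_def)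
      qed
      have "simple_polygon n v"
        unfolding simple_polygon_def using n ne adj far by (auto simp: v_def)
      thus False
        using enclosable_simple_polygon[OF P less(2)] not unfolding n_def v_def by simp
    qed
  qed
qed

section \<open>Polygons inscribed in the curves of \<open>\<Lambda>\<close>\<close>

lemma flux_approx:
  assumes P: "smooth_plane P" and \<omega>: "\<And>z. z \<in> closed_segment a b \<Longrightarrow> norm (flux_field P z - F) \<le> \<omega>"
  shows "\<bar>flux P a b - Re (F * (b - a))\<bar> \<le> \<omega> * norm (b - a)"
proof -
  have \<omega>0: "0 \<le> \<omega>" by (rule order_trans[OF norm_ge_zero \<omega>[OF ends_in_segment(1)]])
  have ci: "flux_field P contour_integrable_on linepath a b"
    by (intro contour_integrable_continuous_linepath continuous_on_flux_field P)
  have "((\<lambda>z. flux_field P z - F) has_contour_integral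
      (contour_integral (linepath a b) (flux_field P) - F * (b - a))) (linepath a b)"
    by (intro has_contour_integral_diff has_contour_integral_integral ci has_contour_integral_const_linepath)
  hence "norm (contour_integral (linepath a b) (flux_field P) - F * (b - a)) \<le> \<omega> * norm (b - a)"
    by (rule has_contour_integral_bound_linepath[OF _ \<omega>0 \<omega>])
  moreover have "\<bar>Re (contour_integral (linepath a b) (flux_field P) - F * (b - a))\<bar> \<le>
    norm (contour_integral (linepath a b) (flux_field P) - F * (b - a))" by (rule abs_Re_le_cmod)
  ultimately show ?thesis by (simp add: flux_def)
qed

lemma FPWS_integral_derivative:
  assumes f: "FPWS f" and B: "\<And>t. t \<in> {0..1} \<Longrightarrow> \<bar>f t\<bar> \<le> B"
  obtains S where "finite S" "{0, 1} \<subseteq> S" "\<And>t. t \<in> {0..1} - S \<Longrightarrow> isCont f t"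
    "\<And>t. t \<in> {0..1} - S \<Longrightarrow> ((\<lambda>r. integral {0..r} f) has_real_derivative f t) (at t)"
    "f integrable_on {0..1}"
proof -
  obtain S where S: "finite S" "{0, 1} \<subseteq> S" "\<And>t. t \<in> {0..1} - S \<Longrightarrow> isCont f t"
    using FPWS_finite_discontinuities[OF f] by blast
  have int: "f integrable_on {0..1}"
    by (rule bounded_finite_discontinuities_integrable[OF S B])
  have "((\<lambda>r. integral {0..r} f) has_real_derivative f t) (at t)" if t: "t \<in> {0..1} - S" for t
  proof -
    have t01: "t \<in> {0<..<1}" using t S(2) by (auto simp: less_le)
    have "continuous (at t within {0..1} - {}) f"
      by (rule continuous_at_imp_continuous_at_within[OF S(3)[OF t]])
    hence "((\<lambda>r. integral {0..r} f) has_vector_derivative f t) (at t within {0..1} - {})"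
      using int t by (intro integral_has_vector_derivative_continuous_at) auto
    thus ?thesis
      using t01 at_within_interior[of t "{0..1}"]
      by (simp add: interior_atLeastAtMost_real has_real_derivative_iff_has_vector_derivative)
  qed
  with S int show ?thesis using that by blast
qed

definition gamma_curve :: "complex \<Rightarrow> real \<Rightarrow> (real \<Rightarrow> real) \<Rightarrow> (real \<Rightarrow> real) \<Rightarrow> real \<Rightarrow> complex" where
  "gamma_curve z0 \<delta> \<alpha> \<beta> r = Complex (gamma1 z0 \<delta> \<alpha> r) (gamma2 z0 \<delta> \<beta> r)"

definition gamma_velocity :: "real \<Rightarrow> (real \<Rightarrow> real) \<Rightarrow> (real \<Rightarrow> real) \<Rightarrow> real \<Rightarrow> complex" where
  "gamma_velocity \<delta> \<alpha> \<beta> r = Complex (\<delta> / 2 * \<alpha> r) (- (\<delta> / 2 * \<beta> r))"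

lemma Xstar_bounds:
  assumes "(\<alpha>, \<beta>) \<in> Xstar" "t \<in> {0..1}"
  shows "\<bar>\<alpha> t\<bar> \<le> 1" "\<bar>\<beta> t\<bar> \<le> 1" "sqrt ((\<alpha> t)\<^sup>2 + (\<beta> t)\<^sup>2) < 1"
proof -
  have lt: "(\<alpha> t)\<^sup>2 + (\<beta> t)\<^sup>2 < 1" using assms by (auto simp: Xstar_def)
  thus "sqrt ((\<alpha> t)\<^sup>2 + (\<beta> t)\<^sup>2) < 1" by simp
  have "(\<alpha> t)\<^sup>2 \<ge> 0" "(\<beta> t)\<^sup>2 \<ge> 0" by auto
  hence "(\<alpha> t)\<^sup>2 \<le> 1" "(\<beta> t)\<^sup>2 \<le> 1" using lt by linarith+
  thus "\<bar>\<alpha> t\<bar> \<le> 1" "\<bar>\<beta> t\<bar> \<le> 1" by (simp_all add: abs_square_le_1)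
qed

lemma norm_gamma_velocity:
  "\<delta> \<ge> 0 \<Longrightarrow> norm (gamma_velocity \<delta> \<alpha> \<beta> t) = \<delta> / 2 * sqrt ((\<alpha> t)\<^sup>2 + (\<beta> t)\<^sup>2)"
proof -
  assume "\<delta> \<ge> 0"
  have "norm (gamma_velocity \<delta> \<alpha> \<beta> t) = sqrt ((\<delta> / 2)\<^sup>2 * ((\<alpha> t)\<^sup>2 + (\<beta> t)\<^sup>2))"
    by (simp add: gamma_velocity_def complex_norm power_mult_distrib power_divide algebra_simps)
  also have "\<dots> = \<delta> / 2 * sqrt ((\<alpha> t)\<^sup>2 + (\<beta> t)\<^sup>2)"
    unfolding real_sqrt_mult using \<open>\<delta> \<ge> 0\<close> by simp
  finally show ?thesis .
qed

text \<open>
  Near a point of continuity the integrand is bounded away from 1.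
\<close>

lemma integral_less_one:
  fixes h :: "real \<Rightarrow> real"
  assumes int: "h integrable_on {0..1}" and S: "finite S" "\<And>t. t \<in> {0..1} - S \<Longrightarrow> isCont h t"
    and lt: "\<And>t. t \<in> {0..1} \<Longrightarrow> h t < 1"
  shows "integral {0..1} h < 1"
proof -
  have "infinite ({0<..<1::real} - S)" using S(1) by (simp add: infinite_Ioo)
  hence "{0<..<1::real} - S \<noteq> {}" by (rule infinite_imp_nonempty)
  then obtain t where t: "t \<in> {0<..<1}" "t \<notin> S" by blast
  define m where "m = (1 + h t) / 2"
  have m: "h t < m" "m < 1" using lt[of t] t by (auto simp: m_def)
  have "isCont h t" using S(2)[of t] t by auto
  hence "eventually (\<lambda>x. h x < m) (at t)"
    unfolding isCont_def by (rule order_tendstoD(2)) (rule m(1))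
  then obtain d where d0: "d > 0" "\<forall>x\<in>UNIV. x \<noteq> t \<and> dist x t < d \<longrightarrow> h x < m"
    unfolding eventually_at by blast
  have d: "d > 0" "h x < m" if "\<bar>x - t\<bar> < d" for x
    using d0 m(1) that by (cases "x = t"; simp add: dist_real_def)+
  define b where "b = min (t + d / 2) 1"
  have b: "t < b" "b \<le> 1" "b < t + d" using t d0(1) by (auto simp: b_def)
  have sub: "h integrable_on {u..w}" if "0 \<le> u" "w \<le> 1" for u w
    by (rule integrable_subinterval_real[OF int]) (use that in auto)
  have "integral {0..1} h = integral {0..t} h + (integral {t..b} h + integral {b..1} h)"
    using Henstock_Kurzweil_Integration.integral_combine[of 0 t 1 h]
      Henstock_Kurzweil_Integration.integral_combine[of t b 1 h] t b int sub by auto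
  also have "integral {0..t} h \<le> integral {0..t} (\<lambda>_. 1)"
    by (intro Henstock_Kurzweil_Integration.integral_le sub) (use t in \<open>auto intro!: less_imp_le lt\<close>)
  also have "integral {t..b} h \<le> integral {t..b} (\<lambda>_. m)"
    using d b t by (intro Henstock_Kurzweil_Integration.integral_le sub) (auto intro!: less_imp_le)
  also have "integral {b..1} h \<le> integral {b..1} (\<lambda>_. 1)"
    by (intro Henstock_Kurzweil_Integration.integral_le sub) (use t b in \<open>auto intro!: less_imp_le lt\<close>)
  finally have "integral {0..1} h \<le> t + (m * (b - t) + (1 - b))" using t b by (simp add: mult.commute)
  also have "\<dots> < t + (1 * (b - t) + (1 - b))"
    using m b by (intro add_strict_left_mono add_strict_right_mono mult_strict_right_mono) auto
  finally show ?thesis by simp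
qed

text \<open>
  What is needed of the curves of \<open>\<Lambda>\<close>: they are closed, the fundamental theorem of calculus holds for
  them, and their mean speed is strictly below the bound, so that a little length is left over.
\<close>

lemma Xstar_curve:
  fixes z0 :: complex
  assumes X: "(\<alpha>, \<beta>) \<in> Xstar" and \<delta>: "\<delta> > 0" and P: "smooth_plane P"
  defines "\<gamma> \<equiv> gamma_curve z0 \<delta> \<alpha> \<beta>" and "g \<equiv> gamma_velocity \<delta> \<alpha> \<beta>"
    and "h \<equiv> \<lambda>t. sqrt ((\<alpha> t)\<^sup>2 + (\<beta> t)\<^sup>2)"
  shows "\<gamma> 0 = z0" "\<gamma> 1 = z0" "continuous_on {0..1} \<gamma>"
    "\<And>s t. 0 \<le> s \<Longrightarrow> s \<le> t \<Longrightarrow> t \<le> 1 \<Longrightarrow> (g has_integral \<gamma> t - \<gamma> s) {s..t}"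
    "h integrable_on {0..1}" "integral {0..1} h < 1"
    "((\<lambda>r. Re (flux_field P (\<gamma> r) * g r)) has_integral Lambda_curve P z0 \<delta> \<alpha> \<beta>) {0..1}"
proof -
  note bd = Xstar_bounds[OF X]
  have FP: "FPWS \<alpha>" "FPWS \<beta>" and i0: "integral {0..1} \<alpha> = 0" "integral {0..1} \<beta> = 0"
    using X by (auto simp: Xstar_def)
  obtain S1 where S1: "finite S1" "{0, 1} \<subseteq> S1" "\<And>t. t \<in> {0..1} - S1 \<Longrightarrow> isCont \<alpha> t"
    "\<And>t. t \<in> {0..1} - S1 \<Longrightarrow> ((\<lambda>r. integral {0..r} \<alpha>) has_real_derivative \<alpha> t) (at t)" "\<alpha> integrable_on {0..1}"
    using FPWS_integral_derivative[OF FP(1) bd(1)] by blast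
  obtain S2 where S2: "finite S2" "{0, 1} \<subseteq> S2" "\<And>t. t \<in> {0..1} - S2 \<Longrightarrow> isCont \<beta> t"
    "\<And>t. t \<in> {0..1} - S2 \<Longrightarrow> ((\<lambda>r. integral {0..r} \<beta>) has_real_derivative \<beta> t) (at t)" "\<beta> integrable_on {0..1}"
    using FPWS_integral_derivative[OF FP(2) bd(2)] by blast
  define S where "S = S1 \<union> S2"
  have S: "finite S" "{0, 1} \<subseteq> S" using S1(1,2) S2(1) by (auto simp: S_def)
  have c: "continuous_on {0..1} (\<lambda>r. integral {0..r} \<alpha>)" "continuous_on {0..1} (\<lambda>r. integral {0..r} \<beta>)"
    by (intro indefinite_integral_continuous_1 S1 S2)+
  show \<gamma>c: "continuous_on {0..1} \<gamma>"
    unfolding \<gamma>_def gamma_curve_def[abs_def] gamma1_def gamma2_def Complex_eq by (intro continuous_intros c)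
  show "\<gamma> 0 = z0" "\<gamma> 1 = z0"
    by (simp_all add: \<gamma>_def gamma_curve_def gamma1_def gamma2_def i0 complex_eq_iff)
  have d12: "(gamma1 z0 \<delta> \<alpha> has_real_derivative \<delta> / 2 * \<alpha> t) (at t)"
    "(gamma2 z0 \<delta> \<beta> has_real_derivative - (\<delta> / 2 * \<beta> t)) (at t)" if t: "t \<in> {0..1} - S" for t
    unfolding gamma1_def[abs_def] gamma2_def[abs_def] using t
    by (auto intro!: derivative_eq_intros S1(4) S2(4) simp: S_def)
  have vd: "(\<gamma> has_vector_derivative g t) (at t)" if t: "t \<in> {0..1} - S" for t
  proof -
    have "((\<lambda>r. of_real (gamma1 z0 \<delta> \<alpha> r) + \<i> * of_real (gamma2 z0 \<delta> \<beta> r)) has_vector_derivative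
      of_real (\<delta> / 2 * \<alpha> t) + \<i> * of_real (- (\<delta> / 2 * \<beta> t))) (at t)"
      by (intro has_vector_derivative_add has_vector_derivative_mult_right has_vector_derivative_of_real d12 t)
    thus ?thesis
      by (simp only: \<gamma>_def gamma_curve_def[abs_def] g_def gamma_velocity_def Complex_eq)
  qed
  show "(g has_integral \<gamma> t - \<gamma> s) {s..t}" if "0 \<le> s" "s \<le> t" "t \<le> 1" for s t
  proof (rule fundamental_theorem_of_calculus_interior_strong[OF S(1) that(2)])
    show "(\<gamma> has_vector_derivative g x) (at x)" if "x \<in> {s<..<t} - S" for x
      using that \<open>0 \<le> s\<close> \<open>t \<le> 1\<close> by (intro vd) auto
    show "continuous_on {s..t} \<gamma>" using \<gamma>c by (rule continuous_on_subset) (use that in auto)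
  qed
  have hc: "isCont h t" if "t \<in> {0..1} - S" for t
    unfolding h_def using that S1(3) S2(3) by (intro continuous_intros) (auto simp: S_def)
  show hint: "h integrable_on {0..1}"
  proof (rule bounded_finite_discontinuities_integrable[OF S hc])
    show "\<bar>h t\<bar> \<le> 1" if "t \<in> {0..1}" for t using bd(3)[OF that] by (simp add: h_def)
  qed
  show "integral {0..1} h < 1"
    by (rule integral_less_one[OF hint S(1) hc]) (use bd(3) in \<open>auto simp: h_def\<close>)
  let ?k = "\<lambda>r. Re (flux_field P (\<gamma> r) * g r)"
  have "?k integrable_on {0..1}"
  proof -
    have "compact ((\<lambda>r. flux_field P (\<gamma> r)) ` {0..1})"
      by (intro compact_continuous_image continuous_on_compose2[OF continuous_on_flux_field[OF P] \<gamma>c, of UNIV]) auto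
    hence "bounded ((\<lambda>r. flux_field P (\<gamma> r)) ` {0..1})" by (rule compact_imp_bounded)
    then obtain M where M': "\<forall>y\<in>(\<lambda>r. flux_field P (\<gamma> r)) ` {0..1}. norm y \<le> M"
      unfolding bounded_iff by (rule exE)
    have M: "norm (flux_field P (\<gamma> r)) \<le> M" if "r \<in> {0..1}" for r
      using bspec[OF M' imageI[OF that]] .
    show ?thesis
    proof (rule bounded_finite_discontinuities_integrable[OF S, of _ "M * \<delta>"])
      show "\<bar>?k r\<bar> \<le> M * \<delta>" if r: "r \<in> {0..1}" for r
      proof -
        have "norm (g r) \<le> \<delta>"
        proof -
          have "\<delta> / 2 * sqrt ((\<alpha> r)\<^sup>2 + (\<beta> r)\<^sup>2) \<le> \<delta> / 2 * 1"
            by (intro mult_left_mono less_imp_le bd(3) r) (use \<delta> in auto)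
          thus ?thesis using norm_gamma_velocity[of \<delta> \<alpha> \<beta> r] \<delta> unfolding g_def by linarith
        qed
        moreover have "\<bar>?k r\<bar> \<le> norm (flux_field P (\<gamma> r)) * norm (g r)"
          using abs_Re_le_cmod[of "flux_field P (\<gamma> r) * g r"] by (simp only: norm_mult)
        moreover have "norm (flux_field P (\<gamma> r)) * norm (g r) \<le> M * \<delta>"
          using M[OF r] \<open>norm (g r) \<le> \<delta>\<close> order_trans[OF norm_ge_zero M[OF r]] by (intro mult_mono) auto
        ultimately show ?thesis by linarith
      qed
      show "isCont ?k t" if t: "t \<in> {0..1} - S" for t
      proof -
        have "t \<in> interior {0..1}" using t S(2) by (auto simp: interior_atLeastAtMost_real less_le)
        hence "isCont \<gamma> t" using \<gamma>c continuous_on_interior by blast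
        moreover have "isCont (flux_field P) (\<gamma> t)"
          using continuous_on_flux_field[OF P, of UNIV] by (simp add: continuous_on_eq_continuous_at)
        ultimately have 1: "isCont (\<lambda>r. flux_field P (\<gamma> r)) t" by (rule isCont_o2)
        have 2: "isCont g t"
          unfolding g_def gamma_velocity_def[abs_def] Complex_eq
          using t S1(3) S2(3) by (intro continuous_intros) (auto simp: S_def)
        show ?thesis by (rule continuous_Re[OF continuous_mult[OF 1 2]])
      qed
    qed
  qed
  hence "(?k has_integral integral {0..1} ?k) {0..1}" by (rule integrable_integral)
  moreover have "integral {0..1} ?k = Lambda_curve P z0 \<delta> \<alpha> \<beta>"
    unfolding Lambda_curve_def
  proof (rule integral_spike[of S])
    show "negligible S" using S(1) by (rule negligible_finite)
    show "pd_y P (Complex (gamma1 z0 \<delta> \<alpha> r) (gamma2 z0 \<delta> \<beta> r)) * deriv (gamma1 z0 \<delta> \<alpha>) r -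
       pd_x P (Complex (gamma1 z0 \<delta> \<alpha> r) (gamma2 z0 \<delta> \<beta> r)) * deriv (gamma2 z0 \<delta> \<beta>) r = ?k r"
      if "r \<in> {0..1} - S" for r
      using DERIV_imp_deriv[OF d12(1)[OF that]] DERIV_imp_deriv[OF d12(2)[OF that]]
      by (simp add: flux_field_def \<gamma>_def gamma_curve_def g_def gamma_velocity_def)
  qed
  ultimately show "(?k has_integral Lambda_curve P z0 \<delta> \<alpha> \<beta>) {0..1}" by simp
qed

text \<open>
  On a short piece the flux field is nearly constant, and for a constant field the flux along an arc
  and along its chord agree.
\<close>

lemma Xstar_inscribed_polygon:
  assumes X: "(\<alpha>, \<beta>) \<in> Xstar" and \<delta>: "\<delta> > 0" and P: "smooth_plane P" and \<epsilon>: "\<epsilon> > 0"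
  obtains vs where "vs \<noteq> []" "hd vs = z0" "chain_sum dist (cycle vs) < \<delta> / 2"
    "\<bar>chain_sum (flux P) (cycle vs) - Lambda_curve P z0 \<delta> \<alpha> \<beta>\<bar> \<le> \<epsilon>"
proof -
  define \<gamma> where "\<gamma> = gamma_curve z0 \<delta> \<alpha> \<beta>"
  define g where "g = gamma_velocity \<delta> \<alpha> \<beta>"
  define h where "h = (\<lambda>t. sqrt ((\<alpha> t)\<^sup>2 + (\<beta> t)\<^sup>2))"
  note C = Xstar_curve(1-4)[where ?z0.0 = z0, OF X \<delta> P, folded \<gamma>_def g_def]
    Xstar_curve(5,6)[OF X \<delta> P, folded h_def]
    Xstar_curve(7)[where ?z0.0 = z0, OF X \<delta> P, folded \<gamma>_def g_def]
  let ?F = "flux_field P"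
  have gh: "norm (g t) \<le> \<delta> / 2 * h t" for t
    using norm_gamma_velocity[of \<delta> \<alpha> \<beta> t] \<delta> by (simp add: g_def h_def)
  have h1: "h t \<le> 1" if "t \<in> {0..1}" for t using Xstar_bounds(3)[OF X that] by (simp add: h_def)
  have hs: "h integrable_on {s..t}" if "0 \<le> s" "t \<le> 1" for s t
    by (rule integrable_subinterval_real[OF C(5)]) (use that in auto)
  have len: "norm (\<gamma> t - \<gamma> s) \<le> \<delta> / 2 * integral {s..t} h" if "0 \<le> s" "s \<le> t" "t \<le> 1" for s t
  proof -
    have "norm (integral {s..t} g) \<le> integral {s..t} (\<lambda>t. \<delta> / 2 * h t)"
      using C(4)[OF that] integrable_cmul[OF hs[of s t], of "\<delta> / 2"] that gh
      by (intro integral_norm_bound_integral) (auto simp: has_integral_integrable)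
    thus ?thesis using integral_unique[OF C(4)[OF that]] by simp
  qed
  have lip: "norm (\<gamma> t - \<gamma> s) \<le> \<delta> / 2 * (t - s)" if st: "0 \<le> s" "s \<le> t" "t \<le> 1" for s t
  proof -
    have "integral {s..t} h \<le> integral {s..t} (\<lambda>_. 1)"
      using hs[of s t] st h1 by (intro Henstock_Kurzweil_Integration.integral_le) auto
    also have "\<dots> = t - s" using st by simp
    finally show ?thesis using len[OF st] \<delta> mult_left_mono[of "integral {s..t} h" "t - s" "\<delta> / 2"] by linarith
  qed
  have near: "\<gamma> t \<in> cball z0 \<delta>" if "t \<in> {0..1}" for t
  proof -
    have "norm (\<gamma> t - \<gamma> 0) \<le> \<delta> / 2 * (t - 0)" using that by (intro lip) auto
    also have "\<dots> \<le> \<delta> * 1" using that \<delta> by (intro mult_mono) auto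
    finally show ?thesis by (simp add: C(1) dist_norm norm_minus_commute)
  qed
  \<comment> \<open>Arc and chord each contribute an error of at most \<open>\<omega>\<close> per unit of length.\<close>
  define \<omega> where "\<omega> = \<epsilon> / (2 * \<delta>)"
  have \<omega>: "\<omega> > 0" using \<epsilon> \<delta> by (simp add: \<omega>_def)
  have "uniformly_continuous_on (cball z0 \<delta>) ?F"
    by (intro compact_uniformly_continuous continuous_on_flux_field P) simp
  from this[unfolded uniformly_continuous_on_def, THEN spec, THEN mp, OF \<omega>]
  obtain \<rho> where uc: "\<rho> > 0 \<and> (\<forall>x\<in>cball z0 \<delta>. \<forall>y\<in>cball z0 \<delta>. dist y x < \<rho> \<longrightarrow> dist (?F y) (?F x) < \<omega>)"
    by (rule exE)
  have \<rho>0: "\<rho> > 0" using uc by (rule conjunct1)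
  have \<rho>: "dist (?F y) (?F x) < \<omega>"
    if "x \<in> cball z0 \<delta>" "y \<in> cball z0 \<delta>" "dist y x < \<rho>" for x y
    using bspec[OF bspec[OF conjunct2[OF uc] that(1)] that(2)] that(3) by (rule mp)
  obtain n :: nat where n: "\<delta> / \<rho> < real n" using reals_Archimedean2 by blast
  hence n0: "n > 0" using \<delta> \<rho>0 by (cases n) (auto simp: divide_less_0_iff)
  have mesh: "\<delta> / 2 * (1 / n) < \<rho>"
  proof -
    have "\<delta> / real n < \<rho>" using n n0 \<rho>0 by (simp add: field_simps)
    thus ?thesis using \<delta> n0 by (simp add: field_simps)
  qed
  define a where "a = (\<lambda>k. real k / real n)"
  have bp: "breakpoints a n" unfolding a_def by (rule breakpoints_uniform[OF n0])
  have a01: "0 \<le> a k" "a k \<le> a (Suc k)" "a (Suc k) \<le> 1" if "k < n" for k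
    using that n0 by (auto simp: a_def divide_right_mono)
  have step: "a (Suc k) - a k = 1 / n" for k by (simp add: a_def diff_divide_distrib[symmetric])
  define v where "v = (\<lambda>k. \<gamma> (a k))"
  define vs where "vs = map v [0..<n]"
  have v0: "v 0 = z0" "v n = z0" using n0 C(1,2) by (simp_all add: v_def a_def)
  have vs: "vs \<noteq> []" "hd vs = z0" using n0 v0 by (simp_all add: vs_def hd_map)
  have cyc: "cycle vs = map v [0..<Suc n]" using vs v0 by (simp add: cycle_def vs_def)
  let ?k = "\<lambda>r. Re (?F (\<gamma> r) * g r)"
  have kint: "?k integrable_on {a k..a (Suc k)}" if "k < n" for k
    by (rule integrable_subinterval_real[OF has_integral_integrable[OF C(7)]]) (use a01[OF that] in auto)
  have "(?k has_integral (\<Sum>k<n. integral {a k..a (Suc k)} ?k)) {0..1}"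
    by (intro has_integral_breakpoints[OF bp] integrable_integral kint)
  hence Lam: "Lambda_curve P z0 \<delta> \<alpha> \<beta> = (\<Sum>k<n. integral {a k..a (Suc k)} ?k)"
    using C(7) has_integral_unique by blast
  have "(h has_integral (\<Sum>k<n. integral {a k..a (Suc k)} h)) {0..1}"
    using a01 by (intro has_integral_breakpoints[OF bp] integrable_integral hs) auto
  hence hsum: "integral {0..1} h = (\<Sum>k<n. integral {a k..a (Suc k)} h)" by (rule integral_unique)
  have piece: "\<bar>flux P (v k) (v (Suc k)) - integral {a k..a (Suc k)} ?k\<bar> \<le> 2 * \<omega> * (\<delta> / 2) * (1 / n)"
    if k: "k < n" for k
  proof -
    note A = a01[OF k]
    have near_k: "dist (\<gamma> r) (v k) < \<rho>" "\<gamma> r \<in> cball z0 \<delta>" if r: "r \<in> {a k..a (Suc k)}" for r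
    proof -
      have "norm (\<gamma> r - \<gamma> (a k)) \<le> \<delta> / 2 * (r - a k)" using r A by (intro lip) auto
      also have "\<dots> \<le> \<delta> / 2 * (1 / n)" using r step[of k] \<delta> by (intro mult_left_mono) auto
      finally show "dist (\<gamma> r) (v k) < \<rho>" using mesh by (simp add: dist_norm v_def)
      show "\<gamma> r \<in> cball z0 \<delta>" using r A by (intro near) auto
    qed
    have vk: "v k \<in> cball z0 \<delta>" "v (Suc k) \<in> cball z0 \<delta>" "dist (v (Suc k)) (v k) < \<rho>"
      using near_k[of "a k"] near_k[of "a (Suc k)"] A by (auto simp: v_def)
    have "norm (?F z - ?F (v k)) \<le> \<omega>" if z: "z \<in> closed_segment (v k) (v (Suc k))" for z
    proof -
      have "z \<in> cball z0 \<delta>" using closed_segment_subset[OF vk(1,2)] z by auto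
      moreover have "dist z (v k) < \<rho>"
        using segment_bound1[OF z] vk(3) by (simp add: dist_norm)
      ultimately show ?thesis using \<rho>[OF vk(1), of z] by (simp add: dist_norm)
    qed
    hence "\<bar>flux P (v k) (v (Suc k)) - Re (?F (v k) * (v (Suc k) - v k))\<bar> \<le> \<omega> * norm (v (Suc k) - v k)"
      by (rule flux_approx[OF P])
    also have "\<dots> \<le> \<omega> * (\<delta> / 2 * (1 / n))"
      using lip[OF A] \<omega> step[of k] by (intro mult_left_mono) (auto simp: v_def)
    finally have 1: "\<bar>flux P (v k) (v (Suc k)) - Re (?F (v k) * (v (Suc k) - v k))\<bar> \<le> \<omega> * (\<delta> / 2) * (1 / n)"
      by (simp add: mult.assoc)
    have "((\<lambda>r. Re (?F (v k) * g r)) has_integral Re (?F (v k) * (v (Suc k) - v k))) {a k..a (Suc k)}"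
      using has_integral_linear[OF has_integral_mult_right[OF C(4)[OF A], of "?F (v k)"] bounded_linear_Re]
      by (simp add: o_def v_def del: times_complex.sel)
    from has_integral_diff[OF integrable_integral[OF kint[OF k]] this]
    have hd: "((\<lambda>r. Re ((?F (\<gamma> r) - ?F (v k)) * g r)) has_integral
      (integral {a k..a (Suc k)} ?k - Re (?F (v k) * (v (Suc k) - v k)))) {a k..a (Suc k)}"
      by (simp add: left_diff_distrib del: times_complex.sel)
    have "norm (integral {a k..a (Suc k)} ?k - Re (?F (v k) * (v (Suc k) - v k))) \<le>
      (\<omega> * (\<delta> / 2)) * measure lborel {a k..a (Suc k)}"
    proof (rule has_integral_bound_real[OF _ finite.emptyI hd])
      show "0 \<le> \<omega> * (\<delta> / 2)" using \<omega> \<delta> by simp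
      fix r assume "r \<in> {a k..a (Suc k)} - {}"
      hence r: "r \<in> {a k..a (Suc k)}" by simp
      have "norm (Re ((?F (\<gamma> r) - ?F (v k)) * g r)) \<le> norm (?F (\<gamma> r) - ?F (v k)) * norm (g r)"
        using abs_Re_le_cmod[of "(?F (\<gamma> r) - ?F (v k)) * g r"] by (simp only: norm_mult real_norm_def)
      also have "\<dots> \<le> \<omega> * (\<delta> / 2)"
      proof (rule mult_mono)
        show "norm (?F (\<gamma> r) - ?F (v k)) \<le> \<omega>"
          using \<rho>[OF vk(1) near_k(2)[OF r] near_k(1)[OF r]] by (simp add: dist_norm)
        have "h r \<le> 1" using r A by (intro h1) auto
        hence "\<delta> / 2 * h r \<le> \<delta> / 2 * 1" using \<delta> by (intro mult_left_mono) auto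
        thus "norm (g r) \<le> \<delta> / 2" using gh[of r] by simp
      qed (use \<omega> in auto)
      finally show "norm (Re ((?F (\<gamma> r) - ?F (v k)) * g r)) \<le> \<omega> * (\<delta> / 2)" .
    qed
    hence 2: "\<bar>integral {a k..a (Suc k)} ?k - Re (?F (v k) * (v (Suc k) - v k))\<bar> \<le> \<omega> * (\<delta> / 2) * (1 / n)"
      using A step[of k] by simp
    from 1 2 show ?thesis by linarith
  qed
  have "\<bar>chain_sum (flux P) (cycle vs) - Lambda_curve P z0 \<delta> \<alpha> \<beta>\<bar> =
    \<bar>\<Sum>k<n. flux P (v k) (v (Suc k)) - integral {a k..a (Suc k)} ?k\<bar>"
    unfolding cyc chain_sum_map_upt Lam by (simp add: sum_subtractf)
  also have "\<dots> \<le> (\<Sum>k<n. 2 * \<omega> * (\<delta> / 2) * (1 / n))"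
    by (rule order_trans[OF sum_abs sum_mono]) (use piece in auto)
  also have "\<dots> \<le> \<epsilon>" using n0 \<delta> \<epsilon> by (simp add: \<omega>_def)
  finally have flx: "\<bar>chain_sum (flux P) (cycle vs) - Lambda_curve P z0 \<delta> \<alpha> \<beta>\<bar> \<le> \<epsilon>" .
  have "chain_sum dist (cycle vs) = (\<Sum>k<n. dist (v k) (v (Suc k)))"
    unfolding cyc by (rule chain_sum_map_upt)
  also have "\<dots> \<le> (\<Sum>k<n. \<delta> / 2 * integral {a k..a (Suc k)} h)"
    using len a01 by (intro sum_mono) (auto simp: dist_norm norm_minus_commute v_def)
  also have "\<dots> = \<delta> / 2 * integral {0..1} h" unfolding hsum by (simp add: sum_distrib_left)
  also have "\<dots> < \<delta> / 2 * 1" using C(6) \<delta> by (intro mult_strict_left_mono) auto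
  finally have "chain_sum dist (cycle vs) < \<delta> / 2" by simp
  with vs flx show ?thesis using that by blast
qed

text \<open>
  The polygon inscribed in a curve of \<open>\<Lambda>\<close> is strictly shorter than \<open>\<delta> / 2\<close>; what remains pays for the
  thin triangles in the stockyard that encloses it.
\<close>

lemma Lambda_le_stockyards:
  assumes P: "smooth_plane P" "\<And>z. laplacian P z \<ge> 0" and \<delta>: "\<delta> > 0"
  shows "Lambda P (z0, t0) \<delta> \<le>
    (SUP R\<in>stockyards z0 \<delta>. ereal (\<Sum>A\<leftarrow>R. set_lebesgue_integral lborel A (laplacian P)))"
    (is "_ \<le> ?S")
  unfolding Lambda_def fst_conv
proof (rule SUP_least, clarify)
  fix \<alpha> \<beta> assume X: "(\<alpha>, \<beta>) \<in> Xstar"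
  show "ereal \<bar>Lambda_curve P z0 \<delta> \<alpha> \<beta>\<bar> \<le> ?S"
  proof (rule ereal_le_epsilon2)
    fix \<epsilon> :: real assume \<epsilon>: "0 < \<epsilon>"
    obtain vs where vs: "vs \<noteq> []" "hd vs = z0" "chain_sum dist (cycle vs) < \<delta> / 2"
      "\<bar>chain_sum (flux P) (cycle vs) - Lambda_curve P z0 \<delta> \<alpha> \<beta>\<bar> \<le> \<epsilon>"
      using Xstar_inscribed_polygon[OF X \<delta> P(1) \<epsilon>] by blast
    have gap: "\<delta> - 2 * chain_sum dist (cycle vs) > 0" using vs(3) by simp
    obtain R where R: "\<forall>A\<in>set R. pen A" "connected (\<Union>A\<in>set R. frontier A)"
      "edge_union (cycle vs) \<subseteq> (\<Union>A\<in>set R. frontier A)"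
      "(\<Sum>A\<leftarrow>R. perimeter A) \<le> ennreal (2 * chain_sum dist (cycle vs) + (\<delta> - 2 * chain_sum dist (cycle vs)))"
      "\<bar>chain_sum (flux P) (cycle vs)\<bar> \<le> (\<Sum>A\<leftarrow>R. set_lebesgue_integral lborel A (laplacian P))"
      using closed_polygon_enclosable[OF P vs(1), unfolded enclosable_def, rule_format, OF gap] by blast
    obtain ws where ws: "vs = z0 # ws" using vs(1,2) by (cases vs) auto
    have "z0 \<in> edge_union (cycle vs)" unfolding ws by (cases ws) (simp_all add: cycle_def)
    hence "z0 \<in> (\<Union>A\<in>set R. frontier A)" by (rule subsetD[OF R(3)])
    moreover have "(\<Sum>A\<leftarrow>R. perimeter A) \<le> ennreal \<delta>" using R(4) by simp
    ultimately have "R \<in> stockyards z0 \<delta>"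
      unfolding stockyards_def mem_Collect_eq using R(1,2) by (intro conjI)
    hence "ereal (\<Sum>A\<leftarrow>R. set_lebesgue_integral lborel A (laplacian P)) \<le> ?S" by (rule SUP_upper)
    note s1 = this
    have "\<bar>Lambda_curve P z0 \<delta> \<alpha> \<beta>\<bar> \<le> (\<Sum>A\<leftarrow>R. set_lebesgue_integral lborel A (laplacian P)) + \<epsilon>"
      using vs(4) R(5) by linarith
    hence s2: "ereal \<bar>Lambda_curve P z0 \<delta> \<alpha> \<beta>\<bar> \<le> ereal (\<Sum>A\<leftarrow>R. set_lebesgue_integral lborel A (laplacian P)) + ereal \<epsilon>"
      by simp
    show "ereal \<bar>Lambda_curve P z0 \<delta> \<alpha> \<beta>\<bar> \<le> ?S + ereal \<epsilon>"
      by (rule order_trans[OF s2 add_right_mono[OF s1]])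
  qed
qed

section \<open>Boundary curves of finite length\<close>

lemma FPWS_differentiable:
  assumes "FPWS f"
  obtains S where "finite S" "{0, 1} \<subseteq> S" "\<And>t. t \<in> {0..1} - S \<Longrightarrow> f differentiable (at t)"
    "\<And>t. t \<in> {0..1} - S \<Longrightarrow> isCont (deriv f) t"
proof -
  obtain N and a :: "nat \<Rightarrow> real" where a: "a 0 = 0" "a (N + 1) = 1" "\<forall>i\<le>N. a i < a (i + 1)"
    and sm: "\<forall>i\<le>N. smooth_interval (a i) (a (i + 1)) f"
    using assms unfolding FPWS_def by blast
  have bp: "breakpoints a (Suc N)" using a by (auto simp: breakpoints_def)
  have ends: "{0, 1} \<subseteq> a ` {..Suc N}"
    using a(1,2) by (auto simp: image_iff intro: bexI[of _ 0] bexI[of _ "Suc N"])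
  have in_piece: "\<exists>k\<le>N. t \<in> {a k<..<a (k + 1)}" if t: "t \<in> {0..1} - a ` {..Suc N}" for t
  proof -
    have "t \<noteq> 1" using t ends by auto
    then obtain k where k: "k < Suc N" "a k \<le> t" "t < a (Suc k)"
      using breakpoints_cases[OF bp, of t] t by auto
    have "t \<noteq> a k" using t k(1) by auto
    thus ?thesis using k by (intro exI[of _ k]) auto
  qed
  show ?thesis
  proof (rule that[of "a ` {..Suc N}"])
    fix t assume "t \<in> {0..1} - a ` {..Suc N}"
    then obtain k where k: "k \<le> N" "t \<in> {a k<..<a (k + 1)}" using in_piece by blast
    have *: "(deriv ^^ j) f differentiable (at t)" for j
      using sm k unfolding smooth_interval_def by blast
    show "f differentiable (at t)" using *[of 0] by simp
    show "isCont (deriv f) t" using *[of 1] by (simp add: differentiable_imp_continuous_within)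
  qed (use ends in auto)
qed

text \<open>
  Piecewise smoothness bounds no derivative near the breakpoints, but a finite length makes the
  speed integrable, and its integral is an arc-length function. The existence of such a function
  and the negligible image are all the regularity of boundary curves that is used below.
\<close>

lemma FPWS_path_arc_length:
  assumes fp: "FPWS_path \<gamma>" and len: "curve_length \<gamma> \<le> ennreal c" and c: "c \<ge> 0"
  obtains l :: "real \<Rightarrow> real" where
    "\<And>s t. 0 \<le> s \<Longrightarrow> s \<le> t \<Longrightarrow> t \<le> 1 \<Longrightarrow> dist (\<gamma> s) (\<gamma> t) \<le> l t - l s"
    "2 * (l 1 - l 0) \<le> c" "path_image \<gamma> \<in> null_sets lborel"
proof -
  have path: "path \<gamma>" and re: "FPWS (\<lambda>t. Re (\<gamma> t))" and im: "FPWS (\<lambda>t. Im (\<gamma> t))"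
    using fp by (auto simp: FPWS_path_def o_def)
  obtain S1 where S1: "finite S1" "{0, 1} \<subseteq> S1"
    "\<And>t. t \<in> {0..1} - S1 \<Longrightarrow> (\<lambda>t. Re (\<gamma> t)) differentiable (at t)"
    "\<And>t. t \<in> {0..1} - S1 \<Longrightarrow> isCont (deriv (\<lambda>t. Re (\<gamma> t))) t"
    using FPWS_differentiable[OF re] by blast
  obtain S2 where S2: "finite S2" "{0, 1} \<subseteq> S2"
    "\<And>t. t \<in> {0..1} - S2 \<Longrightarrow> (\<lambda>t. Im (\<gamma> t)) differentiable (at t)"
    "\<And>t. t \<in> {0..1} - S2 \<Longrightarrow> isCont (deriv (\<lambda>t. Im (\<gamma> t))) t"
    using FPWS_differentiable[OF im] by blast
  define S where "S = S1 \<union> S2"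
  define T where "T = {0..1} - S"
  have S: "finite S" "{0, 1} \<subseteq> S" using S1 S2 by (auto simp: S_def)
  have T: "T = {0<..<1} - S" using S(2) by (auto simp: T_def less_le)
  have openT: "open T" unfolding T using S(1) by (intro open_Diff finite_imp_closed) auto
  define g where "g = (\<lambda>t. Complex (deriv (\<lambda>t. Re (\<gamma> t)) t) (deriv (\<lambda>t. Im (\<gamma> t)) t))"
  have vd: "(\<gamma> has_vector_derivative g t) (at t)" if "t \<in> T" for t
  proof -
    have 1: "((\<lambda>t. Re (\<gamma> t)) has_real_derivative deriv (\<lambda>t. Re (\<gamma> t)) t) (at t)"
      using S1(3)[of t] that by (auto simp: T_def S_def DERIV_deriv_iff_real_differentiable)
    have 2: "((\<lambda>t. Im (\<gamma> t)) has_real_derivative deriv (\<lambda>t. Im (\<gamma> t)) t) (at t)"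
      using S2(3)[of t] that by (auto simp: T_def S_def DERIV_deriv_iff_real_differentiable)
    have "((\<lambda>t. of_real (Re (\<gamma> t)) + \<i> * of_real (Im (\<gamma> t))) has_vector_derivative
      of_real (deriv (\<lambda>t. Re (\<gamma> t)) t) + \<i> * of_real (deriv (\<lambda>t. Im (\<gamma> t)) t)) (at t)"
      by (intro has_vector_derivative_add has_vector_derivative_mult_right has_vector_derivative_of_real 1 2)
    thus ?thesis by (simp add: complex_eq[symmetric] g_def Complex_eq)
  qed
  have gc: "continuous_on T g"
  proof (rule continuous_at_imp_continuous_on, rule ballI)
    fix t assume "t \<in> T"
    thus "isCont g t"
      unfolding g_def Complex_eq using S1(4)[of t] S2(4)[of t]
      by (intro continuous_intros) (auto simp: T_def S_def)
  qed
  have ft: "(g has_integral \<gamma> t - \<gamma> s) {s..t}" if "0 \<le> s" "s \<le> t" "t \<le> 1" for s t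
  proof (rule fundamental_theorem_of_calculus_interior_strong[OF S(1) that(2)])
    show "(\<gamma> has_vector_derivative g x) (at x)" if "x \<in> {s<..<t} - S" for x
      using that \<open>0 \<le> s\<close> \<open>t \<le> 1\<close> by (intro vd) (auto simp: T_def)
    show "continuous_on {s..t} \<gamma>"
      using path unfolding path_def by (rule continuous_on_subset) (use that in auto)
  qed
  have Tm: "T \<in> sets borel" using openT by simp
  have gm: "(\<lambda>t. indicator T t *\<^sub>R g t) \<in> borel_measurable borel"
    by (rule borel_measurable_continuous_on_indicator[OF Tm gc])
  have nm: "(\<lambda>t. indicator T t * norm (g t)) \<in> borel_measurable borel"
    using borel_measurable_continuous_on_indicator[OF Tm continuous_on_norm[OF gc]] by simp
  have AE_S: "AE t in lborel. t \<notin> S"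
    using S(1) by (intro AE_not_in) (simp add: finite_imp_null_set_lborel)
  have "(\<integral>\<^sup>+t. ennreal (2 * (indicator T t * norm (g t))) \<partial>lborel) = curve_length \<gamma>"
    unfolding curve_length_def
    by (rule nn_integral_cong_AE, use AE_S in eventually_elim)
       (auto simp: T_def vector_derivative_at[OF vd] indicator_def)
  hence nn: "(\<integral>\<^sup>+t. ennreal (2 * (indicator T t * norm (g t))) \<partial>lborel) \<le> ennreal c"
    using len by simp
  have "integrable lborel (\<lambda>t. 2 * (indicator T t * norm (g t)))"
    unfolding integrable_iff_bounded using nm nn by (auto intro: le_less_trans)
  hence int: "integrable lborel (\<lambda>t. indicator T t * norm (g t))"
    by simp
  define n where "n = (\<lambda>t. indicator T t * norm (g t))"
  have n_int: "(n has_integral integral\<^sup>L lborel n) UNIV"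
    using has_integral_integral_lborel[OF int] by (simp add: n_def)
  have "n = (\<lambda>t. if t \<in> {0..1} then n t else 0)" by (auto simp: n_def T_def indicator_def)
  from arg_cong[where f = "\<lambda>k. (k has_integral integral\<^sup>L lborel n) UNIV", OF this]
  have "((\<lambda>t. if t \<in> {0..1} then n t else 0) has_integral integral\<^sup>L lborel n) UNIV"
    using n_int by (rule iffD1)
  hence n01: "(n has_integral integral\<^sup>L lborel n) {0..1}"
    by (simp only: has_integral_restrict_UNIV)
  have ni: "n integrable_on {s..t}" if "0 \<le> s" "t \<le> 1" for s t
    by (rule integrable_subinterval_real[OF has_integral_integrable[OF n01]]) (use that in auto)
  define l where "l = (\<lambda>t. integral {0..t} n)"
  have "dist (\<gamma> s) (\<gamma> t) \<le> l t - l s" if st: "0 \<le> s" "s \<le> t" "t \<le> 1" for s t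
  proof -
    have A: "((\<lambda>x. if x \<in> S then 0 else g x) has_integral \<gamma> t - \<gamma> s) {s..t}"
      by (rule has_integral_spike_finite[OF S(1) _ ft[OF st]]) auto
    have B: "norm (if x \<in> S then 0 else g x) \<le> n x" if "x \<in> {s..t}" for x
      using that st by (auto simp: n_def T_def)
    have "norm (\<gamma> t - \<gamma> s) \<le> integral {s..t} n"
      using integral_norm_bound_integral[OF has_integral_integrable[OF A] ni B] st
      unfolding integral_unique[OF A] by blast
    also have "\<dots> = l t - l s"
      using Henstock_Kurzweil_Integration.integral_combine[of 0 s t n] ni[of 0 t] st by (simp add: l_def)
    finally show ?thesis by (simp add: dist_norm norm_minus_commute)
  qed
  moreover have "2 * (l 1 - l 0) \<le> c"
  proof -
    have "l 1 - l 0 = integral\<^sup>L lborel n"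
      using integral_unique[OF n01] by (simp add: l_def)
    moreover have "ennreal (integral\<^sup>L lborel (\<lambda>t. 2 * n t)) = (\<integral>\<^sup>+t. ennreal (2 * n t) \<partial>lborel)"
      using int by (intro nn_integral_eq_integral[symmetric]) (auto simp: n_def)
    ultimately have "ennreal (2 * (l 1 - l 0)) \<le> ennreal c"
      using nn by (simp add: n_def)
    thus ?thesis using c by (simp add: ennreal_le_iff)
  qed
  moreover have "path_image \<gamma> \<in> null_sets lborel"
  proof -
    have "\<gamma> differentiable_on T"
      unfolding differentiable_on_def
      by (rule ballI, rule differentiable_at_withinI, rule differentiableI_vector[OF vd])
    hence "negligible (\<gamma> ` T)" by (intro negligible_differentiable_image_lowdim) auto
    moreover have "negligible (\<gamma> ` (S \<inter> {0..1}))" using S(1) by (intro negligible_finite) auto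
    ultimately have "negligible (\<gamma> ` T \<union> \<gamma> ` (S \<inter> {0..1}))" by (rule negligible_Un)
    moreover have "\<gamma> ` T \<union> \<gamma> ` (S \<inter> {0..1}) = path_image \<gamma>"
    proof -
      have "T \<union> (S \<inter> {0..1}) = {0..1}" by (auto simp: T_def)
      thus ?thesis unfolding path_image_def image_Un[symmetric] by simp
    qed
    moreover have "path_image \<gamma> \<in> sets lborel"
      using compact_path_image[OF path] by (simp add: compact_imp_closed)
    ultimately show ?thesis by (simp add: negligible_iff_null_sets null_sets_completion_iff)
  qed
  ultimately show ?thesis using that by blast
qed

section \<open>Polygons inscribed in Jordan curves\<close>

text \<open>
  Partitions are lists here, so that prescribed points can be inserted one by one.
\<close>

fun gaps_le :: "real \<Rightarrow> real list \<Rightarrow> bool" where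
  "gaps_le d (s # t # ts) \<longleftrightarrow> s \<le> t \<and> t - s \<le> d \<and> gaps_le d (t # ts)"
| "gaps_le d ts \<longleftrightarrow> True"

lemma gaps_le_insert:
  "gaps_le d ts \<Longrightarrow> ts \<noteq> [] \<Longrightarrow> hd ts \<le> x \<Longrightarrow> x \<le> last ts \<Longrightarrow> d \<ge> 0 \<Longrightarrow>
    \<exists>us. us \<noteq> [] \<and> gaps_le d us \<and> hd us = hd ts \<and> last us = last ts \<and> set us = insert x (set ts)"
proof (induction ts rule: induct_list012)
  case (2 s)
  thus ?case by (intro exI[of _ "[s]"]) auto
next
  case (3 s t ts)
  show ?case
  proof (cases "x \<le> t")
    case True
    thus ?thesis using 3 by (intro exI[of _ "s # x # t # ts"]) auto
  next
    case False
    then obtain us where us: "us \<noteq> []" "gaps_le d us" "hd us = t" "last us = last (t # ts)"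
      "set us = insert x (set (t # ts))"
      using 3(2)[of] 3(3-7) by auto
    then obtain us' where "us = t # us'" by (cases us) auto
    thus ?thesis using us 3 by (intro exI[of _ "s # us"]) auto
  qed
qed simp

lemma gaps_le_uniform:
  assumes "n > 0" "1 / real n \<le> d"
  shows "gaps_le d (map (\<lambda>k. real k / real n) [m..<m + j])"
proof (induction j arbitrary: m)
  case (Suc j)
  show ?case
  proof (cases j)
    case (Suc i)
    have "[m..<m + Suc j] = m # [Suc m..<Suc m + j]" "[Suc m..<Suc m + j] = Suc m # [Suc (Suc m)..<Suc m + j]"
      using Suc by (simp_all add: upt_conv_Cons)
    thus ?thesis
      using \<open>gaps_le d (map _ [Suc m..<Suc m + j])\<close> assms
      by (simp add: divide_right_mono diff_divide_distrib[symmetric])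
  qed simp
qed simp

lemma fine_partition_through:
  assumes "d > 0" "finite F" "F \<subseteq> {0..1}"
  obtains ts where "gaps_le d ts" "length ts \<ge> 2" "hd ts = 0" "last ts = 1" "F \<subseteq> set ts" "set ts \<subseteq> {0..1}"
proof -
  obtain n :: nat where n: "n > 0" "1 / real n \<le> d"
    using assms(1) by (metis nat_approx_posE order_less_imp_le zero_less_Suc)
  define ts where "ts = map (\<lambda>k. real k / real n) [0..<Suc n]"
  have "\<exists>us. us \<noteq> [] \<and> gaps_le d us \<and> hd us = 0 \<and> last us = 1 \<and> set us = F \<union> set ts"
    using assms(2,3)
  proof (induction F rule: finite_induct)
    case empty
    have "gaps_le d ts" using gaps_le_uniform[OF n, of 0 "Suc n"] by (simp add: ts_def del: upt_Suc)
    moreover have "hd ts = 0" "last ts = 1"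
      using n(1) by (simp_all add: ts_def hd_map last_map del: upt_Suc) 
    moreover have "ts \<noteq> []" by (simp add: ts_def del: upt_Suc)
    ultimately show ?case by auto
  next
    case (insert x F)
    then obtain us where us: "us \<noteq> []" "gaps_le d us" "hd us = 0" "last us = 1" "set us = F \<union> set ts" by auto
    show ?case
      using gaps_le_insert[OF us(2,1), of x] us insert(4) assms(1) by auto
  qed
  then obtain us where us: "us \<noteq> []" "gaps_le d us" "hd us = 0" "last us = 1" "set us = F \<union> set ts" by blast
  moreover have "set ts \<subseteq> {0..1}" using n(1) by (auto simp: ts_def field_simps simp del: upt_Suc)
  moreover have "length us \<ge> 2" using us(1,3,4) by (cases us; cases "tl us") auto
  ultimately show ?thesis using assms(3) by (intro that[of us]) auto
qed

lemma chain_sum_dist_inscribed: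
  assumes l: "\<And>s t. 0 \<le> s \<Longrightarrow> s \<le> t \<Longrightarrow> t \<le> 1 \<Longrightarrow> dist (\<gamma> s) (\<gamma> t) \<le> l t - (l s :: real)"
  shows "gaps_le d ts \<Longrightarrow> ts \<noteq> [] \<Longrightarrow> set ts \<subseteq> {0..1} \<Longrightarrow>
    chain_sum dist (map \<gamma> ts) \<le> l (last ts) - l (hd ts)"
proof (induction ts rule: induct_list012)
  case (3 s t ts)
  thus ?case using l[of s t] by auto
qed auto

text \<open>
  Away from the curve, each short arc is homotopic to its chord in the complement of \<open>w\<close>, with end
  points fixed. The factor 2 accounts for the distances of arc and chord from their common
  starting point.
\<close>

lemma winding_number_inscribed:
  assumes path: "path \<gamma>" and w: "w \<notin> path_image \<gamma>"
    and close: "\<And>s t u. s \<in> {0..1} \<Longrightarrow> t \<in> {0..1} \<Longrightarrow> s \<le> t \<Longrightarrow> t - s \<le> d \<Longrightarrow> u \<in> {s..t} \<Longrightarrow>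
      2 * dist (\<gamma> s) (\<gamma> u) < infdist w (path_image \<gamma>) "
  shows "gaps_le d ts \<Longrightarrow> ts \<noteq> [] \<Longrightarrow> set ts \<subseteq> {0..1} \<Longrightarrow>
    chain_sum (\<lambda>a b. winding_number (linepath a b) w) (map \<gamma> ts) =
    winding_number (subpath (hd ts) (last ts) \<gamma>) w"
proof (induction ts rule: induct_list012)
  case (2 s)
  hence "\<gamma> s \<noteq> w" using w by (auto simp: path_image_def)
  thus ?case by simp
next
  case (3 s t ts)
  have st: "s \<in> {0..1}" "t \<in> {0..1}" "s \<le> t" "t - s \<le> d" using 3(3-5) by auto
  have IH: "chain_sum (\<lambda>a b. winding_number (linepath a b) w) (map \<gamma> (t # ts)) =
    winding_number (subpath t (last (t # ts)) \<gamma>) w"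
    using 3(2) 3(3-5) by auto
  have "homotopic_paths (- {w}) (subpath s t \<gamma>) (linepath (\<gamma> s) (\<gamma> t))"
  proof (rule homotopic_paths_nearby_explicit)
    fix x z assume x: "x \<in> {0..1::real}" and "z \<notin> - {w}"
    hence z: "z = w" by simp
    define u where "u = (t - s) * x + s"
    have "(t - s) * x \<le> t - s" "0 \<le> (t - s) * x" using x st by (auto intro: mult_left_le)
    hence u: "u \<in> {s..t}" by (simp add: u_def)
    hence u01: "u \<in> {0..1}" using st by auto
    have "norm (linepath (\<gamma> s) (\<gamma> t) x - \<gamma> s) \<le> norm (\<gamma> t - \<gamma> s)"
      using segment_bound1[of "linepath (\<gamma> s) (\<gamma> t) x" "\<gamma> s" "\<gamma> t"] x linepath_in_path by blast
    hence "norm (linepath (\<gamma> s) (\<gamma> t) x - \<gamma> u) \<le> dist (\<gamma> s) (\<gamma> t) + dist (\<gamma> s) (\<gamma> u)"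
      using norm_triangle_ineq[of "linepath (\<gamma> s) (\<gamma> t) x - \<gamma> s" "\<gamma> s - \<gamma> u"]
      by (simp add: dist_norm norm_minus_commute)
    also have "\<dots> < infdist w (path_image \<gamma>)"
      using close[OF st, of u] close[OF st, of t] u st by auto
    also have "\<dots> \<le> dist w (\<gamma> u)"
      by (rule infdist_le) (use u01 in \<open>auto simp: path_image_def\<close>)
    finally show "norm (linepath (\<gamma> s) (\<gamma> t) x - subpath s t \<gamma> x) < norm (subpath s t \<gamma> x - z)"
      by (simp add: subpath_def u_def z dist_norm norm_minus_commute)
  qed (use st path in \<open>auto intro: path_subpath\<close>)
  hence "winding_number (linepath (\<gamma> s) (\<gamma> t)) w = winding_number (subpath s t \<gamma>) w"
    by (metis winding_number_homotopic_paths)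
  moreover have "last (t # ts) \<in> {0..1}" using 3(5) by (auto dest: subsetD[OF _ last_in_set])
  hence "winding_number (subpath s t \<gamma>) w + winding_number (subpath t (last (t # ts)) \<gamma>) w =
    winding_number (subpath s (last (t # ts)) \<gamma>) w"
    using st by (intro winding_number_subpath_combine[OF path w]) auto
  ultimately show ?case using IH by simp
qed auto

lemma nn_integral_chain_winding_kernel_le:
  assumes r: "r > 0" and E: "E \<in> sets lborel"
  shows "(\<integral>\<^sup>+w. chain_sum (\<lambda>a b. winding_kernel a b w) vs * indicator E w \<partial>lborel) \<le>
    ennreal (chain_sum dist vs) * (ennreal (4 * pi * r) + ennreal (1 / r) * emeasure lborel E)"
proof (induction vs rule: induct_list012)
  case (3 a b vs)
  let ?C = "ennreal (4 * pi * r) + ennreal (1 / r) * emeasure lborel E"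
  have m: "(\<lambda>w. chain_sum (\<lambda>a b. winding_kernel a b w) us) \<in> borel_measurable borel" for us
    by (induction us rule: induct_list012) auto
  have "(\<integral>\<^sup>+w. chain_sum (\<lambda>a b. winding_kernel a b w) (a # b # vs) * indicator E w \<partial>lborel) =
    (\<integral>\<^sup>+w. winding_kernel a b w * indicator E w \<partial>lborel) +
    (\<integral>\<^sup>+w. chain_sum (\<lambda>a b. winding_kernel a b w) (b # vs) * indicator E w \<partial>lborel)"
    unfolding chain_sum.simps distrib_right
    by (intro nn_integral_add borel_measurable_times_ennreal borel_measurable_indicator)
       (use m E in simp_all)
  also have "\<dots> \<le> ennreal (norm (b - a)) * ?C + ennreal (chain_sum dist (b # vs)) * ?C"
    by (intro add_mono nn_integral_winding_kernel_le[OF r E] 3)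
  also have "\<dots> = ennreal (chain_sum dist (a # b # vs)) * ?C"
    by (simp add: distrib_right[symmetric] ennreal_plus[symmetric] chain_sum_dist_nonneg dist_norm
        norm_minus_commute del: ennreal_plus)
  finally show ?case .
qed auto

lemma chain_sum_rev: "chain_sum f (rev xs) = chain_sum (\<lambda>a b. f b a) xs"
proof (induction xs rule: induct_list012)
  case (3 a b xs)
  have "chain_sum f (rev (a # b # xs)) = chain_sum f (rev (b # xs)) + f b a"
    using chain_sum_append[of f "rev xs" b "[a]"] by simp
  thus ?case using 3 by (simp add: add.commute)
qed auto

lemma cycle_butlast:
  assumes "length vs \<ge> 2" "hd vs = last vs"
  shows "cycle (butlast vs) = vs" "butlast vs \<noteq> []" "set (butlast vs) = set vs"
proof -
  obtain x y ys where vs: "vs = x # y # ys" using assms(1) by (cases vs; cases "tl vs") auto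
  have 1: "hd (butlast vs) = hd vs" by (simp add: vs)
  show "cycle (butlast vs) = vs"
    unfolding cycle_def 1 assms(2) by (rule append_butlast_last_id) (simp add: vs)
  show 2: "butlast vs \<noteq> []" by (simp add: vs)
  have "set vs = insert (last vs) (set (butlast vs))"
    using append_butlast_last_id[of vs] vs by (metis Un_commute insert_is_Un list.distinct(1) list.set(1) list.simps(15) set_append)
  moreover have "last vs \<in> set (butlast vs)" using 1 2 assms(2) by (metis hd_in_set)
  ultimately show "set (butlast vs) = set vs" by auto
qed

lemma ennreal_abs_chain_sum_le:
  "ennreal \<bar>chain_sum f vs\<bar> \<le> chain_sum (\<lambda>a b. ennreal \<bar>f a b\<bar>) vs"
proof (induction vs rule: induct_list012)
  case (3 a b vs)
  have "ennreal \<bar>chain_sum f (a # b # vs)\<bar> \<le> ennreal (\<bar>f a b\<bar> + \<bar>chain_sum f (b # vs)\<bar>)"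
    by (intro ennreal_leI) simp
  also have "\<dots> = ennreal \<bar>f a b\<bar> + ennreal \<bar>chain_sum f (b # vs)\<bar>" by simp
  also have "\<dots> \<le> ennreal \<bar>f a b\<bar> + chain_sum (\<lambda>a b. ennreal \<bar>f a b\<bar>) (b # vs)"
    using 3 by (intro add_left_mono)
  finally show ?case by simp
qed auto

lemma AE_chain_crossing_le_kernel:
  assumes "vs \<noteq> []" "hd vs = last vs"
  shows "AE w in lborel. ennreal \<bar>chain_sum (\<lambda>a b. crossing a b w) vs\<bar> \<le>
    chain_sum (\<lambda>a b. winding_kernel a b w) vs"
proof -
  have "AE w in lborel. w \<notin> (\<Union>a\<in>set vs. \<Union>b\<in>set vs. closed_segment a b)"
    by (intro AE_not_in null_sets.finite_UN null_sets_closed_segment) auto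
  with AE_chain_winding_number_crossing[OF assms] show ?thesis
  proof eventually_elim
    case (elim w)
    have "\<bar>chain_sum (\<lambda>a b. crossing a b w) vs\<bar> = \<bar>chain_sum (\<lambda>a b. Re (winding_number (linepath a b) w)) vs\<bar>"
      using elim(1) by simp
    hence "ennreal \<bar>chain_sum (\<lambda>a b. crossing a b w) vs\<bar> \<le>
      chain_sum (\<lambda>a b. ennreal \<bar>Re (winding_number (linepath a b) w)\<bar>) vs"
      using ennreal_abs_chain_sum_le by simp
    also have "\<dots> \<le> chain_sum (\<lambda>a b. winding_kernel a b w) vs"
    proof (rule chain_sum_mono)
      fix a b assume "a \<in> set vs" "b \<in> set vs"
      hence "w \<notin> closed_segment a b" using elim(2) by blast
      from norm_winding_number_linepath_le[OF this]
      show "ennreal \<bar>Re (winding_number (linepath a b) w)\<bar> \<le> winding_kernel a b w"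
        using ennreal_leI[OF abs_Re_le_cmod] order_trans by blast
    qed
    finally show ?case .
  qed
qed

text \<open>
  The closed neighbourhoods of radius \<open>1 / (k + 1)\<close> decrease to the compact set.
\<close>

lemma measure_neighbourhood_null_compact:
  fixes J :: "complex set"
  assumes J: "compact J" "J \<noteq> {}" "J \<in> null_sets lborel" and e: "e > 0"
  obtains d where "d > 0" "d \<le> 1" "{w. infdist w J \<le> d} \<in> sets lborel"
    "emeasure lborel {w. infdist w J \<le> d} \<le> ennreal e"
proof -
  define E where "E = (\<lambda>k. {w. infdist w J \<le> 1 / real (Suc k)})"
  have cl: "closed (E k)" for k
    unfolding E_def by (intro closed_Collect_le continuous_intros)
  obtain M where M: "\<And>x. x \<in> J \<Longrightarrow> norm x \<le> M"
    using compact_imp_bounded[OF J(1)] unfolding bounded_iff by blast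
  have sub: "E k \<subseteq> cball 0 (M + 1)" for k
  proof
    fix w assume "w \<in> E k"
    hence le: "infdist w J \<le> 1" by (auto simp: E_def intro: order_trans)
    obtain x where x: "x \<in> J" "infdist w J = dist w x"
      using infdist_attains_inf[OF compact_imp_closed[OF J(1)] J(2)] by blast
    have "norm w \<le> norm x + dist w x" using norm_triangle_sub[of w x] by (simp add: dist_norm)
    thus "w \<in> cball 0 (M + 1)" using M[OF x(1)] le x(2) by simp
  qed
  have fin: "emeasure lborel (E k) \<noteq> \<infinity>" for k
    using emeasure_mono[OF sub, of lborel k] emeasure_lborel_cball_finite[of "0::complex" "M + 1"]
    by (auto simp: top_unique)
  have "1 / real (Suc n) \<le> 1 / real (Suc m)" if "m \<le> n" for m n
    using that by (intro divide_left_mono) auto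
  hence dec: "decseq E" unfolding decseq_def E_def by (auto intro: order_trans)
  have "(\<Inter>k. E k) = J"
  proof
    show "J \<subseteq> (\<Inter>k. E k)" by (auto simp: E_def)
    show "(\<Inter>k. E k) \<subseteq> J"
    proof
      fix w assume w: "w \<in> (\<Inter>k. E k)"
      have "infdist w J \<le> 0 + \<epsilon>" if pos: "\<epsilon> > 0" for \<epsilon>
      proof -
        obtain k where "1 / real (Suc k) < \<epsilon>" by (rule nat_approx_posE[OF pos])
        moreover have "infdist w J \<le> 1 / real (Suc k)" using w by (auto simp: E_def)
        ultimately show ?thesis by simp
      qed
      hence "infdist w J \<le> 0" by (rule field_le_epsilon)
      hence "infdist w J = 0" using infdist_nonneg[of w J] by simp
      thus "w \<in> J" using in_closed_iff_infdist_zero[OF compact_imp_closed[OF J(1)] J(2)] by simp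
    qed
  qed
  moreover have "(\<lambda>k. measure lborel (E k)) \<longlonglongrightarrow> measure lborel (\<Inter>k. E k)"
    by (rule Lim_measure_decseq[OF _ dec fin]) (use cl in auto)
  ultimately have "(\<lambda>k. measure lborel (E k)) \<longlonglongrightarrow> 0"
    using J(3) by (simp add: null_sets_def measure_def)
  hence "eventually (\<lambda>k. measure lborel (E k) < e) sequentially"
    using e by (rule order_tendstoD(2))
  then obtain k where "\<forall>n\<ge>k. measure lborel (E n) < e" unfolding eventually_sequentially by (rule exE)
  hence "measure lborel (E k) < e" by simp
  hence "emeasure lborel (E k) \<le> ennreal e"
    using fin[of k] by (subst emeasure_eq_ennreal_measure) (auto intro: ennreal_leI)
  thus ?thesis using cl[of k] by (intro that[of "1 / real (Suc k)"]) (auto simp: E_def)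
qed

text \<open>
  Fine inscribed polygons of a rectifiable Jordan curve. Away from the curve their winding numbers
  agree with those of the curve. Near the curve they are dominated by the winding kernel,
  whose integral over a small neighbourhood is small with a bound that depends on the length only.
  The orientation is chosen so that the flux approximates the integral over the inside.
\<close>

lemma inscribed_polygon_flux:
  fixes l :: "real \<Rightarrow> real"
  assumes P: "smooth_plane P" and sp: "simple_path \<gamma>" "pathfinish \<gamma> = pathstart \<gamma>"
    and l: "\<And>s t. 0 \<le> s \<Longrightarrow> s \<le> t \<Longrightarrow> t \<le> 1 \<Longrightarrow> dist (\<gamma> s) (\<gamma> t) \<le> l t - l s"
    and null: "path_image \<gamma> \<in> null_sets lborel"
    and \<epsilon>: "\<epsilon> > 0" and F: "finite F" "F \<subseteq> path_image \<gamma>"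
  obtains us where "us \<noteq> []" "F \<subseteq> set us" "chain_sum dist (cycle us) \<le> l 1 - l 0"
    "\<bar>chain_sum (flux P) (cycle us) - set_lebesgue_integral lborel (inside (path_image \<gamma>)) (laplacian P)\<bar> \<le> \<epsilon>"
proof -
  define J where "J = path_image \<gamma>"
  define A where "A = inside J"
  define I where "I = set_lebesgue_integral lborel A (laplacian P)"
  define L where "L = l 1 - l 0"
  note jor = Jordan_inside_outside[OF sp, folded J_def, folded A_def]
  have path: "path \<gamma>" using sp(1) by (rule simple_path_imp_path)
  have J: "compact J" "J \<noteq> {}" unfolding J_def using path by (auto intro: compact_path_image)
  have L0: "L \<ge> 0" using l[of 0 1] zero_le_dist[of "\<gamma> 0" "\<gamma> 1"] unfolding L_def by linarith
  have "bounded (A \<union> J)" using jor J(1) by (auto intro: compact_imp_bounded)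
  then obtain M where M: "\<And>w. w \<in> A \<union> J \<Longrightarrow> norm w \<le> M" unfolding bounded_iff by blast
  define c where "c = - M - 1"
  have c: "c < Im w" if "w \<in> A \<union> J" for w
    using M[OF that] abs_Im_le_cmod[of w] unfolding c_def by linarith
  obtain \<sigma> :: real where \<sigma>: "\<sigma> = 1 \<or> \<sigma> = -1" "\<And>z. z \<in> A \<Longrightarrow> winding_number \<gamma> z = of_real \<sigma>"
  proof (rule simple_closed_path_winding_number_inside[OF sp(1), folded J_def, folded A_def])
    assume "\<And>z. z \<in> A \<Longrightarrow> winding_number \<gamma> z = 1"
    thus thesis using that[of 1] by simp
  next
    assume "\<And>z. z \<in> A \<Longrightarrow> winding_number \<gamma> z = -1"
    thus thesis using that[of "-1"] by simp
  qed
  have "compact (laplacian P ` cball 0 (M + 1))"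
    by (intro compact_continuous_image continuous_on_laplacian P) simp
  hence "bounded (laplacian P ` cball 0 (M + 1))" by (rule compact_imp_bounded)
  then obtain K0 where K0: "\<forall>y\<in>laplacian P ` cball 0 (M + 1). norm y \<le> K0"
    unfolding bounded_iff by (rule exE)
  define K where "K = max K0 1"
  have K: "\<bar>laplacian P w\<bar> \<le> K" if "w \<in> cball 0 (M + 1)" for w
    using bspec[OF K0 imageI[OF that]] by (simp add: K_def)
  have K1: "K \<ge> 1" by (simp add: K_def)
  \<comment> \<open>The kernel contributes at most \<open>K L (4 \<pi> r + e / r)\<close> for a neighbourhood of measure \<open>e\<close>, and the inside at most \<open>K e\<close>:
    half of \<open>\<epsilon>\<close> is spent on \<open>r\<close>, then half on \<open>e\<close>.\<close>
  define r where "r = \<epsilon> / (2 * K * (4 * pi * L + 1))"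
  have r: "r > 0" using \<epsilon> K1 L0 by (auto simp: r_def intro!: divide_pos_pos mult_pos_pos add_nonneg_pos)
  define e where "e = \<epsilon> / (2 * K * (L / r + 1))"
  have e: "e > 0" using \<epsilon> K1 L0 r by (auto simp: e_def intro!: divide_pos_pos mult_pos_pos add_nonneg_pos)
  obtain d where d: "d > 0" "d \<le> 1" "{w. infdist w J \<le> d} \<in> sets lborel"
    "emeasure lborel {w. infdist w J \<le> d} \<le> ennreal e"
    using measure_neighbourhood_null_compact[OF J null[folded J_def] e] by blast
  define E where "E = {w. infdist w J \<le> d}"
  have Em: "E \<in> sets lborel" and Ee: "emeasure lborel E \<le> ennreal e" using d by (simp_all add: E_def)
  have E_cball: "w \<in> cball 0 (M + 1)" if "w \<in> E" for w
  proof -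
    obtain x where x: "x \<in> J" "infdist w J = dist w x"
      using infdist_attains_inf[OF compact_imp_closed[OF J(1)] J(2)] by blast
    have "norm w \<le> norm x + dist w x" using norm_triangle_sub[of w x] by (simp add: dist_norm)
    thus ?thesis using M[of x] x that d(2) by (simp add: E_def)
  qed
  have budget: "K * (L * (4 * pi * r + 1 / r * e) + e) \<le> \<epsilon>"
  proof -
    have 1: "K * (4 * pi * L * r) \<le> \<epsilon> / 2"
    proof -
      have "K * (4 * pi * L + 1) * r = \<epsilon> / 2"
      proof -
        have "2 * K * (4 * pi * L + 1) \<noteq> 0" using K1 L0 by (auto intro!: less_imp_neq[symmetric] add_nonneg_pos)
        thus ?thesis unfolding r_def by (simp add: field_simps)
      qed
      moreover have "K * (4 * pi * L * r) \<le> K * (4 * pi * L + 1) * r"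
        using K1 r by (simp add: algebra_simps)
      ultimately show ?thesis by simp
    qed
    have 2: "K * (L / r + 1) * e = \<epsilon> / 2"
    proof -
      have "2 * K * (L / r + 1) \<noteq> 0" using K1 L0 r by (auto intro!: less_imp_neq[symmetric] add_nonneg_pos divide_nonneg_pos)
      thus ?thesis unfolding e_def by (simp add: field_simps)
    qed
    have "K * (L * (4 * pi * r + 1 / r * e) + e) = K * (4 * pi * L * r) + K * (L / r + 1) * e"
      by (simp add: algebra_simps)
    thus ?thesis using 1 2 by simp
  qed
  have "uniformly_continuous_on {0..1} \<gamma>"
    using path by (intro compact_uniformly_continuous) (auto simp: path_def)
  from this[unfolded uniformly_continuous_on_def, THEN spec, THEN mp, of "d / 2"]
  obtain \<mu> where uc: "\<mu> > 0 \<and> (\<forall>x\<in>{0..1}. \<forall>y\<in>{0..1}. dist y x < \<mu> \<longrightarrow> dist (\<gamma> y) (\<gamma> x) < d / 2)"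
    using d(1) by auto
  have \<mu>: "dist (\<gamma> y) (\<gamma> x) < d / 2" if "x \<in> {0..1}" "y \<in> {0..1}" "dist y x < \<mu>" for x y
    using bspec[OF bspec[OF conjunct2[OF uc] that(1)] that(2)] that(3) by (rule mp)
  obtain F' where F': "F' \<subseteq> {0..1}" "finite F'" "F = \<gamma> ` F'"
    using finite_subset_image[OF F[unfolded path_image_def]] by blast
  have "\<mu> / 2 > 0" using uc by simp
  then obtain ts where ts: "gaps_le (\<mu> / 2) ts" "length ts \<ge> 2" "hd ts = 0" "last ts = 1" "F' \<subseteq> set ts" "set ts \<subseteq> {0..1}"
    using fine_partition_through[OF _ F'(2,1)] by blast
  define vs where "vs = map \<gamma> ts"
  have ts0: "ts \<noteq> []" using ts(2) by auto
  have vs: "vs \<noteq> []" "hd vs = last vs" "length vs \<ge> 2" "set vs \<subseteq> J" "F \<subseteq> set vs"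
    using ts ts0 sp(2) F'(3) by (auto simp: vs_def hd_map last_map pathstart_def pathfinish_def J_def path_image_def)
  have len: "chain_sum dist vs \<le> L"
    using chain_sum_dist_inscribed[OF l ts(1) ts0 ts(6)] ts(3,4) by (simp add: vs_def L_def)
  have wn: "chain_sum (\<lambda>a b. winding_number (linepath a b) w) vs = winding_number \<gamma> w" if "w \<notin> E" for w
  proof -
    have far: "d < infdist w J" using that by (simp add: E_def)
    hence "w \<notin> J" using d(1) by auto
    hence "chain_sum (\<lambda>a b. winding_number (linepath a b) w) vs = winding_number (subpath (hd ts) (last ts) \<gamma>) w"
      unfolding vs_def
    proof (intro winding_number_inscribed[OF path _ _ ts(1) ts0 ts(6)])
      fix s t u :: real
      assume "s \<in> {0..1}" "t \<in> {0..1}" "s \<le> t" "t - s \<le> \<mu> / 2" "u \<in> {s..t}"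
      hence "dist (\<gamma> s) (\<gamma> u) < d / 2" using \<open>\<mu> / 2 > 0\<close> by (intro \<mu>) (auto simp: dist_real_def)
      thus "2 * dist (\<gamma> s) (\<gamma> u) < infdist w (path_image \<gamma>)" using far by (simp add: J_def)
    qed (simp add: J_def)
    thus ?thesis by (simp add: ts)
  qed
  define cr where "cr = (\<lambda>w. chain_sum (\<lambda>a b. crossing a b w) vs)"
  \<comment> \<open>The integral of \<open>X\<close> is the error to be estimated; \<open>X\<close> vanishes almost everywhere off the neighbourhood \<open>E\<close>.\<close>
  define X where "X = (\<lambda>w. indicator {w. c < Im w} w * (laplacian P w * cr w) + \<sigma> * (indicator A w * laplacian P w))"
  have cvs: "c < Im v" if "v \<in> set vs" for v using c vs(4) that by auto
  have Ab: "A \<in> sets borel" using jor by simp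
  have intA: "integrable lborel (\<lambda>w. indicator A w * laplacian P w)"
    using set_integrable_continuous_bounded[OF continuous_on_laplacian[OF P] Ab] jor
    by (simp add: set_integrable_def)
  have green: "(\<integral>w. indicator {w. c < Im w} w * (laplacian P w * cr w) \<partial>lborel) = chain_sum (flux P) vs"
    "integrable lborel (\<lambda>w. indicator {w. c < Im w} w * (laplacian P w * cr w))"
    unfolding cr_def using green_closed_chain[OF P vs(1,2), of c] cvs by blast+
  have intX: "integrable lborel X" unfolding X_def using green(2) intA by simp
  have "integral\<^sup>L lborel X = chain_sum (flux P) vs + \<sigma> * I"
    unfolding X_def using green intA by (simp add: I_def set_lebesgue_integral_def)
  hence "ennreal \<bar>chain_sum (flux P) vs + \<sigma> * I\<bar> = ennreal (norm (integral\<^sup>L lborel X))" by simp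
  also have "\<dots> \<le> (\<integral>\<^sup>+w. ennreal (norm (X w)) \<partial>lborel)"
    by (rule integral_norm_bound_ennreal[OF intX])
  also have "\<dots> \<le> (\<integral>\<^sup>+w. ennreal K * (chain_sum (\<lambda>a b. winding_kernel a b w) vs * indicator E w + indicator E w) \<partial>lborel)"
  proof (rule nn_integral_mono_AE)
    show "AE w in lborel. ennreal (norm (X w)) \<le>
      ennreal K * (chain_sum (\<lambda>a b. winding_kernel a b w) vs * indicator E w + indicator E w)"
      using AE_chain_winding_number_crossing[OF vs(1,2)] AE_chain_crossing_le_kernel[OF vs(1,2)]
    proof eventually_elim
      case (elim w)
      show ?case
      proof (cases "w \<in> E")
        case False
        have "cr w = - Re (winding_number \<gamma> w)"
          using elim(1) wn[OF False] by (simp add: cr_def Re_chain_sum[symmetric])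
        moreover have "w \<notin> J" using False d(1) by (auto simp: E_def)
        ultimately have "X w = 0"
        proof (cases "w \<in> A")
          case True
          thus ?thesis using \<open>cr w = _\<close> \<sigma>(2)[OF True] c[of w] by (simp add: X_def)
        next
          case False
          hence "w \<in> outside J" using jor \<open>w \<notin> J\<close> by auto
          hence "winding_number \<gamma> w = 0"
            using winding_number_zero_in_outside[OF path sp(2)] by (simp add: J_def)
          thus ?thesis using \<open>cr w = _\<close> False by (simp add: X_def)
        qed
        thus ?thesis by simp
      next
        case True
        have lap: "\<bar>laplacian P w\<bar> \<le> K" using K E_cball[OF True] by simp
        have "\<bar>X w\<bar> \<le> \<bar>laplacian P w\<bar> * (\<bar>cr w\<bar> + 1)"
        proof -
          have "\<bar>X w\<bar> \<le> \<bar>indicator {w. c < Im w} w * (laplacian P w * cr w)\<bar> + \<bar>\<sigma> * (indicator A w * laplacian P w)\<bar>"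
            unfolding X_def by (rule abs_triangle_ineq)
          also have "\<bar>indicator {w. c < Im w} w * (laplacian P w * cr w)\<bar> \<le> \<bar>laplacian P w\<bar> * \<bar>cr w\<bar>"
            by (simp add: indicator_def abs_mult)
          also have "\<bar>\<sigma> * (indicator A w * laplacian P w)\<bar> \<le> \<bar>laplacian P w\<bar>"
            using \<sigma>(1) by (auto simp: indicator_def abs_mult)
          finally show ?thesis by (simp add: distrib_left)
        qed
        also have "\<dots> \<le> K * (\<bar>cr w\<bar> + 1)" using lap by (intro mult_right_mono) auto
        finally have "ennreal (norm (X w)) \<le> ennreal (K * (\<bar>cr w\<bar> + 1))" by (intro ennreal_leI) simp
        also have "\<dots> = ennreal K * (ennreal \<bar>cr w\<bar> + 1)"
          using K1 by (simp add: ennreal_mult)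
        also have "\<dots> \<le> ennreal K * (chain_sum (\<lambda>a b. winding_kernel a b w) vs + 1)"
          using elim(2) by (intro mult_left_mono add_right_mono) (auto simp: cr_def)
        finally show ?thesis using True by simp
      qed
    qed
  qed
  also have "\<dots> = ennreal K * ((\<integral>\<^sup>+w. chain_sum (\<lambda>a b. winding_kernel a b w) vs * indicator E w \<partial>lborel) + emeasure lborel E)"
  proof -
    have m: "(\<lambda>w. chain_sum (\<lambda>a b. winding_kernel a b w) us) \<in> borel_measurable lborel" for us
      by (induction us rule: induct_list012) auto
    have m1: "(\<lambda>w. chain_sum (\<lambda>a b. winding_kernel a b w) vs * indicator E w) \<in> borel_measurable lborel"
      by (intro borel_measurable_times_ennreal m borel_measurable_indicator Em)
    have m2: "(\<lambda>w. indicator E w :: ennreal) \<in> borel_measurable lborel"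
      by (intro borel_measurable_indicator Em)
    show ?thesis
      by (subst nn_integral_cmult[OF borel_measurable_add[OF m1 m2]])
         (simp add: nn_integral_add[OF m1 m2] nn_integral_indicator[OF Em])
  qed
  also have "\<dots> \<le> ennreal K * (ennreal L * (ennreal (4 * pi * r) + ennreal (1 / r) * ennreal e) + ennreal e)"
  proof (intro mult_left_mono add_mono Ee)
    have "(\<integral>\<^sup>+w. chain_sum (\<lambda>a b. winding_kernel a b w) vs * indicator E w \<partial>lborel) \<le>
      ennreal (chain_sum dist vs) * (ennreal (4 * pi * r) + ennreal (1 / r) * emeasure lborel E)"
      by (rule nn_integral_chain_winding_kernel_le[OF r Em])
    also have "\<dots> \<le> ennreal L * (ennreal (4 * pi * r) + ennreal (1 / r) * ennreal e)"
      using len Ee by (intro mult_mono add_mono mult_left_mono ennreal_leI) auto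
    finally show "(\<integral>\<^sup>+w. chain_sum (\<lambda>a b. winding_kernel a b w) vs * indicator E w \<partial>lborel) \<le>
      ennreal L * (ennreal (4 * pi * r) + ennreal (1 / r) * ennreal e)" .
  qed auto
  also have "\<dots> = ennreal (K * (L * (4 * pi * r + 1 / r * e) + e))"
    using K1 L0 r e by (simp add: ennreal_mult[symmetric] ennreal_plus[symmetric] del: ennreal_plus)
  also have "\<dots> \<le> ennreal \<epsilon>" using budget by (rule ennreal_leI)
  finally have main: "\<bar>chain_sum (flux P) vs + \<sigma> * I\<bar> \<le> \<epsilon>" using \<epsilon> by (simp add: ennreal_le_iff)
  define ws where "ws = (if \<sigma> = 1 then rev vs else vs)"
  have ws: "length ws \<ge> 2" "hd ws = last ws" "set ws = set vs"
    using vs by (auto simp: ws_def hd_rev last_rev)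
  have "chain_sum (flux P) (rev vs) = - chain_sum (flux P) vs"
  proof -
    have "chain_sum (\<lambda>a b. flux P b a) vs = chain_sum (\<lambda>a b. (-1) * flux P a b) vs"
    proof (rule chain_sum_cong)
      show "flux P b a = (-1) * flux P a b" for a b using flux_swap[OF P, of b a] by simp
    qed
    thus ?thesis unfolding chain_sum_rev chain_sum_mult_left by simp
  qed
  hence "\<bar>chain_sum (flux P) ws - I\<bar> \<le> \<epsilon>" using main \<sigma>(1) by (auto simp: ws_def)
  moreover have "chain_sum dist ws \<le> L"
    using len chain_sum_rev[of dist vs] by (simp add: ws_def dist_commute)
  ultimately show ?thesis
    using cycle_butlast[OF ws(1,2)] ws(3) vs(5)
    by (intro that[of "butlast ws"]) (auto simp: L_def I_def A_def J_def)
qed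

section \<open>Tours of stockyards\<close>

text \<open>
  A connected open set whose frontier is a Jordan curve is one of the two components of the complement of
  the curve. The outside is excluded because it is not simply connected.
\<close>

lemma pen_eq_inside:
  assumes pen: "pen A" and sp: "simple_path \<gamma>" "pathfinish \<gamma> = pathstart \<gamma>" and fr: "path_image \<gamma> = frontier A"
  shows "A = inside (path_image \<gamma>)"
proof -
  define J where "J = path_image \<gamma>"
  have A: "open A" "connected A" "simply_connected A" using pen by (auto simp: pen_def)
  note jor = Jordan_inside_outside[OF sp, folded J_def]
  have frJ: "frontier A = J" using fr by (simp add: J_def)
  have J0: "J \<noteq> {}" by (simp add: J_def)
  have A0: "A \<noteq> {}" using J0 frJ by auto
  have AJ: "A \<inter> J = {}" using A(1) frontier_disjoint_eq[of A] frJ by (simp add: Int_commute)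
  note io = inside_Int_outside[of J] inside_Un_outside[of J] inside_no_overlap[of J] outside_no_overlap[of J]
  have eq: "A = C" if "A \<inter> C \<noteq> {}" "connected C" "C \<inter> J = {}" "open C" "C \<union> D = - J" "C \<inter> D = {}" "open D" for C D
  proof -
    have "C \<subseteq> A"
      using connected_Int_frontier[OF that(2), of A] that(1,3) frJ by blast
    moreover have "A \<subseteq> C"
      using connectedD[OF A(2) that(4) that(7)] that(1,5,6) AJ by blast
    ultimately show ?thesis by blast
  qed
  have "A \<inter> inside J \<noteq> {} \<or> A \<inter> outside J \<noteq> {}" using A0 AJ io(2) by blast
  thus ?thesis
  proof
    assume "A \<inter> inside J \<noteq> {}"
    hence "A = inside J" using jor io by (intro eq[of "inside J" "outside J"]) simp_all
    thus ?thesis by (simp add: J_def)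
  next
    assume "A \<inter> outside J \<noteq> {}"
    hence AO: "A = outside J" using jor io by (intro eq[of "outside J" "inside J"]) (simp_all add: Un_commute Int_commute)
    have "- A = inside J \<union> J" using AO io by blast
    moreover have "bounded J" unfolding J_def using sp(1) by (intro bounded_simple_path_image)
    ultimately have bd: "bounded (- A)" using jor by simp
    have "inside A = {}" using A simply_connected_eq_empty_inside[OF A(1)] by blast
    moreover have "J \<subseteq> inside A"
    proof
      fix x assume "x \<in> J"
      hence "x \<notin> A" using AJ by blast
      moreover have "bounded (connected_component_set (- A) x)"
        using bd connected_component_subset by (rule bounded_subset)
      ultimately show "x \<in> inside A" by (simp add: inside_def)
    qed
    ultimately show ?thesis using J0 by blast
  qed
qed

text \<open>
  The tour is a fine polygon inscribed in the boundary curve that has the prescribed points among its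
  vertices; a rotation moves its start to \<open>x\<close>.
\<close>

lemma pen_tour:
  assumes P: "smooth_plane P" and pen: "pen A" and per: "perimeter A < ennreal q"
    and \<epsilon>: "\<epsilon> > 0" and F: "finite F" "F \<subseteq> frontier A" and x: "x \<in> frontier A"
  obtains us where "us \<noteq> []" "hd us = x" "F \<subseteq> set us" "2 * chain_sum dist (cycle us) \<le> q"
    "\<bar>chain_sum (flux P) (cycle us) - set_lebesgue_integral lborel A (laplacian P)\<bar> \<le> \<epsilon>"
proof -
  obtain \<gamma> where \<gamma>: "FPWS_path \<gamma>" "simple_path \<gamma>" "pathfinish \<gamma> = pathstart \<gamma>" "path_image \<gamma> = frontier A"
    "curve_length \<gamma> < ennreal q"
    using per unfolding perimeter_def INF_less_iff by blast
  have q: "q \<ge> 0" using \<gamma>(5) by (cases "q \<ge> 0") (auto simp: ennreal_neg)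
  obtain l :: "real \<Rightarrow> real" where l: "\<And>s t. 0 \<le> s \<Longrightarrow> s \<le> t \<Longrightarrow> t \<le> 1 \<Longrightarrow> dist (\<gamma> s) (\<gamma> t) \<le> l t - l s"
    "2 * (l 1 - l 0) \<le> q" "path_image \<gamma> \<in> null_sets lborel"
    using FPWS_path_arc_length[OF \<gamma>(1) less_imp_le[OF \<gamma>(5)] q] by blast
  have F': "finite (insert x F)" "insert x F \<subseteq> path_image \<gamma>" using F x \<gamma>(4) by auto
  obtain us where us: "us \<noteq> []" "insert x F \<subseteq> set us" "chain_sum dist (cycle us) \<le> l 1 - l 0"
    "\<bar>chain_sum (flux P) (cycle us) - set_lebesgue_integral lborel (inside (path_image \<gamma>)) (laplacian P)\<bar> \<le> \<epsilon>"
    using inscribed_polygon_flux[OF P \<gamma>(2,3) l(1,3) \<epsilon> F'] by blast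
  obtain i where i: "i < length us" "us ! i = x" using us(2) by (auto simp: in_set_conv_nth)
  show ?thesis
  proof (rule that[of "rotate i us"])
    show "hd (rotate i us) = x" using hd_rotate_conv_nth[OF us(1), of i] i by simp
    show "2 * chain_sum dist (cycle (rotate i us)) \<le> q"
      unfolding chain_sum_cycle_rotate using us(3) l(2) by simp
    show "\<bar>chain_sum (flux P) (cycle (rotate i us)) - set_lebesgue_integral lborel A (laplacian P)\<bar> \<le> \<epsilon>"
      unfolding chain_sum_cycle_rotate using us(4) pen_eq_inside[OF pen \<gamma>(2-4)] by simp
  qed (use us in auto)
qed

lemma perimeter_finite_frontier:
  assumes "perimeter A < \<infinity>"
  shows "frontier A \<noteq> {}"
proof -
  obtain \<gamma> where "path_image \<gamma> = frontier A" "simple_path \<gamma>"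
    using assms unfolding perimeter_def INF_less_iff by blast
  thus ?thesis using path_image_nonempty[of \<gamma>] by auto
qed

lemma insert_tour:
  assumes us: "us \<noteq> []" "x \<in> set us" and ws: "ws \<noteq> []" "hd ws = x"
  obtains vs where "vs \<noteq> []" "hd vs = hd us" "set vs = set us \<union> set ws"
    "\<And>f :: 'a \<Rightarrow> 'a \<Rightarrow> real. chain_sum f (cycle vs) = chain_sum f (cycle us) + chain_sum f (cycle ws)"
proof -
  obtain U W where U: "us = U @ x # W" using us(2) by (auto simp: in_set_conv_decomp)
  obtain ws' where ws': "ws = x # ws'" using ws by (cases ws) auto
  \<comment> \<open>As \<open>ws\<close> starts with \<open>x\<close>, this runs to \<open>x\<close>, through \<open>ws\<close> back to \<open>x\<close>, and on.\<close>
  define vs where "vs = U @ ws @ x # W"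
  have hd: "hd vs = hd us" by (cases U) (auto simp: vs_def U ws')
  have "chain_sum f (cycle vs) = chain_sum f (cycle us) + chain_sum f (cycle ws)" for f :: "'a \<Rightarrow> 'a \<Rightarrow> real"
  proof -
    have "chain_sum f (cycle vs) = chain_sum f (U @ x # (ws' @ x # (W @ [hd us])))"
      unfolding cycle_def hd by (simp add: vs_def ws')
    also have "\<dots> = chain_sum f (U @ [x]) + chain_sum f ((x # ws') @ x # (W @ [hd us]))"
      by (subst chain_sum_append) simp
    also have "\<dots> = chain_sum f (U @ [x]) + (chain_sum f ((x # ws') @ [x]) + chain_sum f (x # W @ [hd us]))"
      by (subst (2) chain_sum_append) simp
    also have "\<dots> = (chain_sum f (U @ [x]) + chain_sum f (x # W @ [hd us])) + chain_sum f (cycle ws)"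
      by (simp add: cycle_def ws')
    also have "chain_sum f (U @ [x]) + chain_sum f (x # W @ [hd us]) = chain_sum f (U @ x # (W @ [hd us]))"
      by (subst (2) chain_sum_append) simp
    also have "U @ x # (W @ [hd us]) = cycle us" by (simp add: cycle_def U)
    finally show ?thesis .
  qed
  thus ?thesis by (intro that[of vs]) (use hd in \<open>auto simp: vs_def U ws'\<close>)
qed

text \<open>
  The boundaries of a stockyard are traversed by one closed polygon. By connectedness the pens can be
  added one after the other, each touching the union of the previous ones, and the tour of the new
  pen is inserted at a common point. The points at which later tours will be inserted must
  already be vertices of the earlier ones; therefore the claim \<open>good K\<close> in the induction prescribes an arbitrary
  finite set of points through which the tour passes.
\<close>

lemma stockyard_tour:
  assumes P: "smooth_plane P" and R: "R \<in> stockyards z0 \<delta>" and \<delta>: "\<delta> > 0" and \<epsilon>: "\<epsilon> > 0" and \<eta>: "\<eta> > 0"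
  obtains us where "us \<noteq> []" "hd us = z0" "2 * chain_sum dist (cycle us) \<le> \<delta> + \<eta>"
    "chain_sum (flux P) (cycle us) \<ge> (\<Sum>A\<leftarrow>R. set_lebesgue_integral lborel A (laplacian P)) - \<epsilon>"
proof -
  define N where "N = length R"
  define J where "J = (\<lambda>i. frontier (R ! i))"
  define I where "I = (\<lambda>i. set_lebesgue_integral lborel (R ! i) (laplacian P))"
  define p where "p = (\<lambda>i. enn2real (perimeter (R ! i)))"
  have pens: "pen (R ! i)" if "i < N" for i using R that by (auto simp: stockyards_def N_def)
  have un: "(\<Union>A\<in>set R. frontier A) = (\<Union>i<N. J i)"
  proof -
    have "set R = (!) R ` {..<N}" by (auto simp: N_def set_conv_nth)
    thus ?thesis by (simp add: J_def)
  qed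
  have z0: "z0 \<in> (\<Union>i<N. J i)" and conn: "connected (\<Union>i<N. J i)"
    and per: "(\<Sum>A\<leftarrow>R. perimeter A) \<le> ennreal \<delta>"
    using R un unfolding stockyards_def by auto
  have sums: "(\<Sum>A\<leftarrow>R. perimeter A) = (\<Sum>i<N. perimeter (R ! i))"
    "(\<Sum>A\<leftarrow>R. set_lebesgue_integral lborel A (laplacian P)) = (\<Sum>i<N. I i)"
    by (simp_all add: sum_list_sum_nth N_def I_def atLeast0LessThan)
  have fin: "perimeter (R ! i) < \<infinity>" if "i < N" for i
  proof -
    have "perimeter (R ! i) \<le> (\<Sum>i<N. perimeter (R ! i))" using that by (intro member_le_sum) auto
    also have "\<dots> \<le> ennreal \<delta>" using per sums(1) by simp
    also have "\<dots> < \<infinity>" by simp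
    finally show ?thesis .
  qed
  have p0: "p i \<ge> 0" for i by (simp add: p_def)
  have pe: "perimeter (R ! i) = ennreal (p i)" if "i < N" for i
    using fin[OF that] by (simp add: p_def less_top[symmetric])
  have psum: "(\<Sum>i<N. p i) \<le> \<delta>"
  proof -
    have "ennreal (\<Sum>i<N. p i) = (\<Sum>i<N. ennreal (p i))"
      by (rule sum_ennreal[symmetric]) (rule p0)
    also have "\<dots> = (\<Sum>i<N. perimeter (R ! i))" by (intro sum.cong refl) (simp add: pe)
    also have "\<dots> \<le> ennreal \<delta>" using per sums(1) by simp
    finally show ?thesis using \<delta> by (simp add: ennreal_le_iff)
  qed
  define good where "good = (\<lambda>K. \<forall>\<eta>>0. \<forall>\<epsilon>>0. \<forall>F. finite F \<longrightarrow> F \<subseteq> (\<Union>i\<in>K. J i) \<longrightarrow>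
    (\<exists>us. us \<noteq> [] \<and> hd us = z0 \<and> F \<subseteq> set us \<and> 2 * chain_sum dist (cycle us) \<le> (\<Sum>i\<in>K. p i) + \<eta> \<and>
      chain_sum (flux P) (cycle us) \<ge> (\<Sum>i\<in>K. I i) - \<epsilon>))"
  have tour: "\<exists>us. us \<noteq> [] \<and> hd us = x \<and> F \<subseteq> set us \<and> 2 * chain_sum dist (cycle us) \<le> p i + \<eta> \<and>
      chain_sum (flux P) (cycle us) \<ge> I i - \<epsilon>"
    if i: "i < N" and x: "x \<in> J i" and F: "finite F" "F \<subseteq> J i" and pos: "\<eta> > 0" "\<epsilon> > 0" for i x F \<eta> \<epsilon>
  proof -
    have "perimeter (R ! i) < ennreal (p i + \<eta>)"
      unfolding pe[OF i] using p0[of i] pos by (simp add: ennreal_less_iff)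
    from pen_tour[OF P pens[OF i] this pos(2) F(1) F(2)[unfolded J_def] x[unfolded J_def]]
    obtain us where us: "us \<noteq> []" "hd us = x" "F \<subseteq> set us" "2 * chain_sum dist (cycle us) \<le> p i + \<eta>"
      "\<bar>chain_sum (flux P) (cycle us) - set_lebesgue_integral lborel (R ! i) (laplacian P)\<bar> \<le> \<epsilon>" by blast
    have "chain_sum (flux P) (cycle us) \<ge> I i - \<epsilon>" using us(5) unfolding I_def by linarith
    thus ?thesis using us by blast
  qed
  obtain i0 where i0: "i0 < N" "z0 \<in> J i0" using z0 by auto
  have good0: "good {i0}"
    unfolding good_def using tour[OF i0] by simp
  have step: "\<exists>j<N. j \<notin> K \<and> good (insert j K)" if K: "K \<subseteq> {..<N}" "i0 \<in> K" "good K" "K \<noteq> {..<N}" for K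
  proof -
    have Kfin: "finite K" using K(1) finite_subset by blast
    have "\<exists>j<N. j \<notin> K \<and> J j \<inter> (\<Union>i\<in>K. J i) \<noteq> {}"
    proof (rule ccontr)
      assume none: "\<not> ?thesis"
      define X where "X = (\<Union>i\<in>K. J i)"
      define Y where "Y = (\<Union>i\<in>{..<N} - K. J i)"
      have cl: "closed X" "closed Y" unfolding X_def Y_def J_def using Kfin by (auto intro: closed_UN)
      have XY: "X \<union> Y = (\<Union>i<N. J i)" using K(1) unfolding X_def Y_def by blast
      have dis: "X \<inter> Y = {}" using none unfolding X_def Y_def by blast
      have X0: "X \<noteq> {}" using i0 K(2) by (auto simp: X_def)
      have Y0: "Y \<noteq> {}"
      proof -
        obtain j where "j < N" "j \<notin> K" using K(1,4) by blast
        thus ?thesis using perimeter_finite_frontier[OF fin[of j]] by (auto simp: Y_def J_def)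
      qed
      have "X \<inter> (X \<union> Y) = {} \<or> Y \<inter> (X \<union> Y) = {}"
        by (rule connected_closedD[OF conn[folded XY] _ _ cl]) (use dis in auto)
      thus False using X0 Y0 by auto
    qed
    then obtain j x where j: "j < N" "j \<notin> K" and x: "x \<in> J j" "x \<in> (\<Union>i\<in>K. J i)" by blast
    have "good (insert j K)"
      unfolding good_def
    proof (intro allI impI)
      fix \<eta> \<epsilon> :: real and F
      assume pos: "\<eta> > 0" "\<epsilon> > 0" and F: "finite F" "F \<subseteq> (\<Union>i\<in>insert j K. J i)"
      have h: "\<eta> / 2 > 0" "\<epsilon> / 2 > 0" using pos by auto
      have F1: "finite (insert x (F \<inter> (\<Union>i\<in>K. J i)))" "insert x (F \<inter> (\<Union>i\<in>K. J i)) \<subseteq> (\<Union>i\<in>K. J i)"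
        using F x by auto
      obtain us where us: "us \<noteq> []" "hd us = z0" "insert x (F \<inter> (\<Union>i\<in>K. J i)) \<subseteq> set us"
        "2 * chain_sum dist (cycle us) \<le> (\<Sum>i\<in>K. p i) + \<eta> / 2"
        "chain_sum (flux P) (cycle us) \<ge> (\<Sum>i\<in>K. I i) - \<epsilon> / 2"
        using K(3)[unfolded good_def, rule_format, OF h F1] by blast
      have F2: "finite (F \<inter> J j)" "F \<inter> J j \<subseteq> J j" using F by auto
      obtain ws where ws: "ws \<noteq> []" "hd ws = x" "F \<inter> J j \<subseteq> set ws"
        "2 * chain_sum dist (cycle ws) \<le> p j + \<eta> / 2"
        "chain_sum (flux P) (cycle ws) \<ge> I j - \<epsilon> / 2"
        using tour[OF j(1) x(1) F2 h] by blast
      have xu: "x \<in> set us" using us(3) by simp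
      obtain vs where vs: "vs \<noteq> []" "hd vs = hd us" "set vs = set us \<union> set ws"
        "\<And>f :: complex \<Rightarrow> complex \<Rightarrow> real. chain_sum f (cycle vs) = chain_sum f (cycle us) + chain_sum f (cycle ws)"
        using insert_tour[OF us(1) xu ws(1,2)] by blast
      have "F \<subseteq> set vs" using F(2) us(3) ws(3) unfolding vs(3) by blast
      moreover have "2 * chain_sum dist (cycle vs) \<le> (\<Sum>i\<in>insert j K. p i) + \<eta>"
        unfolding vs(4) using us(4) ws(4) j(2) Kfin by simp
      moreover have "chain_sum (flux P) (cycle vs) \<ge> (\<Sum>i\<in>insert j K. I i) - \<epsilon>"
        unfolding vs(4) using us(5) ws(5) j(2) Kfin by simp
      ultimately show "\<exists>us. us \<noteq> [] \<and> hd us = z0 \<and> F \<subseteq> set us \<and>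
        2 * chain_sum dist (cycle us) \<le> (\<Sum>i\<in>insert j K. p i) + \<eta> \<and>
        chain_sum (flux P) (cycle us) \<ge> (\<Sum>i\<in>insert j K. I i) - \<epsilon>"
        using vs(1,2) us(2) by (intro exI[of _ vs]) auto
    qed
    thus ?thesis using j by blast
  qed
  have "\<exists>K. K \<subseteq> {..<N} \<and> i0 \<in> K \<and> good K \<and> card K = Suc m" if "m < N" for m
    using that
  proof (induction m)
    case 0
    thus ?case using good0 i0 by (intro exI[of _ "{i0}"]) auto
  next
    case (Suc m)
    then obtain K where K: "K \<subseteq> {..<N}" "i0 \<in> K" "good K" "card K = Suc m" by auto
    have "K \<noteq> {..<N}" using K(4) Suc.prems by auto
    then obtain j where j: "j < N" "j \<notin> K" "good (insert j K)" using step[OF K(1-3)] by blast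
    moreover have "finite K" using K(1) finite_subset by blast
    ultimately show ?case using K by (intro exI[of _ "insert j K"]) auto
  qed
  from this[of "N - 1"] i0 obtain K where K: "K \<subseteq> {..<N}" "good K" "card K = N" by auto
  hence "K = {..<N}" by (intro card_subset_eq) auto
  hence "good {..<N}" using K(2) by simp
  from this[unfolded good_def, rule_format, OF \<eta> \<epsilon>, of "{}"]
  obtain us where "us \<noteq> []" "hd us = z0" "2 * chain_sum dist (cycle us) \<le> (\<Sum>i<N. p i) + \<eta>"
    "chain_sum (flux P) (cycle us) \<ge> (\<Sum>i<N. I i) - \<epsilon>" by auto
  thus ?thesis using psum sums(2) by (intro that[of us]) auto
qed

section \<open>Closed polygons as curves of \<open>\<Lambda>\<close>\<close>

lemma dist_hd_le_chain_sum: "v \<in> set vs \<Longrightarrow> dist (hd vs) v \<le> chain_sum dist vs"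
proof (induction vs rule: induct_list012)
  case (3 a b vs)
  show ?case
  proof (cases "v = a")
    case True
    thus ?thesis using chain_sum_dist_nonneg[of "a # b # vs"] by simp
  next
    case False
    hence "dist b v \<le> chain_sum dist (b # vs)" using 3 by auto
    thus ?thesis using dist_triangle[of a v b] by simp
  qed
qed auto

lemma chain_sum_map: "chain_sum f (map g vs) = chain_sum (\<lambda>a b. f (g a) (g b)) vs"
  by (induction vs rule: induct_list012) auto

lemma chain_sum_abs_diff_le:
  fixes f g :: "complex \<Rightarrow> complex \<Rightarrow> real"
  assumes "\<And>a b. a \<in> set vs \<Longrightarrow> b \<in> set vs \<Longrightarrow> \<bar>f a b - g a b\<bar> \<le> \<omega> * dist a b"
  shows "\<bar>chain_sum f vs - chain_sum g vs\<bar> \<le> \<omega> * chain_sum dist vs"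
  using assms
proof (induction vs rule: induct_list012)
  case (3 a b vs)
  have "\<bar>f a b - g a b\<bar> \<le> \<omega> * dist a b" using 3(3) by simp
  moreover have "\<bar>chain_sum f (b # vs) - chain_sum g (b # vs)\<bar> \<le> \<omega> * chain_sum dist (b # vs)"
    using 3(3) by (intro 3(2)) auto
  ultimately show ?case by (simp add: distrib_left)
qed auto

definition shrink :: "complex \<Rightarrow> real \<Rightarrow> complex \<Rightarrow> complex" where
  "shrink z0 \<theta> z = z0 + of_real (1 - \<theta>) * (z - z0)"

text \<open>
  The flux of the shrunk polygon is a line integral along the original polygon, whose integrand depends
  on the shrinking factor uniformly continuously. The factor works for all polygons through
  \<open>z0\<close> of bounded length at once.
\<close>

lemma flux_shrink_continuous:
  assumes P: "smooth_plane P" and \<epsilon>: "\<epsilon> > 0" and D: "D > 0"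
  obtains \<theta> where "0 < \<theta>" "\<theta> < 1"
    "\<And>us. us \<noteq> [] \<Longrightarrow> hd us = z0 \<Longrightarrow> chain_sum dist (cycle us) \<le> D \<Longrightarrow>
      \<bar>chain_sum (flux P) (cycle (map (shrink z0 \<theta>) us)) - chain_sum (flux P) (cycle us)\<bar> \<le> \<epsilon>"
proof -
  define \<omega> where "\<omega> = \<epsilon> / D"
  have \<omega>: "\<omega> > 0" using \<epsilon> D by (simp add: \<omega>_def)
  let ?F = "flux_field P"
  define H where "H = (\<lambda>q::real \<times> complex. of_real (1 - fst q) * ?F (shrink z0 (fst q) (snd q)))"
  have "continuous_on UNIV (\<lambda>q::real \<times> complex. ?F (shrink z0 (fst q) (snd q)))"
    unfolding shrink_def
    by (rule continuous_on_compose2[OF continuous_on_flux_field[OF P, of UNIV]]) (auto intro!: continuous_intros)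
  hence "continuous_on UNIV H" unfolding H_def by (intro continuous_intros)
  hence "uniformly_continuous_on ({0..1} \<times> cball z0 D) H"
    by (intro compact_uniformly_continuous compact_Times) (auto intro: continuous_on_subset)
  from this[unfolded uniformly_continuous_on_def, THEN spec, THEN mp, OF \<omega>]
  obtain \<rho> where uc: "\<rho> > 0 \<and> (\<forall>x\<in>{0..1} \<times> cball z0 D. \<forall>y\<in>{0..1} \<times> cball z0 D. dist y x < \<rho> \<longrightarrow> dist (H y) (H x) < \<omega>)"
    by (rule exE)
  have \<rho>0: "\<rho> > 0" using uc by (rule conjunct1)
  have \<rho>: "dist (H y) (H x) < \<omega>" if "x \<in> {0..1} \<times> cball z0 D" "y \<in> {0..1} \<times> cball z0 D" "dist y x < \<rho>" for x y
    using bspec[OF bspec[OF conjunct2[OF uc] that(1)] that(2)] that(3) by (rule mp)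
  define \<theta> where "\<theta> = min (\<rho> / 2) (1 / 2)"
  have \<theta>: "0 < \<theta>" "\<theta> < 1" "\<theta> < \<rho>" using \<rho>0 by (auto simp: \<theta>_def)
  have close: "norm (of_real (1 - \<theta>) * ?F (shrink z0 \<theta> z) - ?F z) \<le> \<omega>" if "z \<in> cball z0 D" for z
  proof -
    have "dist (H (\<theta>, z)) (H (0, z)) < \<omega>"
      using that \<theta> by (intro \<rho>) (auto simp: dist_Pair_Pair)
    thus ?thesis by (simp add: H_def shrink_def dist_norm)
  qed
  have edge: "\<bar>flux P (shrink z0 \<theta> a) (shrink z0 \<theta> b) - flux P a b\<bar> \<le> \<omega> * dist a b"
    if ab: "a \<in> cball z0 D" "b \<in> cball z0 D" for a b
  proof -
    let ?G = "\<lambda>z. of_real (1 - \<theta>) * ?F (shrink z0 \<theta> z)"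
    have Gc: "continuous_on A ?G" for A
    proof -
      have "continuous_on A (\<lambda>z. ?F (shrink z0 \<theta> z))"
        unfolding shrink_def
        by (rule continuous_on_compose2[OF continuous_on_flux_field[OF P, of UNIV]]) (auto intro!: continuous_intros)
      thus ?thesis by (intro continuous_intros)
    qed
    have lin: "linepath (shrink z0 \<theta> a) (shrink z0 \<theta> b) t = shrink z0 \<theta> (linepath a b t)" for t
      by (simp add: shrink_def linepath_def scaleR_conv_of_real algebra_simps)
    have dif: "shrink z0 \<theta> b - shrink z0 \<theta> a = of_real (1 - \<theta>) * (b - a)"
      by (simp add: shrink_def algebra_simps)
    have "(?F has_contour_integral contour_integral (linepath (shrink z0 \<theta> a) (shrink z0 \<theta> b)) ?F)
      (linepath (shrink z0 \<theta> a) (shrink z0 \<theta> b))"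
      by (intro has_contour_integral_integral contour_integrable_continuous_linepath continuous_on_flux_field P)
    hence "(?G has_contour_integral contour_integral (linepath (shrink z0 \<theta> a) (shrink z0 \<theta> b)) ?F) (linepath a b)"
      unfolding has_contour_integral_linepath lin dif by (simp add: mult_ac)
    moreover have "(?F has_contour_integral contour_integral (linepath a b) ?F) (linepath a b)"
      by (intro has_contour_integral_integral contour_integrable_continuous_linepath continuous_on_flux_field P)
    ultimately have "((\<lambda>z. ?G z - ?F z) has_contour_integral
      (contour_integral (linepath (shrink z0 \<theta> a) (shrink z0 \<theta> b)) ?F - contour_integral (linepath a b) ?F)) (linepath a b)"
      by (rule has_contour_integral_diff)
    hence "norm (contour_integral (linepath (shrink z0 \<theta> a) (shrink z0 \<theta> b)) ?F - contour_integral (linepath a b) ?F)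
      \<le> \<omega> * norm (b - a)"
    proof (rule has_contour_integral_bound_linepath)
      show "0 \<le> \<omega>" using \<omega> by simp
      fix z assume "z \<in> closed_segment a b"
      hence "z \<in> cball z0 D" using closed_segment_subset[OF ab] by auto
      thus "norm (?G z - ?F z) \<le> \<omega>" by (rule close)
    qed
    from order_trans[OF abs_Re_le_cmod this] show ?thesis
      by (simp add: flux_def dist_norm norm_minus_commute[of b a])
  qed
  have "\<bar>chain_sum (flux P) (cycle (map (shrink z0 \<theta>) us)) - chain_sum (flux P) (cycle us)\<bar> \<le> \<epsilon>"
    if us: "us \<noteq> []" "hd us = z0" "chain_sum dist (cycle us) \<le> D" for us
  proof -
    have "cycle (map (shrink z0 \<theta>) us) = map (shrink z0 \<theta>) (cycle us)"
      using us(1) by (simp add: cycle_def hd_map)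
    hence "\<bar>chain_sum (flux P) (cycle (map (shrink z0 \<theta>) us)) - chain_sum (flux P) (cycle us)\<bar> =
      \<bar>chain_sum (\<lambda>a b. flux P (shrink z0 \<theta> a) (shrink z0 \<theta> b)) (cycle us) - chain_sum (flux P) (cycle us)\<bar>"
      by (simp add: chain_sum_map)
    also have "\<dots> \<le> \<omega> * chain_sum dist (cycle us)"
    proof (rule chain_sum_abs_diff_le)
      have "hd (cycle us) = z0" using us by (simp add: cycle_def)
      hence "v \<in> cball z0 D" if "v \<in> set (cycle us)" for v
        using dist_hd_le_chain_sum[OF that] us(3) by simp
      thus "\<bar>flux P (shrink z0 \<theta> a) (shrink z0 \<theta> b) - flux P a b\<bar> \<le> \<omega> * dist a b"
        if "a \<in> set (cycle us)" "b \<in> set (cycle us)" for a b using that by (intro edge)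
    qed
    also have "\<dots> \<le> \<omega> * D" using us(3) \<omega> by (intro mult_left_mono) auto
    finally show ?thesis using D by (simp add: \<omega>_def)
  qed
  with \<theta> show ?thesis using that by blast
qed

definition step_function :: "(nat \<Rightarrow> real) \<Rightarrow> nat \<Rightarrow> (nat \<Rightarrow> real) \<Rightarrow> real \<Rightarrow> real" where
  "step_function a n c t = (\<Sum>k<n. c k * indicator {a k..<a (Suc k)} t)"

lemma step_function_eq:
  assumes a: "breakpoints a n" and k: "k < n" and t: "a k \<le> t" "t < a (Suc k)"
  shows "step_function a n c t = c k"
proof -
  have "indicator {a j..<a (Suc j)} t = (if j = k then 1 else 0 :: real)" if "j < n" for j
    using breakpoints_mono[OF a, of "Suc j" k] breakpoints_mono[OF a, of "Suc k" j] that k t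
    by (cases "j < k"; cases "j = k") (auto simp: indicator_def)
  hence "step_function a n c t = (\<Sum>k'<n. if k' = k then c k' else 0)"
    unfolding step_function_def by (intro sum.cong) auto
  thus ?thesis using k by simp
qed

lemma step_function_at_1:
  assumes a: "breakpoints a n"
  shows "step_function a n c 1 = 0"
  unfolding step_function_def
  using breakpoints_in_01(2)[OF a, of "Suc _"] by (intro sum.neutral) (force simp: indicator_def Suc_le_eq)

lemma FPWS_step_function:
  assumes a: "breakpoints a n"
  shows "FPWS (step_function a n c)"
  by (rule FPWS_piecewise_affine[OF a, of _ c "\<lambda>_. 0"]) (use step_function_eq[OF a] in auto)

lemma step_function_integral:
  assumes a: "breakpoints a n" and k: "k < n" and g: "\<And>k. k < n \<Longrightarrow> c k = (y (Suc k) - y k) / (a (Suc k) - a k)"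
    and t: "a k \<le> t" "t \<le> a (Suc k)"
  shows "(step_function a n c has_integral (y k - y 0 + (t - a k) * c k)) {0..t}"
proof -
  have piece: "(step_function a n c has_integral (s - a j) * c j) {a j..s}" if "j < n" "a j \<le> s" "s \<le> a (Suc j)" for j s
  proof -
    have "((\<lambda>_. c j) has_integral (s - a j) * c j) {a j..s}"
      using has_integral_const_real[of "c j" "a j" s] that by simp
    thus ?thesis
      by (rule has_integral_spike_finite[of "{s}", rotated 2])
         (use step_function_eq[OF a] that in \<open>auto intro!: step_function_eq[OF a]\<close>)
  qed
  have full: "(step_function a n c has_integral (y m - y 0)) {0..a m}" if "m \<le> n" for m
    using that
  proof (induction m)
    case 0
    thus ?case using a has_integral_refl(2)[of "step_function a n c" 0] by (simp add: breakpoints_def)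
  next
    case (Suc m)
    have pos: "a m < a (Suc m)" using a Suc.prems by (simp add: breakpoints_def)
    have "(a (Suc m) - a m) * c m = y (Suc m) - y m" using g[of m] Suc.prems pos by simp
    hence "(step_function a n c has_integral (y (Suc m) - y m)) {a m..a (Suc m)}"
      using piece[of m "a (Suc m)"] Suc.prems pos by simp
    from has_integral_combine[OF _ _ Suc.IH this]
    show ?case using pos breakpoints_in_01[OF a, of m] Suc.prems by simp
  qed
  show ?thesis
    by (rule has_integral_combine[OF _ t(1) full piece]) (use k t breakpoints_in_01[OF a, of k] in auto)
qed

text \<open>
  A closed polygon shorter than \<open>\<delta> / 2\<close> is the curve of a pair of step functions. Each edge is given time
  proportional to its length plus a small constant, so that the subdivision is strict
  even if some edges have length 0.
\<close>

lemma polygon_Lambda_curve: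
  assumes P: "smooth_plane P" and us: "us \<noteq> []" "hd us = z0" and len: "chain_sum dist (cycle us) < \<delta> / 2"
  shows "\<exists>\<alpha> \<beta>. (\<alpha>, \<beta>) \<in> Xstar \<and> Lambda_curve P z0 \<delta> \<alpha> \<beta> = chain_sum (flux P) (cycle us)"
proof -
  define n where "n = length us"
  define v where "v = (\<lambda>k. cycle us ! k)"
  have n0: "n > 0" using us by (simp add: n_def)
  have lc: "length (cycle us) = Suc n" by (simp add: cycle_def n_def)
  have cs: "chain_sum f (cycle us) = (\<Sum>k<n. f (v k) (v (Suc k)))" for f :: "complex \<Rightarrow> complex \<Rightarrow> real"
    unfolding chain_sum_conv_nth lc v_def by simp
  have v0: "v 0 = z0" "v n = z0"
    using us n0 by (auto simp: v_def cycle_def nth_append n_def hd_conv_nth)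
  define d where "d = (\<lambda>k. dist (v k) (v (Suc k)))"
  define L where "L = (\<Sum>k<n. d k)"
  have L: "L < \<delta> / 2" using len cs by (simp add: L_def d_def)
  have L0: "L \<ge> 0" by (simp add: L_def d_def sum_nonneg)
  have \<delta>: "\<delta> > 0" using L L0 by simp
  \<comment> \<open>Half of the spare length is distributed over the edges; \<open>T\<close> bounds the speed.\<close>
  define \<eta> where "\<eta> = (\<delta> / 2 - L) / (2 * real n)"
  have \<eta>: "\<eta> > 0" using L n0 by (simp add: \<eta>_def)
  define T where "T = L + real n * \<eta>"
  have T: "0 < T" "T < \<delta> / 2"
  proof -
    have "real n * \<eta> = (\<delta> / 2 - L) / 2" using n0 by (simp add: \<eta>_def)
    thus "0 < T" "T < \<delta> / 2" unfolding T_def using L L0 by simp_all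
  qed
  define a where "a = (\<lambda>k. (\<Sum>j<k. d j + \<eta>) / T)"
  have gap: "a (Suc k) - a k = (d k + \<eta>) / T" for k
    by (simp add: a_def add_divide_distrib)
  have dk: "d k \<ge> 0" for k by (simp add: d_def)
  have pos: "a k < a (Suc k)" for k
  proof -
    have "(d k + \<eta>) / T > 0" using dk[of k] \<eta> T(1) by simp
    thus ?thesis using gap[of k] by simp
  qed
  have bp: "breakpoints a n"
    unfolding breakpoints_def using n0 pos T(1) by (simp add: a_def sum.distrib L_def T_def)
  define c where "c = (\<lambda>k. (v (Suc k) - v k) / of_real (a (Suc k) - a k))"
  have cspeed: "norm (c k) < \<delta> / 2" for k
  proof -
    have "norm (c k) = d k / ((d k + \<eta>) / T)"
      using dk[of k] \<eta> T(1) unfolding c_def gap by (simp add: norm_divide d_def dist_norm norm_minus_commute del: of_real_add of_real_divide)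
    also have "\<dots> \<le> T" using dk[of k] \<eta> T(1) by (simp add: field_simps)
    finally show ?thesis using T(2) by simp
  qed
  define cr where "cr = (\<lambda>k. (Re (v (Suc k)) - Re (v k)) / (a (Suc k) - a k))"
  define ci where "ci = (\<lambda>k. (Im (v (Suc k)) - Im (v k)) / (a (Suc k) - a k))"
  have c_eq: "c k = Complex (cr k) (ci k)" for k
    by (simp add: c_def cr_def ci_def complex_eq_iff del: of_real_diff)
  define \<alpha> where "\<alpha> = step_function a n (\<lambda>k. 2 / \<delta> * cr k)"
  define \<beta> where "\<beta> = step_function a n (\<lambda>k. - (2 / \<delta>) * ci k)"
  have \<alpha>k: "\<alpha> t = 2 / \<delta> * cr k" and \<beta>k: "\<beta> t = - (2 / \<delta>) * ci k"
    if "k < n" "a k \<le> t" "t < a (Suc k)" for k t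
    unfolding \<alpha>_def \<beta>_def by (rule step_function_eq[OF bp that])+
  have i\<alpha>: "(\<alpha> has_integral (2 / \<delta> * Re (v k) - 2 / \<delta> * Re (v 0) + (t - a k) * (2 / \<delta> * cr k))) {0..t}"
    and i\<beta>: "(\<beta> has_integral (- (2 / \<delta>) * Im (v k) - - (2 / \<delta>) * Im (v 0) + (t - a k) * (- (2 / \<delta>) * ci k))) {0..t}"
    if "k < n" "a k \<le> t" "t \<le> a (Suc k)" for k t
    unfolding \<alpha>_def \<beta>_def
    by (rule step_function_integral[OF bp that(1) _ that(2,3), where y = "\<lambda>k. 2 / \<delta> * Re (v k)"],
        simp add: cr_def right_diff_distrib)
       (rule step_function_integral[OF bp that(1) _ that(2,3), where y = "\<lambda>k. - (2 / \<delta>) * Im (v k)"],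
        simp add: ci_def right_diff_distrib diff_divide_distrib)
  define m where "m = n - 1"
  have m: "m < n" "Suc m = n" using n0 by (auto simp: m_def)
  have am: "a (Suc m) = 1" using bp m(2) by (simp add: breakpoints_def)
  have X: "(\<alpha>, \<beta>) \<in> Xstar"
  proof -
    have "\<bar>\<alpha> t\<bar>\<^sup>2 + \<bar>\<beta> t\<bar>\<^sup>2 < 1" if t: "t \<in> {0..1}" for t
    proof (cases "t = 1")
      case True
      thus ?thesis using step_function_at_1[OF bp] by (simp add: \<alpha>_def \<beta>_def)
    next
      case False
      then obtain k where k: "k < n" "a k \<le> t" "t < a (Suc k)" using breakpoints_cases[OF bp, of t] t by auto
      have "(norm (c k))\<^sup>2 < (\<delta> / 2)\<^sup>2" using cspeed[of k] by (intro power_strict_mono) auto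
      hence "(2 / \<delta>)\<^sup>2 * ((cr k)\<^sup>2 + (ci k)\<^sup>2) < (2 / \<delta>)\<^sup>2 * (\<delta> / 2)\<^sup>2"
        using \<delta> by (intro mult_strict_left_mono) (simp_all add: c_eq cmod_power2)
      also have "(2 / \<delta>)\<^sup>2 * (\<delta> / 2)\<^sup>2 = 1" using \<delta> by (simp add: power_mult_distrib[symmetric])
      finally have "(2 / \<delta>)\<^sup>2 * ((cr k)\<^sup>2 + (ci k)\<^sup>2) < 1" .
      moreover have "(2 / \<delta> * cr k)\<^sup>2 + (- (2 / \<delta>) * ci k)\<^sup>2 = (2 / \<delta>)\<^sup>2 * ((cr k)\<^sup>2 + (ci k)\<^sup>2)"
        by (simp add: power2_eq_square algebra_simps)
      ultimately show ?thesis unfolding \<alpha>k[OF k] \<beta>k[OF k] power2_abs by simp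
    qed
    moreover have "integral {0..1} \<alpha> = 0"
    proof -
      have "(1 - a m) * cr m = Re (v n) - Re (v m)" using pos[of m] m am by (simp add: cr_def)
      hence "2 / \<delta> * Re (v m) - 2 / \<delta> * Re (v 0) + (1 - a m) * (2 / \<delta> * cr m) = 0"
        using v0 by (simp add: mult.left_commute[of "1 - a m"] right_diff_distrib diff_divide_distrib)
      thus ?thesis using i\<alpha>[OF m(1), of 1] pos[of m] am by (simp add: integral_unique)
    qed
    moreover have "integral {0..1} \<beta> = 0"
    proof -
      have "(1 - a m) * ci m = Im (v n) - Im (v m)" using pos[of m] m am by (simp add: ci_def)
      hence "- (2 / \<delta>) * Im (v m) - - (2 / \<delta>) * Im (v 0) + (1 - a m) * (- (2 / \<delta>) * ci m) = 0"
        using v0 by (simp add: mult.left_commute[of "1 - a m"] right_diff_distrib diff_divide_distrib)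
      thus ?thesis using i\<beta>[OF m(1), of 1] pos[of m] am by (simp add: integral_unique)
    qed
    ultimately show ?thesis
      unfolding Xstar_def using FPWS_step_function[OF bp] by (auto simp: \<alpha>_def \<beta>_def)
  qed
  have curve: "gamma1 z0 \<delta> \<alpha> t = Re (v k) + (t - a k) * cr k" "gamma2 z0 \<delta> \<beta> t = Im (v k) + (t - a k) * ci k"
    if "k < n" "a k \<le> t" "t \<le> a (Suc k)" for k t
  proof -
    have "\<delta> / 2 * (2 / \<delta> * x - 2 / \<delta> * y + s * (2 / \<delta> * z)) = x - y + s * z"
      "\<delta> / 2 * (- (2 / \<delta>) * x - - (2 / \<delta>) * y + s * (- (2 / \<delta>) * z)) = - (x - y + s * z)" for x y s z
      using \<delta> by (simp_all add: field_simps)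
    thus "gamma1 z0 \<delta> \<alpha> t = Re (v k) + (t - a k) * cr k" "gamma2 z0 \<delta> \<beta> t = Im (v k) + (t - a k) * ci k"
      unfolding gamma1_def gamma2_def integral_unique[OF i\<alpha>[OF that]] integral_unique[OF i\<beta>[OF that]]
      by (simp_all only: v0)
  qed
  let ?G = "\<lambda>r. pd_y P (Complex (gamma1 z0 \<delta> \<alpha> r) (gamma2 z0 \<delta> \<beta> r)) * deriv (gamma1 z0 \<delta> \<alpha>) r -
       pd_x P (Complex (gamma1 z0 \<delta> \<alpha> r) (gamma2 z0 \<delta> \<beta> r)) * deriv (gamma2 z0 \<delta> \<beta>) r"
  have "(?G has_integral flux P (v k) (v (Suc k))) {a k..a (Suc k)}" if k: "k < n" for k
  proof -
    define g where "g = (\<lambda>r. pd_y P (Complex (Re (v k) + (r - a k) * cr k) (Im (v k) + (r - a k) * ci k)) * cr k -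
      pd_x P (Complex (Re (v k) + (r - a k) * cr k) (Im (v k) + (r - a k) * ci k)) * ci k)"
    have "(g has_integral flux P (v k) (v (Suc k))) {a k..a (Suc k)}"
    proof (subst has_integral_unit_interval_iff[OF pos, symmetric], rule has_integral_eq[OF _ flux_has_integral[OF P]])
      fix t :: real
      have e: "(a (Suc k) - a k) * cr k = Re (v (Suc k)) - Re (v k)" "(a (Suc k) - a k) * ci k = Im (v (Suc k)) - Im (v k)"
        using pos[of k] by (simp_all add: cr_def ci_def)
      have l: "linepath (v k) (v (Suc k)) t = Complex (Re (v k) + t * (a (Suc k) - a k) * cr k) (Im (v k) + t * (a (Suc k) - a k) * ci k)"
        unfolding mult.assoc e by (simp add: complex_eq_iff linepath_def algebra_simps)
      show "pd_y P (linepath (v k) (v (Suc k)) t) * Re (v (Suc k) - v k) - pd_x P (linepath (v k) (v (Suc k)) t) * Im (v (Suc k) - v k)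
        = (a (Suc k) - a k) *\<^sub>R g (a k + t * (a (Suc k) - a k))"
        unfolding l g_def minus_complex.sel e[symmetric] by (simp add: algebra_simps)
    qed
    thus ?thesis
    proof (rule has_integral_spike_finite[of "{a k, a (Suc k)}", rotated 2])
      fix r assume "r \<in> {a k..a (Suc k)} - {a k, a (Suc k)}"
      hence r: "a k < r" "r < a (Suc k)" by auto
      have "(gamma1 z0 \<delta> \<alpha> has_real_derivative cr k) (at r)"
      proof (rule has_field_derivative_transform_within_open[where S = "{a k<..<a (Suc k)}"])
        show "((\<lambda>t. Re (v k) + (t - a k) * cr k) has_real_derivative cr k) (at r)"
          by (auto intro!: derivative_eq_intros)
      qed (use r curve(1)[OF k] in auto)
      moreover have "(gamma2 z0 \<delta> \<beta> has_real_derivative ci k) (at r)"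
      proof (rule has_field_derivative_transform_within_open[where S = "{a k<..<a (Suc k)}"])
        show "((\<lambda>t. Im (v k) + (t - a k) * ci k) has_real_derivative ci k) (at r)"
          by (auto intro!: derivative_eq_intros)
      qed (use r curve(2)[OF k] in auto)
      ultimately show "?G r = g r"
        using curve[OF k, of r] r by (simp add: g_def DERIV_imp_deriv)
    qed simp
  qed
  hence "(?G has_integral (\<Sum>k<n. flux P (v k) (v (Suc k)))) {0..1}"
    by (rule has_integral_breakpoints[OF bp])
  hence "Lambda_curve P z0 \<delta> \<alpha> \<beta> = chain_sum (flux P) (cycle us)"
    unfolding Lambda_curve_def cs by (rule integral_unique)
  with X show ?thesis by blast
qed

text \<open>
  The tour of a stockyard may be slightly longer than \<open>\<delta> / 2\<close>. Shrinking it towards \<open>z0\<close> makes it a curve of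
  \<open>\<Lambda>\<close>, at a small cost in flux.
\<close>

lemma stockyards_le_Lambda:
  assumes P: "smooth_plane P" and \<delta>: "\<delta> > 0"
  shows "(SUP R\<in>stockyards z0 \<delta>. ereal (\<Sum>A\<leftarrow>R. set_lebesgue_integral lborel A (laplacian P))) \<le>
    Lambda P (z0, t0) \<delta>"
proof (rule SUP_least, rule ereal_le_epsilon2)
  fix R and \<epsilon> :: real assume R: "R \<in> stockyards z0 \<delta>" and \<epsilon>: "0 < \<epsilon>"
  let ?V = "\<Sum>A\<leftarrow>R. set_lebesgue_integral lborel A (laplacian P)"
  have e2: "\<epsilon> / 2 > 0" using \<epsilon> by simp
  obtain \<theta> where \<theta>: "0 < \<theta>" "\<theta> < 1"
    "\<And>us. us \<noteq> [] \<Longrightarrow> hd us = z0 \<Longrightarrow> chain_sum dist (cycle us) \<le> \<delta> \<Longrightarrow>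
      \<bar>chain_sum (flux P) (cycle (map (shrink z0 \<theta>) us)) - chain_sum (flux P) (cycle us)\<bar> \<le> \<epsilon> / 2"
    using flux_shrink_continuous[OF P e2 \<delta>, of z0] by blast
  \<comment> \<open>The excess is chosen such that \<open>(1 - \<theta>) * (\<delta> + \<eta>) < \<delta>\<close>.\<close>
  define \<eta> where "\<eta> = \<theta> * \<delta>"
  have \<eta>: "\<eta> > 0" using \<theta>(1) \<delta> by (simp add: \<eta>_def)
  obtain us where us: "us \<noteq> []" "hd us = z0" "2 * chain_sum dist (cycle us) \<le> \<delta> + \<eta>"
    "chain_sum (flux P) (cycle us) \<ge> ?V - \<epsilon> / 2"
    using stockyard_tour[OF P R \<delta> e2 \<eta>] by blast
  define ws where "ws = map (shrink z0 \<theta>) us"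
  have ws: "ws \<noteq> []" "hd ws = z0" using us(1,2) by (auto simp: ws_def hd_map shrink_def)
  have "\<eta> \<le> 1 * \<delta>" unfolding \<eta>_def using \<theta>(2) \<delta> by (intro mult_right_mono) auto
  hence "chain_sum dist (cycle us) \<le> \<delta>" using us(3) by simp
  hence fl: "\<bar>chain_sum (flux P) (cycle ws) - chain_sum (flux P) (cycle us)\<bar> \<le> \<epsilon> / 2"
    unfolding ws_def by (rule \<theta>(3)[OF us(1,2)])
  have "chain_sum dist (cycle ws) = (1 - \<theta>) * chain_sum dist (cycle us)"
  proof -
    have "dist (shrink z0 \<theta> a) (shrink z0 \<theta> b) = (1 - \<theta>) * dist a b" for a b
    proof -
      have "shrink z0 \<theta> a - shrink z0 \<theta> b = of_real (1 - \<theta>) * (a - b)" by (simp add: shrink_def algebra_simps)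
      thus ?thesis using \<theta>(2) by (simp add: dist_norm norm_mult del: of_real_diff)
    qed
    moreover have "cycle ws = map (shrink z0 \<theta>) (cycle us)" using us(1) by (simp add: ws_def cycle_def hd_map)
    ultimately show ?thesis by (simp add: chain_sum_map chain_sum_mult_left)
  qed
  also have "\<dots> \<le> (1 - \<theta>) * (\<delta> / 2 * (1 + \<theta>))"
    using us(3) \<theta>(2) by (intro mult_left_mono) (auto simp: \<eta>_def algebra_simps)
  also have "\<dots> = \<delta> / 2 - \<delta> / 2 * (\<theta> * \<theta>)"
  proof -
    have "(1 - \<theta>) * (y * (1 + \<theta>)) = y - y * (\<theta> * \<theta>)" for y by (simp add: algebra_simps)
    thus ?thesis .
  qed
  also have "\<dots> < \<delta> / 2" using \<theta>(1) \<delta> by simp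
  finally have len: "chain_sum dist (cycle ws) < \<delta> / 2" .
  obtain \<alpha> \<beta> where ab: "(\<alpha>, \<beta>) \<in> Xstar" "Lambda_curve P z0 \<delta> \<alpha> \<beta> = chain_sum (flux P) (cycle ws)"
    using polygon_Lambda_curve[OF P ws len] by blast
  have "?V \<le> \<bar>Lambda_curve P z0 \<delta> \<alpha> \<beta>\<bar> + \<epsilon>" using us(4) fl ab(2) by linarith
  hence s2: "ereal ?V \<le> ereal \<bar>Lambda_curve P z0 \<delta> \<alpha> \<beta>\<bar> + ereal \<epsilon>" by simp
  have s1: "ereal \<bar>Lambda_curve P z0 \<delta> \<alpha> \<beta>\<bar> \<le> Lambda P (z0, t0) \<delta>"
    unfolding Lambda_def fst_conv using SUP_upper[OF ab(1), of "\<lambda>(\<alpha>, \<beta>). ereal \<bar>Lambda_curve P z0 \<delta> \<alpha> \<beta>\<bar>"] by simp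
  show "ereal ?V \<le> Lambda P (z0, t0) \<delta> + ereal \<epsilon>"
    by (rule order_trans[OF s2 add_right_mono[OF s1]])
qed

section \<open>The stockyard formula\<close>

theorem theorem1p1:
  fixes P :: "complex \<Rightarrow> real" and z0 :: complex and t0 \<delta> :: real
  assumes "smooth_plane P" and "subharmonic P" and "\<not> harmonic P"
    and "boundary_point P (z0, t0) \<in> frontier (Omega P)"
    and "\<delta> > 0"
  shows "Lambda P (z0, t0) \<delta> =
    (SUP R\<in>stockyards z0 \<delta>. ereal (\<Sum>A\<leftarrow>R. set_lebesgue_integral lborel A (laplacian P)))"
proof (rule antisym)
  have L: "laplacian P z \<ge> 0" for z
    by (rule subharmonic_imp_laplacian_nonneg[OF assms(1,2)])
  show "Lambda P (z0, t0) \<delta> \<le>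
    (SUP R\<in>stockyards z0 \<delta>. ereal (\<Sum>A\<leftarrow>R. set_lebesgue_integral lborel A (laplacian P)))"
    by (rule Lambda_le_stockyards[OF assms(1) L assms(5)])
  show "(SUP R\<in>stockyards z0 \<delta>. ereal (\<Sum>A\<leftarrow>R. set_lebesgue_integral lborel A (laplacian P))) \<le>
    Lambda P (z0, t0) \<delta>"
    by (rule stockyards_le_Lambda[OF assms(1,5)])
qed

end
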